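(* Let $T>0$ be a rational multiple of $\pi$, let $S^1=\mathbb R/T\mathbb Z$ and $\Omega=[0,\pi]\times S^1$, and let $f:\Omega\times\mathbb R\to\mathbb R$ satisfy the following two conditions. $(f_1)$ $f\in C(\Omega\times\mathbb R,\mathbb R)$, and there exist $b\neq0$ and $l_F\in(0,|b|)$ such that, with $f_b(x,t,u):=f(x,t,u)-bu$, $$|f_b(x,t,u+v)-f_b(x,t,u)|\le l_F|v|\qquad\forall(x,t)\in\Omega,\ u,v\in\mathbb R.$$ $(f_2^\pm)$ There exist $g_\infty\in L^\infty(\Omega,\mathbb R)\cap\mathcal L_s(\mathbf H,-|b|,|b|)$ and constants $M_1,M_2,c>0$ such that $$|f_b(x,t,u)-g_\infty(x,t)u|\le M_1\qquad\forall(x,t,u)\in\Omega\times\mathbb R,$$ and, for one choice of the sign $\pm$, $$\pm\big(f_b(x,t,u)-g_\infty(x,t)u\big)\,u\ge c|u|\qquad\forall(x,t)\in\Omega,\ u\in\mathbb R\setminus[-M_2,M_2].$$ Then the problem $$u_{tt}-u_{xx}=f(x,t,u),\qquad u(0,t)=u(\pi,t)=0,\qquad u(x,t+T)=u(x,t)$$ has a weak solution.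
   Context: Write $T=2\pi q/p$ with coprime integers $p,q$. $\mathbf H=L^2$ is the real Hilbert space of functions on $\Omega$ of the form $u=\sum_{j\ge1,k\in\mathbb Z}u_{j,k}\sin(jx)\exp(ik\tfrac pq t)$ with $u_{j,k}\in\mathbb C$, $u_{j,k}=\overline{u_{j,-k}}$ and $\|u\|_2^2=\sum|u_{j,k}|^2<\infty$. $\Box$ is the unbounded self-adjoint operator $u_{tt}-u_{xx}$ on $\mathbf H$, acting on the Fourier mode $\sin(jx)\exp(ik\frac pq t)$ by multiplication with $j^2-p^2k^2/q^2$. A weak solution is $u\in D(\Box)\subset\mathbf H$ with $\Box u=f(\cdot,\cdot,u)$ in $\mathbf H$. $\mathcal L_s(\mathbf H,-|b|,|b|)$ is the set of bounded self-adjoint operators $B$ on $\mathbf H$ with $-|b|I<B<|b|I$, where $B<|b|I$ means that $(|b|-\delta)I-B$ is positive definite for some $\delta>0$, and $B>-|b|I$ is understood similarly. A function $g\in L^\infty(\Omega,\mathbb R)$ is identified with the multiplication operator $u\mapsto gu$ on $\mathbf H$. *)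

theory Defs
  imports "HOL-Analysis.Analysis"
begin

text \<open>
  Functions on \<open>\<Omega> = [0,\<pi>] \<times> \<real>/T\<int>\<close> are represented by functions on \<open>[0,\<pi>] \<times> \<real>\<close>
  that are \<open>T\<close>-periodic in the second variable; values for \<open>x\<close> outside \<open>[0,\<pi>]\<close> are
  irrelevant. Elements of \<open>L\<^sup>2\<close> and \<open>L\<^sup>\<infinity>\<close> are represented by functions, with equality
  almost everywhere on the fundamental domain \<open>[0,\<pi>] \<times> [0,T)\<close>.
\<close>

definition strip :: "(real \<times> real) set" where
  "strip = {0..pi} \<times> UNIV"

definition on_cylinder :: "real \<Rightarrow> (real \<times> real \<Rightarrow> 'a) \<Rightarrow> bool" where
  "on_cylinder T F \<longleftrightarrow> (\<forall>x\<in>{0..pi}. \<forall>t. F (x, t + T) = F (x, t))"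

definition Omega_measure :: "real \<Rightarrow> (real \<times> real) measure" where
  "Omega_measure T = lebesgue_on ({0..pi} \<times> {0..<T})"

definition period :: "int \<Rightarrow> int \<Rightarrow> real" where
  "period p q = 2 * pi * real_of_int q / real_of_int p"

abbreviation Omega :: "int \<Rightarrow> int \<Rightarrow> (real \<times> real) measure" where
  "Omega p q \<equiv> Omega_measure (period p q)"

definition Linf :: "int \<Rightarrow> int \<Rightarrow> (real \<times> real \<Rightarrow> real) set" where
  "Linf p q = {g. on_cylinder (period p q) g \<and> g \<in> borel_measurable (Omega p q) \<and>
     (\<exists>C. AE z in Omega p q. \<bar>g z\<bar> \<le> C)}"

definition modes :: "(nat \<times> int) set" where
  "modes = {1..} \<times> UNIV"

definition mode :: "int \<Rightarrow> int \<Rightarrow> nat \<Rightarrow> int \<Rightarrow> real \<times> real \<Rightarrow> complex" where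
  "mode p q j k = (\<lambda>(x, t). of_real (sin (real j * x)) *
     exp (\<i> * of_real (real_of_int k * (real_of_int p / real_of_int q) * t)))"

text \<open>
  \<open>expands p q u c\<close>: the real-valued function \<open>u\<close> is the sum, unconditionally in \<open>L\<^sup>2\<close>, of
  the series with coefficients \<open>c\<close>. Square integrability of \<open>u\<close> is required separately since
  the Bochner integral of a non-integrable function is \<open>0\<close>.
\<close>

definition expands ::
  "int \<Rightarrow> int \<Rightarrow> (real \<times> real \<Rightarrow> real) \<Rightarrow> (nat \<Rightarrow> int \<Rightarrow> complex) \<Rightarrow> bool" where
  "expands p q u c \<longleftrightarrow>
     on_cylinder (period p q) u \<and>
     u \<in> borel_measurable (Omega p q) \<and> integrable (Omega p q) (\<lambda>z. (u z)\<^sup>2) \<and>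
     (\<forall>j\<ge>1. \<forall>k. c j k = cnj (c j (- k))) \<and>
     (\<lambda>(j, k). (cmod (c j k))\<^sup>2) summable_on modes \<and>
     ((\<lambda>F. LINT z|Omega p q.
          (cmod (of_real (u z) - (\<Sum>(j, k)\<in>F. c j k * mode p q j k z)))\<^sup>2) \<longlongrightarrow> 0)
       (finite_subsets_at_top modes)"

definition HH :: "int \<Rightarrow> int \<Rightarrow> (real \<times> real \<Rightarrow> real) set" where
  "HH p q = {u. \<exists>c. expands p q u c}"

text \<open>The choice in \<open>coeffs\<close> is unique on the index set \<open>modes\<close>.\<close>

definition coeffs :: "int \<Rightarrow> int \<Rightarrow> (real \<times> real \<Rightarrow> real) \<Rightarrow> nat \<Rightarrow> int \<Rightarrow> complex" where
  "coeffs p q u = (SOME c. expands p q u c)"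

definition inner_H ::
  "int \<Rightarrow> int \<Rightarrow> (real \<times> real \<Rightarrow> real) \<Rightarrow> (real \<times> real \<Rightarrow> real) \<Rightarrow> real" where
  "inner_H p q u v = (\<Sum>\<^sub>\<infinity>(j, k)\<in>modes. Re (coeffs p q u j k * cnj (coeffs p q v j k)))"

definition norm_H :: "int \<Rightarrow> int \<Rightarrow> (real \<times> real \<Rightarrow> real) \<Rightarrow> real" where
  "norm_H p q u = sqrt (\<Sum>\<^sub>\<infinity>(j, k)\<in>modes. (cmod (coeffs p q u j k))\<^sup>2)"

type_synonym operator = "(real \<times> real \<Rightarrow> real) \<Rightarrow> real \<times> real \<Rightarrow> real"

definition bounded_selfadjoint :: "int \<Rightarrow> int \<Rightarrow> operator \<Rightarrow> bool" where
  "bounded_selfadjoint p q B \<longleftrightarrow>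
     (\<forall>u\<in>HH p q. B u \<in> HH p q) \<and>
     (\<forall>u\<in>HH p q. \<forall>v\<in>HH p q. (AE z in Omega p q. u z = v z) \<longrightarrow>
        (AE z in Omega p q. B u z = B v z)) \<and>
     (\<forall>u\<in>HH p q. \<forall>v\<in>HH p q. AE z in Omega p q. B (\<lambda>y. u y + v y) z = B u z + B v z) \<and>
     (\<forall>u\<in>HH p q. \<forall>r. AE z in Omega p q. B (\<lambda>y. r * u y) z = r * B u z) \<and>
     (\<exists>K. \<forall>u\<in>HH p q. norm_H p q (B u) \<le> K * norm_H p q u) \<and>
     (\<forall>u\<in>HH p q. \<forall>v\<in>HH p q. inner_H p q (B u) v = inner_H p q u (B v))"

definition positive_definite :: "int \<Rightarrow> int \<Rightarrow> operator \<Rightarrow> bool" where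
  "positive_definite p q A \<longleftrightarrow>
     (\<forall>u\<in>HH p q. \<not> (AE z in Omega p q. u z = 0) \<longrightarrow> inner_H p q (A u) u > 0)"

text \<open>\<open>Ls p q \<alpha> \<beta>\<close> is the set \<open>\<L>\<^sub>s(H,\<alpha>,\<beta>)\<close> of bounded self-adjoint \<open>B\<close> with \<open>\<alpha>I < B < \<beta>I\<close>.\<close>

definition Ls :: "int \<Rightarrow> int \<Rightarrow> real \<Rightarrow> real \<Rightarrow> operator set" where
  "Ls p q \<alpha> \<beta> = {B. bounded_selfadjoint p q B \<and>
     (\<exists>\<delta>>0. positive_definite p q (\<lambda>u z. B u z - (\<alpha> + \<delta>) * u z)) \<and>
     (\<exists>\<delta>>0. positive_definite p q (\<lambda>u z. (\<beta> - \<delta>) * u z - B u z))}"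

definition mult_op :: "(real \<times> real \<Rightarrow> real) \<Rightarrow> operator" where
  "mult_op g = (\<lambda>u z. g z * u z)"

definition box_eigenvalue :: "int \<Rightarrow> int \<Rightarrow> nat \<Rightarrow> int \<Rightarrow> real" where
  "box_eigenvalue p q j k =
     (real j)\<^sup>2 - (real_of_int p)\<^sup>2 * (real_of_int k)\<^sup>2 / (real_of_int q)\<^sup>2"

definition box_domain :: "int \<Rightarrow> int \<Rightarrow> (real \<times> real \<Rightarrow> real) set" where
  "box_domain p q = {u \<in> HH p q.
     (\<lambda>(j, k). (cmod (of_real (box_eigenvalue p q j k) * coeffs p q u j k))\<^sup>2)
       summable_on modes}"

text \<open>
  \<open>box_eq p q u w\<close> states \<open>\<box>u = w\<close> in \<open>H\<close>, that is, \<open>(u,w)\<close> lies in the graph of \<open>\<box>\<close>.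
  Since \<open>expands\<close> is invariant under changing the (periodic) function on a null set, this is
  an equation of classes.
\<close>

definition box_eq ::
  "int \<Rightarrow> int \<Rightarrow> (real \<times> real \<Rightarrow> real) \<Rightarrow> (real \<times> real \<Rightarrow> real) \<Rightarrow> bool" where
  "box_eq p q u w \<longleftrightarrow> u \<in> box_domain p q \<and>
     expands p q w (\<lambda>j k. of_real (box_eigenvalue p q j k) * coeffs p q u j k)"

definition weak_solution ::
  "int \<Rightarrow> int \<Rightarrow> (real \<times> real \<Rightarrow> real \<Rightarrow> real) \<Rightarrow> (real \<times> real \<Rightarrow> real) \<Rightarrow> bool" where
  "weak_solution p q f u \<longleftrightarrow> box_eq p q u (\<lambda>z. f z (u z))"

end

theory Submission
  imports Defs "HOL-Homology.Homology" "HOL-Real_Asymp.Real_Asymp"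
begin

text \<open>
  In an orthonormal basis of trigonometric modes the problem reads \<open>\<mu> x = N x\<close> in \<open>\<ell>\<^sup>2\<close>, where
  \<open>\<mu>\<close> is the diagonal operator of the eigenvalues of \<open>\<box> - b\<close> and \<open>N\<close> is the superposition
  operator of \<open>f\<^sub>b\<close>, with Lipschitz constant \<open>l < \<bar>b\<bar>\<close>. Only finitely many modes satisfy
  \<open>\<bar>\<mu>\<bar> < \<bar>b\<bar>\<close>: an infinite-dimensional eigenspace occurs only for the eigenvalue \<open>0\<close> of \<open>\<box>\<close>,
  where \<open>\<mu> = - b\<close>. The contraction principle solves for all other modes, which leaves a
  finite-dimensional equation. It is joined by a homotopy to the linear equation
  \<open>\<mu> x = (g\<^sub>\<infinity> \<plusminus> \<kappa>) x\<close>, which for small \<open>\<kappa> > 0\<close> has no nontrivial solution. The sign condition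
  bounds the solutions along the homotopy: unbounded solutions, normalised, would
  accumulate at a kernel element \<open>v\<close> of \<open>\<mu> - g\<^sub>\<infinity>\<close>, and testing the equation with \<open>v\<close> gives
  a contradiction. The finite-dimensional equation is then solvable because spheres are not
  contractible.
\<close>

subsection \<open>Square summable families\<close>

text \<open>The kernel of the wave operator is infinite-dimensional, so there is no compact
  resolvent, and compactness of families of solutions must come from elsewhere. The gap between
  \<open>l\<close> and \<open>\<bar>b\<bar>\<close> supplies it: for the difference of two
  solutions, the part outside the finitely many small modes is at most a fixed fraction
  \<open>< 1\<close> of the whole, up to small terms. Convergence of finitely many coordinates then
  forces convergence in norm. The linear end of the homotopy needs injectivity for all shifts in an
  interval \<open>(0, \<kappa>]\<close>, since the homotopy runs through the shifts
  \<open>(1 - s) * \<kappa>\<close>. It holds because eigenvectors of a symmetric operator for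
  different eigenvalues are orthogonal. The shift carries the sign \<open>\<sigma>\<close>, so that
  it and the nonlinearity push in the same direction against a kernel element. The linear part
  inherits the constant \<open>l\<close>: a line at bounded distance from an
  \<open>l\<close>-Lipschitz function has slope at most \<open>l\<close>. The functions
  \<open>sin (j x) * (cos (k w t) + sin (k w t))\<close> form a real basis indexed by the same pairs
  \<open>(j, k)\<close> as the complex modes; only the final translation to the given notion of
  expansion is complex.\<close>

typedef 'i ell2 = "{x :: 'i \<Rightarrow> real. (\<lambda>i. (x i)\<^sup>2) summable_on UNIV}"
  morphisms coord Abs_ell2
  by (intro exI[of _ "\<lambda>_. 0"]) simp

setup_lifting type_definition_ell2

lemma coord_square_summable: "(\<lambda>i. (coord x i)\<^sup>2) summable_on A"
proof -
  have "(\<lambda>i. (coord x i)\<^sup>2) summable_on UNIV"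
    using coord[of x] by simp
  then show ?thesis
    by (rule summable_on_subset_banach) simp
qed

lemma abs_mult_le_squares: "\<bar>x * y\<bar> \<le> x\<^sup>2 + (y :: real)\<^sup>2"
proof -
  have "0 \<le> (\<bar>x\<bar> - \<bar>y\<bar>)\<^sup>2" "0 \<le> \<bar>x\<bar> * \<bar>y\<bar>" by simp_all
  then show ?thesis unfolding abs_mult power2_diff power2_abs by linarith
qed

lemma square_summable_mult:
  fixes x y :: "'i \<Rightarrow> real"
  assumes "(\<lambda>i. (x i)\<^sup>2) summable_on A" "(\<lambda>i. (y i)\<^sup>2) summable_on A"
  shows "(\<lambda>i. x i * y i) summable_on A"
proof -
  have "(\<lambda>i. (x i)\<^sup>2 + (y i)\<^sup>2) summable_on A"
    using assms by (rule summable_on_add)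
  moreover have "norm (x i * y i) \<le> (x i)\<^sup>2 + (y i)\<^sup>2" for i
    using abs_mult_le_squares[of "x i" "y i"] by simp
  ultimately have "(\<lambda>i. norm (x i * y i)) summable_on A"
    by (rule Infinite_Sum.abs_summable_on_comparison_test')
  then show ?thesis by (rule abs_summable_summable)
qed

lemma coord_mult_summable: "(\<lambda>i. coord x i * coord y i) summable_on A"
  by (intro square_summable_mult coord_square_summable)

lemma square_summable_add:
  fixes x y :: "'i \<Rightarrow> real"
  assumes "(\<lambda>i. (x i)\<^sup>2) summable_on A" "(\<lambda>i. (y i)\<^sup>2) summable_on A"
  shows "(\<lambda>i. (x i + y i)\<^sup>2) summable_on A"
  unfolding power2_sum
  using assms by (intro summable_on_add square_summable_mult summable_on_cmult_right)
    (simp_all add: mult.assoc summable_on_cmult_right square_summable_mult)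

instantiation ell2 :: (type) real_vector
begin

lift_definition zero_ell2 :: "'a ell2" is "\<lambda>_. 0" by simp
lift_definition plus_ell2 :: "'a ell2 \<Rightarrow> 'a ell2 \<Rightarrow> 'a ell2" is "\<lambda>x y i. x i + y i"
  by (rule square_summable_add)
lift_definition uminus_ell2 :: "'a ell2 \<Rightarrow> 'a ell2" is "\<lambda>x i. - x i" by simp
lift_definition minus_ell2 :: "'a ell2 \<Rightarrow> 'a ell2 \<Rightarrow> 'a ell2" is "\<lambda>x y i. x i - y i"
  subgoal for x y using square_summable_add[of x UNIV "\<lambda>i. - y i"] by simp
  done
lift_definition scaleR_ell2 :: "real \<Rightarrow> 'a ell2 \<Rightarrow> 'a ell2" is "\<lambda>r x i. r * x i"
  by (simp add: power_mult_distrib summable_on_cmult_right)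
instance
proof
  fix x y z :: "'a ell2" and r s :: real
  show "x + y + z = x + (y + z)" by transfer (simp add: add.assoc)
  show "x + y = y + x" by transfer (simp add: add.commute)
  show "0 + x = x" by transfer simp
  show "- x + x = 0" by transfer simp
  show "x - y = x + - y" by transfer simp
  show "r *\<^sub>R (x + y) = r *\<^sub>R x + r *\<^sub>R y" by transfer (simp add: algebra_simps)
  show "(r + s) *\<^sub>R x = r *\<^sub>R x + s *\<^sub>R x" by transfer (simp add: algebra_simps)
  show "r *\<^sub>R s *\<^sub>R x = (r * s) *\<^sub>R x" by transfer (simp add: algebra_simps)
  show "1 *\<^sub>R x = x" by transfer simp
qed

end

lemmas coord_simps [simp] = zero_ell2.rep_eq plus_ell2.rep_eq minus_ell2.rep_eq
  uminus_ell2.rep_eq scaleR_ell2.rep_eq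

instantiation ell2 :: (type) real_inner
begin

definition inner_ell2 :: "'a ell2 \<Rightarrow> 'a ell2 \<Rightarrow> real"
  where "inner_ell2 x y = (\<Sum>\<^sub>\<infinity>i. coord x i * coord y i)"
definition norm_ell2 :: "'a ell2 \<Rightarrow> real" where "norm_ell2 x = sqrt (inner x x)"
definition sgn_ell2 :: "'a ell2 \<Rightarrow> 'a ell2" where "sgn_ell2 x = x /\<^sub>R norm x"
definition dist_ell2 :: "'a ell2 \<Rightarrow> 'a ell2 \<Rightarrow> real" where "dist_ell2 x y = norm (x - y)"
definition uniformity_ell2 :: "('a ell2 \<times> 'a ell2) filter"
  where "uniformity_ell2 = (INF e\<in>{0<..}. principal {(x, y). dist x y < e})"
definition open_ell2 :: "'a ell2 set \<Rightarrow> bool"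
  where "open_ell2 U \<longleftrightarrow> (\<forall>x\<in>U. eventually (\<lambda>(x', y). x' = x \<longrightarrow> y \<in> U) uniformity)"

instance
proof
  fix x y z :: "'a ell2" and r :: real
  show "dist x y = norm (x - y)" by (rule dist_ell2_def)
  show "sgn x = x /\<^sub>R norm x" by (rule sgn_ell2_def)
  show "uniformity = (INF e\<in>{0<..}. principal {(x, y :: 'a ell2). dist x y < e})"
    by (rule uniformity_ell2_def)
  show "open U \<longleftrightarrow> (\<forall>x\<in>U. eventually (\<lambda>(x', y). x' = x \<longrightarrow> y \<in> U) uniformity)"
    for U :: "'a ell2 set" by (rule open_ell2_def)
  show "inner x y = inner y x" by (simp add: inner_ell2_def mult.commute)
  show "inner (x + y) z = inner x z + inner y z"
    by (simp add: inner_ell2_def distrib_right infsum_add coord_mult_summable)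
  show "inner (r *\<^sub>R x) y = r * inner x y"
    by (simp add: inner_ell2_def mult.assoc infsum_cmult_right coord_mult_summable)
  show "0 \<le> inner x x"
    by (simp add: inner_ell2_def infsum_nonneg)
  show "inner x x = 0 \<longleftrightarrow> x = 0"
  proof
    assume "inner x x = 0"
    then have "coord x i * coord x i = 0" for i
      unfolding inner_ell2_def
      by (intro nonneg_infsum_le_0D[where A = UNIV]) (auto simp: coord_mult_summable)
    then show "x = 0" by transfer auto
  qed (simp add: inner_ell2_def)
  show "norm x = sqrt (inner x x)" by (rule norm_ell2_def)
qed

end

lemma ell2_eqI: "(\<And>i. coord x i = coord y i) \<Longrightarrow> x = y"
  by (simp add: coord_inject[symmetric] fun_eq_iff)

lemma norm_ell2_square: "(norm x)\<^sup>2 = (\<Sum>\<^sub>\<infinity>i. (coord x i)\<^sup>2)"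
  unfolding power2_norm_eq_inner inner_ell2_def by (simp add: power2_eq_square)

lemma sum_coord_square_le: "finite F \<Longrightarrow> (\<Sum>i\<in>F. (coord x i)\<^sup>2) \<le> (norm x)\<^sup>2"
  unfolding norm_ell2_square by (rule finite_sum_le_infsum) (auto simp: coord_square_summable)

lemma abs_coord_le_norm: "\<bar>coord x i\<bar> \<le> norm x"
  using sum_coord_square_le[of "{i}" x] by (simp add: abs_le_square_iff[symmetric])

lemma square_summable_bounded:
  assumes "\<And>F. finite F \<Longrightarrow> (\<Sum>i\<in>F. (x i :: real)\<^sup>2) \<le> C"
  shows "(\<lambda>i. (x i)\<^sup>2) summable_on UNIV"
  by (rule nonneg_bounded_partial_sums_imp_summable_on[of _ _ C])
    (use assms in \<open>auto intro: eventually_finite_subsets_at_top_weakI\<close>)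

lemma norm_ell2_le:
  assumes "\<And>F. finite F \<Longrightarrow> (\<Sum>i\<in>F. (coord x i)\<^sup>2) \<le> C\<^sup>2" "0 \<le> C"
  shows "norm x \<le> C"
proof -
  have "(norm x)\<^sup>2 \<le> C\<^sup>2"
    unfolding norm_ell2_square
    by (rule infsum_le_finite_sums) (use assms coord_square_summable in auto)
  then show ?thesis using assms(2) by (simp add: power2_le_iff_abs_le)
qed

lemma bounded_linear_coord: "bounded_linear (\<lambda>x. coord x i)"
  by (rule bounded_linear_intro[of _ 1]) (auto simp: abs_coord_le_norm)

lemmas tendsto_coord = bounded_linear.tendsto[OF bounded_linear_coord]
lemmas continuous_on_coord = bounded_linear.continuous_on[OF bounded_linear_coord]

instance ell2 :: (type) complete_space
proof
  fix X :: "nat \<Rightarrow> 'a ell2"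
  assume X: "Cauchy X"
  have "Cauchy (\<lambda>n. coord (X n) i)" for i
    by (rule bounded_linear.Cauchy[OF bounded_linear_coord X])
  then have "\<exists>l. (\<lambda>n. coord (X n) i) \<longlonglongrightarrow> l" for i
    by (meson convergentD Cauchy_convergent)
  then obtain l where l: "(\<lambda>n. coord (X n) i) \<longlonglongrightarrow> l i" for i by metis
  \<comment> \<open>\<open>N\<close> must not depend on \<open>F\<close>: the bound for each finite
    partial sum passes to the coordinatewise limit in \<open>m\<close>, and the supremum over
    \<open>F\<close> is then the norm bound.\<close>
  have tail: "\<exists>N. \<forall>n\<ge>N. \<forall>F. finite F \<longrightarrow> (\<Sum>i\<in>F. (coord (X n) i - l i)\<^sup>2) \<le> e\<^sup>2" if "e > 0" for e
  proof -
    obtain N where N: "\<And>m n. m \<ge> N \<Longrightarrow> n \<ge> N \<Longrightarrow> dist (X m) (X n) < e"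
      using X \<open>e > 0\<close> unfolding Cauchy_def by blast
    have "(\<Sum>i\<in>F. (coord (X n) i - l i)\<^sup>2) \<le> e\<^sup>2" if "n \<ge> N" "finite F" for n F
    proof (rule tendsto_upperbound)
      show "(\<lambda>m. \<Sum>i\<in>F. (coord (X n) i - coord (X m) i)\<^sup>2) \<longlonglongrightarrow> (\<Sum>i\<in>F. (coord (X n) i - l i)\<^sup>2)"
        by (intro tendsto_intros l)
      show "\<forall>\<^sub>F m in sequentially. (\<Sum>i\<in>F. (coord (X n) i - coord (X m) i)\<^sup>2) \<le> e\<^sup>2"
        using eventually_ge_at_top[of N]
      proof eventually_elim
        case (elim m)
        have "(\<Sum>i\<in>F. (coord (X n - X m) i)\<^sup>2) \<le> (norm (X n - X m))\<^sup>2"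
          by (rule sum_coord_square_le) fact
        also have "\<dots> \<le> e\<^sup>2"
          using N[OF \<open>n \<ge> N\<close> elim] by (intro power_mono) (auto simp: dist_norm)
        finally show ?case by simp
      qed
    qed simp
    then show ?thesis by blast
  qed
  obtain N where N: "\<And>n F. n \<ge> N \<Longrightarrow> finite F \<Longrightarrow> (\<Sum>i\<in>F. (coord (X n) i - l i)\<^sup>2) \<le> 1\<^sup>2"
    using tail[of 1] by auto
  have "(\<lambda>i. (coord (X N) i - l i)\<^sup>2) summable_on UNIV"
    using N[of N] by (intro square_summable_bounded[of _ 1]) auto
  from square_summable_add[OF coord_square_summable this[unfolded power2_commute[of "coord (X N) _"]], of "X N"]
  have "(\<lambda>i. (l i)\<^sup>2) summable_on UNIV" by simp
  then have [simp]: "coord (Abs_ell2 l) = l" by (simp add: Abs_ell2_inverse)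
  have "X \<longlonglongrightarrow> Abs_ell2 l"
  proof (rule LIMSEQ_I)
    fix r :: real assume "r > 0"
    obtain N where "\<And>n F. n \<ge> N \<Longrightarrow> finite F \<Longrightarrow> (\<Sum>i\<in>F. (coord (X n) i - l i)\<^sup>2) \<le> (r / 2)\<^sup>2"
      using tail[of "r / 2"] \<open>r > 0\<close> by auto
    then have "norm (X n - Abs_ell2 l) \<le> r / 2" if "n \<ge> N" for n
      using that \<open>r > 0\<close> by (intro norm_ell2_le) auto
    then have "norm (X n - Abs_ell2 l) < r" if "n \<ge> N" for n
      using that \<open>r > 0\<close> by (fastforce intro: le_less_trans)
    then show "\<exists>N. \<forall>n\<ge>N. norm (X n - Abs_ell2 l) < r" by blast
  qed
  then show "convergent X" by (rule convergentI)
qed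

section \<open>Diagonal operators and coordinate projections\<close>

definition diag :: "('i \<Rightarrow> real) \<Rightarrow> 'i ell2 \<Rightarrow> 'i ell2" where
  "diag m x = Abs_ell2 (\<lambda>i. m i * coord x i)"

text \<open>Boundedness of the multiplier keeps the products square summable; without that,
  \<open>Abs_ell2\<close> in \<open>diag\<close> returns an unspecified value. For this reason the
  unbounded multiplier \<open>mu\<close> below never enters through \<open>diag\<close>, only
  through equations between coordinates.\<close>

lemma
  assumes "\<And>i. \<bar>m i\<bar> \<le> C"
  shows coord_diag: "coord (diag m x) i = m i * coord x i"
    and norm_diag_le: "norm (diag m x) \<le> C * norm x"
proof -
  have C: "0 \<le> C" using assms[of undefined] by linarith
  have le: "(\<Sum>i\<in>F. (m i * coord x i)\<^sup>2) \<le> (C * norm x)\<^sup>2" if "finite F" for F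
  proof -
    have "(\<Sum>i\<in>F. (m i * coord x i)\<^sup>2) \<le> (\<Sum>i\<in>F. C\<^sup>2 * (coord x i)\<^sup>2)"
      unfolding power_mult_distrib using assms C
      by (intro sum_mono mult_right_mono) (auto simp: abs_le_square_iff[symmetric])
    also have "\<dots> \<le> C\<^sup>2 * (norm x)\<^sup>2"
      unfolding sum_distrib_left[symmetric]
      by (intro mult_left_mono sum_coord_square_le that) simp
    finally show ?thesis by (simp add: power_mult_distrib)
  qed
  have eq: "coord (diag m x) = (\<lambda>i. m i * coord x i)"
    unfolding diag_def using square_summable_bounded[OF le]
    by (simp add: Abs_ell2_inverse)
  then show "coord (diag m x) i = m i * coord x i" by simp
  show "norm (diag m x) \<le> C * norm x"
    by (rule norm_ell2_le) (use le C in \<open>auto simp: eq\<close>)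
qed

lemma linear_diag:
  assumes "\<And>i. \<bar>m i\<bar> \<le> C"
  shows "linear (diag m)"
  by (rule linearI) (auto intro!: ell2_eqI simp: coord_diag[OF assms] algebra_simps)

definition restr :: "'i set \<Rightarrow> 'i ell2 \<Rightarrow> 'i ell2" where
  "restr A = diag (indicator A)"

lemma coord_restr [simp]: "coord (restr A x) i = (if i \<in> A then coord x i else 0)"
  unfolding restr_def by (subst coord_diag[where C = 1]) (auto simp: indicator_def)

lemma norm_restr_le: "norm (restr A x) \<le> norm x"
  unfolding restr_def by (rule order_trans[OF norm_diag_le[where C = 1]]) (auto simp: indicator_def)

lemma linear_restr: "linear (restr A)"
  unfolding restr_def by (rule linear_diag[where C = 1]) (auto simp: indicator_def)

lemma bounded_linear_restr: "bounded_linear (restr A)"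
  using norm_restr_le
  by (intro bounded_linear_intro[of _ 1])
    (auto simp: linear_add[OF linear_restr] linear_scale[OF linear_restr])

lemma restr_add_compl: "restr A x + restr (- A) x = x"
  by (rule ell2_eqI) auto

lift_definition unit_ell2 :: "'i \<Rightarrow> 'i ell2" is "\<lambda>i j. if j = i then 1 else 0"
proof -
  fix i :: 'i
  show "(\<lambda>j. (if j = i then 1 else 0 :: real)\<^sup>2) summable_on UNIV"
    by (rule finite_nonzero_values_imp_summable_on, rule finite_subset[of _ "{i}"]) auto
qed

lemma coord_unit [simp]: "coord (unit_ell2 i) j = (if j = i then 1 else 0)"
  by (simp add: unit_ell2.rep_eq)

lemma restr_finite_sum: "finite A \<Longrightarrow> restr A x = (\<Sum>i\<in>A. coord x i *\<^sub>R unit_ell2 i)"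
proof (rule ell2_eqI)
  fix j assume A: "finite A"
  interpret c: bounded_linear "\<lambda>x :: 'a ell2. coord x j" by (rule bounded_linear_coord)
  show "coord (restr A x) j = coord (\<Sum>i\<in>A. coord x i *\<^sub>R unit_ell2 i) j"
    using A by (simp add: c.sum if_distrib sum.delta cong: if_cong)
qed

subsection \<open>Zeros of maps that are linear at infinity\<close>

text \<open>This plays the part of Euclidean space of dimension \<open>card A\<close>. As a subset
  of \<open>ell2\<close> its dimension may depend on the data, here on the number of small
  modes.\<close>

definition coord_space :: "'i set \<Rightarrow> 'i ell2 set" where
  "coord_space A = {x. restr A x = x}"

lemma coord_space_iff: "x \<in> coord_space A \<longleftrightarrow> (\<forall>i. i \<notin> A \<longrightarrow> coord x i = 0)"
proof
  assume "x \<in> coord_space A"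
  then have "coord (restr A x) i = coord x i" for i by (simp add: coord_space_def)
  then show "\<forall>i. i \<notin> A \<longrightarrow> coord x i = 0" by (metis coord_restr)
qed (auto simp: coord_space_def intro!: ell2_eqI)

lemma subspace_coord_space: "subspace (coord_space A)"
  by (auto simp: subspace_def coord_space_iff)

lemma coord_space_scale: "x \<in> coord_space A \<Longrightarrow> r *\<^sub>R x \<in> coord_space A"
  by (auto simp: coord_space_iff)

lemma span_units: "finite A \<Longrightarrow> span (unit_ell2 ` A) = coord_space A"
proof (rule span_subspace)
  assume A: "finite A"
  show "unit_ell2 ` A \<subseteq> coord_space A" by (auto simp: coord_space_iff)
  show "coord_space A \<subseteq> span (unit_ell2 ` A)"
  proof
    fix x assume "x \<in> coord_space A"
    then have "x = (\<Sum>i\<in>A. coord x i *\<^sub>R unit_ell2 i)"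
      using restr_finite_sum[OF A, of x] by (simp add: coord_space_def)
    then show "x \<in> span (unit_ell2 ` A)"
      by (metis (no_types, lifting) imageI span_base span_scale span_sum)
  qed
qed (rule subspace_coord_space)

lemma norm_finite_coord_space:
  assumes "finite A" "x \<in> coord_space A"
  shows "(norm x)\<^sup>2 = (\<Sum>i\<in>A. (coord x i)\<^sup>2)"
proof -
  have "(norm x)\<^sup>2 = infsum (\<lambda>i. (coord x i)\<^sup>2) A"
    unfolding norm_ell2_square
    by (rule infsum_cong_neutral) (use assms in \<open>auto simp: coord_space_iff\<close>)
  then show ?thesis using assms by simp
qed

lemma independent_units: "finite A \<Longrightarrow> independent (unit_ell2 ` A)"
proof (rule independent_if_scalars_zero)
  fix f v assume A: "finite A" and s: "(\<Sum>x\<in>unit_ell2 ` A. f x *\<^sub>R x) = 0" and v: "v \<in> unit_ell2 ` A"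
  then obtain j where j: "j \<in> A" "v = unit_ell2 j" by auto
  interpret c: bounded_linear "\<lambda>x :: 'a ell2. coord x j" by (rule bounded_linear_coord)
  have inj: "inj_on unit_ell2 A"
  proof
    fix i k :: 'a assume "unit_ell2 i = unit_ell2 k"
    then have "coord (unit_ell2 i) k = coord (unit_ell2 k) k" by simp
    then show "i = k" by (auto split: if_splits)
  qed
  have "0 = coord (\<Sum>x\<in>unit_ell2 ` A. f x *\<^sub>R x) j" by (simp add: s)
  also have "\<dots> = (\<Sum>i\<in>A. f (unit_ell2 i) * coord (unit_ell2 i) j)"
    by (simp add: c.sum sum.reindex[OF inj] del: coord_unit)
  also have "\<dots> = f v"
    using j A by (simp add: if_distrib sum.delta cong: if_cong)
  finally show "f v = 0" by simp
qed simp

text \<open>Enumerating \<open>A\<close> makes this sphere homeomorphic to \<open>nsphere n\<close>,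
  whose non-contractibility is a theorem of homology.\<close>

lemma not_contractible_finite_sphere:
  assumes A: "finite A" "A \<noteq> {}"
  shows "\<not> contractible {x \<in> coord_space A. norm x = 1}"
proof -
  \<comment> \<open>The \<open>n\<close>-sphere lies in dimension \<open>n + 1\<close>; its
    coordinates are numbered \<open>0\<close> to \<open>n\<close>.\<close>
  define n where "n = card A - 1"
  have n: "card A = Suc n" using A by (simp add: n_def card_gt_0_iff)
  obtain b where b: "bij_betw b {..n} A"
    using ex_bij_betw_nat_finite[OF A(1)] n by (auto simp: atLeast0LessThan lessThan_Suc_atMost)
  define S where "S = {x :: nat \<Rightarrow> real. (\<Sum>i\<le>n. (x i)\<^sup>2) = 1 \<and> (\<forall>i>n. x i = 0)}"
  define S' where "S' = {x \<in> coord_space A. norm x = 1}"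
  have nS: "nsphere n = top_of_set S"
    unfolding nsphere S_def euclidean_product_topology by (simp add: conj_commute)
  define d where "d i = inv_into {..n} b i" for i
  have bd: "b (d i) = i" "d i \<le> n" if "i \<in> A" for i
    using that b f_inv_into_f[of i b "{..n}"] inv_into_into[of i b "{..n}"]
    by (auto simp: d_def bij_betw_def)
  have db: "d (b k) = k" "b k \<in> A" if "k \<le> n" for k
    using that b by (auto simp: d_def bij_betw_def)
  define F where "F v = (\<Sum>i\<in>A. v (d i) *\<^sub>R unit_ell2 i)" for v :: "nat \<Rightarrow> real"
  define G where "G x k = (if k \<le> n then coord x (b k) else 0)" for x k
  have cF: "coord (F v) j = (if j \<in> A then v (d j) else 0)" for v j
  proof -
    interpret c: bounded_linear "\<lambda>x :: 'a ell2. coord x j" by (rule bounded_linear_coord)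
    show ?thesis using A by (simp add: F_def c.sum if_distrib sum.delta cong: if_cong)
  qed
  have F_in: "F v \<in> coord_space A" for v by (simp add: coord_space_iff cF)
  have normF: "(norm (F v))\<^sup>2 = (\<Sum>k\<le>n. (v k)\<^sup>2)" for v
  proof -
    have "(norm (F v))\<^sup>2 = (\<Sum>i\<in>A. (v (d i))\<^sup>2)"
      by (simp add: norm_finite_coord_space[OF A(1) F_in] cF)
    also have "\<dots> = (\<Sum>k\<le>n. (v k)\<^sup>2)"
      by (subst sum.reindex_bij_betw[OF b, symmetric]) (simp add: db)
    finally show ?thesis .
  qed
  have GF: "G (F v) = v" if "v \<in> S" for v
    using that by (auto simp: G_def cF db S_def)
  have FG: "F (G x) = x" if "x \<in> coord_space A" for x
    using that by (auto intro!: ell2_eqI simp: cF G_def bd coord_space_iff)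
  have "homeomorphism S S' F G"
  proof (rule homeomorphismI)
    show "continuous_on S F"
    proof -
      have "continuous_on S (\<lambda>v. v k)" for k
        by (rule continuous_on_product_then_coordinatewise) (rule continuous_on_id)
      then show ?thesis unfolding F_def by (intro continuous_on_sum continuous_on_scaleR continuous_on_const)
    qed
    show "continuous_on S' G"
      unfolding G_def
    proof (rule continuous_on_coordinatewise_then_product)
      show "continuous_on S' (\<lambda>x. if k \<le> n then coord x (b k) else 0)" for k
        by (cases "k \<le> n") (auto intro: continuous_on_coord continuous_on_id)
    qed
    show "F ` S \<subseteq> S'"
    proof
      fix x assume "x \<in> F ` S"
      then obtain v where v: "v \<in> S" "x = F v" by auto
      then have "(norm x)\<^sup>2 = 1\<^sup>2" by (simp add: normF S_def)
      then have "norm x = 1" by (rule power2_eq_imp_eq) auto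
      then show "x \<in> S'" using F_in v by (simp add: S'_def)
    qed
    show "G ` S' \<subseteq> S"
    proof
      fix v assume "v \<in> G ` S'"
      then obtain x where x: "x \<in> S'" "v = G x" by auto
      then have "(\<Sum>k\<le>n. (v k)\<^sup>2) = 1"
        using normF[of "G x"] FG[of x] by (simp add: S'_def)
      then show "v \<in> S" using x by (auto simp: S_def G_def)
    qed
    show "G (F x) = x" if "x \<in> S" for x by (rule GF) fact
    show "F (G y) = y" if "y \<in> S'" for y using that by (intro FG) (simp add: S'_def)
  qed
  then have "homeomorphic_maps (top_of_set S) (top_of_set S') F G"
    unfolding homeomorphism_def homeomorphic_maps_def
    by (auto simp: continuous_map_in_subtopology continuous_map_iff_continuous)
  then have "top_of_set S homeomorphic_space top_of_set S'"
    unfolding homeomorphic_space_def by blast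
  then have "contractible_space (nsphere n) \<longleftrightarrow> contractible_space (top_of_set S')"
    unfolding nS by (rule homeomorphic_space_contractibility)
  then show ?thesis
    unfolding S'_def[symmetric] by (simp add: non_contractible_space_nsphere)
qed

text \<open>A dimension count inside \<open>ell2\<close>: the images of the \<open>card A\<close>
  unit vectors are independent, and a vector outside their span would give \<open>card A + 1\<close>
  independent vectors in the span of \<open>card A\<close> vectors.\<close>

lemma linear_inj_coord_space_surj:
  assumes A: "finite A" and B: "linear B" "\<And>y. y \<in> coord_space A \<Longrightarrow> B y \<in> coord_space A"
    and inj: "\<And>y. y \<in> coord_space A \<Longrightarrow> B y = 0 \<Longrightarrow> y = 0"
  shows "B ` coord_space A = coord_space A"
proof -
  let ?U = "unit_ell2 ` A"
  have injB: "inj_on B (span ?U)"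
    unfolding span_units[OF A] linear_injective_on_subspace_0[OF B(1) subspace_coord_space] using inj by auto
  then have "inj_on B ?U" by (rule inj_on_subset) (rule span_superset)
  then have card: "card (B ` ?U) = card ?U" by (rule card_image)
  have ind: "independent (B ` ?U)"
    by (rule linear_independent_injective_image[OF B(1) independent_units[OF A] injB])
  have BU: "B ` coord_space A = span (B ` ?U)"
    using linear_span_image[OF B(1), of ?U] by (simp only: span_units[OF A])
  have "y \<in> span (B ` ?U)" if y: "y \<in> coord_space A" for y
  proof (rule ccontr)
    assume n: "y \<notin> span (B ` ?U)"
    then have "independent (insert y (B ` ?U))"
      by (rule independent_insertI) (rule ind)
    moreover have "insert y (B ` ?U) \<subseteq> span ?U"
    proof -
      have "unit_ell2 i \<in> coord_space A" if "i \<in> A" for i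
        using that by (auto simp: coord_space_iff)
      then show ?thesis unfolding span_units[OF A] using y B(2) by blast
    qed
    ultimately have "card (insert y (B ` ?U)) \<le> card ?U"
      by (rule independent_span_bound[OF finite_imageI[OF A], THEN conjunct2])
    moreover have "y \<notin> B ` ?U" using n span_base[of y "B ` ?U"] by (rule contrapos_nn)
    then have "card (insert y (B ` ?U)) = Suc (card (B ` ?U))"
      using A by (intro card_insert_disjoint finite_imageI)
    ultimately show False using card by linarith
  qed
  then have "coord_space A \<subseteq> B ` coord_space A" unfolding BU by (rule subsetI)
  moreover have "B ` coord_space A \<subseteq> coord_space A" by (rule image_subsetI) (rule B(2))
  ultimately show ?thesis by (rule equalityI[rotated])
qed

text \<open>This replaces the degree of a map. With a left inverse \<open>g\<close> of
  \<open>B\<close>, a zero-free \<open>F\<close> would make the normalised \<open>g o F\<close>, on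
  spheres shrinking from a large radius to 0, a homotopy on the unit sphere from the identity to a
  constant.\<close>

lemma zero_of_linear_at_infinity:
  assumes A: "finite A"
    and cont: "continuous_on (coord_space A) F"
    and maps: "\<And>y. y \<in> coord_space A \<Longrightarrow> F y \<in> coord_space A"
    and B: "linear B" "\<And>y. y \<in> coord_space A \<Longrightarrow> B y \<in> coord_space A"
    and inj: "\<And>y. y \<in> coord_space A \<Longrightarrow> B y = 0 \<Longrightarrow> y = 0"
    and far: "\<And>y. y \<in> coord_space A \<Longrightarrow> norm y \<ge> \<rho> \<Longrightarrow> F y = B y"
  shows "\<exists>y \<in> coord_space A. F y = 0"
\<comment> \<open>For empty \<open>A\<close> the unit sphere is empty and gives no contradiction;
  but then the space is \<open>{0}\<close> and 0 itself is a zero.\<close>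
proof (cases "A = {}")
  case True
  have "x = 0" if "x \<in> coord_space A" for x
    using that True by (intro ell2_eqI) (auto simp: coord_space_iff)
  then show ?thesis using maps[of 0] by (intro bexI[of _ 0]) (auto simp: coord_space_iff)
next
  case False
  show ?thesis
  proof (rule ccontr)
    assume nz: "\<not> ?thesis"
    have surj: "B ` coord_space A = coord_space A"
      by (rule linear_inj_coord_space_surj) fact+
    obtain g where g: "linear g" "range g \<subseteq> coord_space A" "\<And>y. y \<in> coord_space A \<Longrightarrow> g (B y) = y"
    proof -
      have "inj_on B (coord_space A)"
        unfolding linear_injective_on_subspace_0[OF B(1) subspace_coord_space] using inj by blast
      from linear_exists_left_inverse_on[OF B(1) subspace_coord_space this] that
      show thesis by blast
    qed
    have g0: "g z \<noteq> 0" if "z \<in> coord_space A" "z \<noteq> 0" for z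
    proof
      assume "g z = 0"
      have "z \<in> B ` coord_space A" using that(1) by (simp only: surj)
      then obtain y where y: "z = B y" "y \<in> coord_space A" by (rule imageE)
      then have "y = 0" using g(3)[OF y(2)] \<open>g z = 0\<close> by simp
      then show False using that(2) y(1) linear_0[OF B(1)] by simp
    qed
    \<comment> \<open>\<open>g\<close> is only known to be linear on the infinite-dimensional space,
      so continuity on \<open>coord_space A\<close> is read off from a finite sum.\<close>
    have g_sum: "g z = (\<Sum>i\<in>A. coord z i *\<^sub>R g (unit_ell2 i))" if "z \<in> coord_space A" for z
    proof -
      have "g z = g (\<Sum>i\<in>A. coord z i *\<^sub>R unit_ell2 i)"
        using that restr_finite_sum[OF A, of z] by (simp add: coord_space_def)
      then show ?thesis by (simp add: linear_sum[OF g(1)] linear_scale[OF g(1)])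
    qed
    have "continuous_on (coord_space A) (\<lambda>y. \<Sum>i\<in>A. coord (F y) i *\<^sub>R g (unit_ell2 i))"
      by (intro continuous_intros continuous_on_coord cont)
    then have cg: "continuous_on (coord_space A) (\<lambda>y. g (F y))"
      by (rule continuous_on_eq) (simp add: g_sum maps)
    \<comment> \<open>Large enough for \<open>F\<close> to be linear on the sphere of radius
      \<open>r\<close>, and positive so that normalising recovers \<open>x\<close>.\<close>
    define r where "r = max \<rho> 1"
    let ?S = "{x \<in> coord_space A. norm x = 1}"
    define h where "h = (\<lambda>(t, x). sgn (g (F (((1 - t) * r) *\<^sub>R x))))"
    have nz': "g (F y) \<noteq> 0" if "y \<in> coord_space A" for y
      using g0[OF maps[OF that]] nz that by blast
    have "continuous_on ({0..1} \<times> ?S) (\<lambda>z. g (F (((1 - fst z) * r) *\<^sub>R snd z)))"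
      by (rule continuous_on_compose2[OF cg])
        (auto intro!: continuous_intros coord_space_scale)
    then have "continuous_on ({0..1} \<times> ?S) h"
      unfolding h_def case_prod_beta
      by (rule continuous_on_sgn) (auto intro!: nz' coord_space_scale)
    moreover have "h ` ({0..1} \<times> ?S) \<subseteq> ?S"
      using nz' g(2)
      by (auto simp: h_def norm_sgn coord_space_scale sgn_div_norm image_subset_iff)
    moreover have "h (0, x) = x" if "x \<in> ?S" for x
    proof -
      have "F (r *\<^sub>R x) = B (r *\<^sub>R x)"
        using that by (intro far) (auto simp: r_def coord_space_scale)
      then have "g (F (r *\<^sub>R x)) = r *\<^sub>R x" using that by (simp add: g coord_space_scale)
      then show ?thesis using that by (simp add: h_def sgn_div_norm r_def)
    qed
    moreover have "h (1, x) = sgn (g (F 0))" for x by (simp add: h_def)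
    ultimately have "continuous_map (prod_topology (top_of_set {0..1}) (top_of_set ?S)) (top_of_set ?S) h \<and>
        (\<forall>x\<in>topspace (top_of_set ?S). h (0, x) = id x) \<and>
        (\<forall>x\<in>topspace (top_of_set ?S). h (1, x) = sgn (g (F 0))) \<and> (\<forall>t\<in>{0..1::real}. True)"
      unfolding prod_topology_subtopology_eu continuous_map_in_subtopology continuous_map_iff_continuous
        topspace_euclidean_subtopology image_subset_iff_funcset[symmetric] id_apply
      by blast
    then have "homotopic_with (\<lambda>x. True) (top_of_set ?S) (top_of_set ?S) id (\<lambda>x. sgn (g (F 0)))"
      unfolding homotopic_with[where P = "\<lambda>x. True", OF refl] by (rule exI[where x = h])
    then have "contractible ?S" unfolding contractible_def by (rule exI)
    then show False using not_contractible_finite_sphere[OF A False] by simp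
  qed
qed

subsection \<open>Solvability of resonant diagonal problems\<close>

text \<open>Bolzano-Weierstrass one coordinate at a time; each step refines the previous
  subsequence, which keeps the earlier limits.\<close>

lemma coordwise_convergent_subseq:
  fixes X :: "nat \<Rightarrow> 'i ell2"
  assumes "finite A" "bounded (range X)"
  shows "\<exists>\<phi>. strict_mono \<phi> \<and> (\<forall>i\<in>A. convergent (\<lambda>n. coord (X (\<phi> n)) i))"
  using assms(1)
proof induction
  case empty
  have "strict_mono (id :: nat \<Rightarrow> nat)" by (simp add: strict_mono_def)
  then show ?case by auto
next
  case (insert j A)
  then obtain \<phi> where \<phi>: "strict_mono \<phi>" "\<forall>i\<in>A. convergent (\<lambda>n. coord (X (\<phi> n)) i)" by auto
  obtain C where C: "\<And>n. norm (X n) \<le> C"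
    using assms(2) unfolding bounded_iff by auto
  have "\<bar>coord (X (\<phi> n)) j\<bar> \<le> C" for n
    by (rule order_trans[OF abs_coord_le_norm C])
  then have "bounded (range (\<lambda>n. coord (X (\<phi> n)) j))"
    unfolding bounded_iff by auto
  then obtain l r where r: "strict_mono r" "((\<lambda>n. coord (X (\<phi> n)) j) \<circ> r) \<longlonglongrightarrow> l"
    using bounded_imp_convergent_subsequence by blast
  show ?case
  proof (intro exI[of _ "\<phi> \<circ> r"] conjI ballI)
    show "strict_mono (\<phi> \<circ> r)" using \<phi>(1) r(1) by (rule strict_mono_o)
    fix i assume i: "i \<in> insert j A"
    show "convergent (\<lambda>n. coord (X ((\<phi> \<circ> r) n)) i)"
    proof (cases "i = j")
      case True
      then show ?thesis using r(2) by (auto simp: convergent_def o_def)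
    next
      case False
      then have "convergent (\<lambda>n. coord (X (\<phi> n)) i)" using i \<phi>(2) by auto
      from convergent_subseq_convergent[OF this r(1)] show ?thesis by (simp add: o_def)
    qed
  qed
qed

text \<open>In the application \<open>\<beta>\<close> is \<open>\<bar>b\<bar>\<close>, and the set
  of small modes is finite because the kernel of the wave operator sits exactly at
  \<open>\<bar>mu\<bar> = \<beta>\<close>, outside it. The last assumption is a Landesman-Lazer
  condition: it is only required along sequences whose norms blow up while their directions
  converge.\<close>

locale resonant_problem =
  fixes mu :: "'i \<Rightarrow> real" and \<beta> l M \<sigma> :: real and N G :: "'i ell2 \<Rightarrow> 'i ell2"
  assumes finite_small: "finite {i. \<bar>mu i\<bar> < \<beta>}"
    and l: "0 \<le> l" "l < \<beta>"
    and N_lipschitz: "norm (N x - N y) \<le> l * norm (x - y)"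
    and linear_G: "linear G" and norm_G: "norm (G x) \<le> l * norm x"
    and G_symmetric: "inner (G x) y = inner x (G y)"
    and N_near_G: "norm (N x - G x) \<le> M"
    and \<sigma>: "\<bar>\<sigma>\<bar> = 1"
    and sign_at_infinity: "\<And>X w. filterlim (\<lambda>n. norm (X n)) at_top sequentially \<Longrightarrow>
      (\<lambda>n. sgn (X n)) \<longlonglongrightarrow> w \<Longrightarrow> norm w = 1 \<Longrightarrow>
      eventually (\<lambda>n. \<sigma> * inner (N (X n) - G (X n)) w > 0) sequentially"
begin

section \<open>The equation off the small modes, and compactness\<close>

abbreviation "I \<equiv> {i. \<bar>mu i\<bar> < \<beta>}"

text \<open>The equation \<open>mu x = y\<close> with unbounded \<open>mu\<close>, coordinate by
  coordinate; that \<open>x\<close> lies in the domain of \<open>mu\<close> is automatic because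
  \<open>y\<close> is an element of \<open>ell2\<close>.\<close>

abbreviation "eigen x y \<equiv> (\<forall>i. mu i * coord x i = coord y i)"

text \<open>Inverse of \<open>mu\<close> off \<open>I\<close>, where
  \<open>\<bar>mu i\<bar> \<ge> \<beta>\<close>, extended by 0 on \<open>I\<close>; this gives the
  norm bound \<open>1 / \<beta>\<close>.\<close>

definition K :: "'i ell2 \<Rightarrow> 'i ell2" where
  "K = diag (\<lambda>i. if i \<in> I then 0 else 1 / mu i)"

lemma \<beta>_pos: "\<beta> > 0" using l by linarith

lemma K_bound: "\<bar>if i \<in> I then 0 else 1 / mu i\<bar> \<le> 1 / \<beta>"
  using \<beta>_pos by (auto simp: field_simps abs_if)

lemma linear_K: "linear K" unfolding K_def by (rule linear_diag[OF K_bound])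
lemma norm_K: "norm (K x) \<le> norm x / \<beta>"
  unfolding K_def using norm_diag_le[where x = x, OF K_bound] by simp
lemma coord_K: "coord (K x) i = (if i \<in> I then 0 else coord x i / mu i)"
  unfolding K_def by (subst coord_diag[OF K_bound]) auto
lemma restr_K [simp]: "restr I (K x) = 0"
  by (rule ell2_eqI) (simp add: coord_K)

lemma eigen_compl_bound:
  assumes "eigen x y"
  shows "\<beta> * norm (restr (- I) x) \<le> norm y"
proof -
  have "restr (- I) x = K y"
  proof (rule ell2_eqI)
    fix i
    show "coord (restr (- I) x) i = coord (K y) i"
      using assms[rule_format, of i] \<beta>_pos by (auto simp: coord_K field_simps)
  qed
  then have "norm (restr (- I) x) \<le> norm y / \<beta>" using norm_K by simp
  then show ?thesis using \<beta>_pos by (simp add: field_simps)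
qed

text \<open>The coordinates in \<open>I\<close> converge along a subsequence because there are
  finitely many. For a difference \<open>D\<close> of two members, the equation bounds the rest by
  \<open>(l + \<kappa>) / \<beta> * norm D\<close> plus terms tending to 0, and
  \<open>l + \<kappa> < \<beta>\<close> allows this to be absorbed. So the subsequence is Cauchy
  without any compactness of \<open>K\<close>.\<close>

lemma eigen_compact:
  assumes bdd: "bounded (range X)" and \<kappa>: "\<And>n. \<bar>a n\<bar> \<le> \<kappa>" "l + \<kappa> < \<beta>"
    and a: "a \<longlonglongrightarrow> a0" and R: "R \<longlonglongrightarrow> 0"
    and eq: "\<And>n. eigen (X n) (G (X n) + a n *\<^sub>R X n + R n)"
  shows "\<exists>\<phi> w. strict_mono \<phi> \<and> (\<lambda>n. X (\<phi> n)) \<longlonglongrightarrow> w \<and> eigen w (G w + a0 *\<^sub>R w)"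
proof -
  obtain \<phi> where \<phi>: "strict_mono \<phi>" "\<And>i. i \<in> I \<Longrightarrow> convergent (\<lambda>n. coord (X (\<phi> n)) i)"
    using coordwise_convergent_subseq[OF finite_small bdd] by auto
  obtain C0 where C0: "\<And>n. norm (X n) \<le> C0" using bdd unfolding bounded_iff by auto
  have C0_nonneg: "0 \<le> C0" using order_trans[OF norm_ge_zero C0] .
  have \<kappa>0: "0 \<le> \<kappa>" using \<kappa>(1)[of 0] by linarith
  define Y b S where "Y n = X (\<phi> n)" and "b n = a (\<phi> n)" and "S n = R (\<phi> n)" for n
  have "convergent (\<lambda>n. \<Sum>i\<in>I. coord (Y n) i *\<^sub>R unit_ell2 i)"
  proof -
    obtain L where "\<And>i. i \<in> I \<Longrightarrow> (\<lambda>n. coord (Y n) i) \<longlonglongrightarrow> L i"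
      using \<phi>(2) unfolding convergent_def Y_def by metis
    then have "(\<lambda>n. \<Sum>i\<in>I. coord (Y n) i *\<^sub>R unit_ell2 i) \<longlonglongrightarrow> (\<Sum>i\<in>I. L i *\<^sub>R unit_ell2 i)"
      by (intro tendsto_intros)
    then show ?thesis by (rule convergentI)
  qed
  then have cI: "Cauchy (\<lambda>n. restr I (Y n))"
    unfolding restr_finite_sum[OF finite_small] by (rule convergent_Cauchy)
  have bl: "b \<longlonglongrightarrow> a0" and Sl: "S \<longlonglongrightarrow> 0"
    using LIMSEQ_subseq_LIMSEQ[OF a \<phi>(1)] LIMSEQ_subseq_LIMSEQ[OF R \<phi>(1)]
    by (simp_all add: b_def[abs_def] S_def[abs_def] o_def)
  then have cb: "Cauchy b" and cS: "Cauchy S" by (auto intro: LIMSEQ_imp_Cauchy)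
  \<comment> \<open>What remains of \<open>\<beta>\<close> after absorbing the linear terms in
    \<open>D\<close>.\<close>
  define q where "q = \<beta> - l - \<kappa>"
  have q: "q > 0" using \<kappa>(2) by (simp add: q_def)
  have est: "q * norm (Y m - Y n) \<le>
      \<beta> * norm (restr I (Y m) - restr I (Y n)) + C0 * \<bar>b m - b n\<bar> + norm (S m - S n)" for m n
  proof -
    define D where "D = Y m - Y n"
    \<comment> \<open>Subtracting the two equations, the mismatch of the coefficients
      \<open>b\<close> falls on the bounded vector \<open>Y n\<close>.\<close>
    have "eigen D (G D + b m *\<^sub>R D + (b m - b n) *\<^sub>R Y n + (S m - S n))"
      using eq[of "\<phi> m"] eq[of "\<phi> n"]
      by (auto simp: D_def Y_def b_def S_def linear_diff[OF linear_G] algebra_simps)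
    then have "\<beta> * norm (restr (- I) D) \<le> norm (G D + b m *\<^sub>R D + (b m - b n) *\<^sub>R Y n + (S m - S n))"
      by (rule eigen_compl_bound)
    also have "\<dots> \<le> norm (G D) + norm (b m *\<^sub>R D) + norm ((b m - b n) *\<^sub>R Y n) + norm (S m - S n)"
      by (intro norm_triangle_le add_mono order_refl)
    also have "\<dots> \<le> l * norm D + \<kappa> * norm D + C0 * \<bar>b m - b n\<bar> + norm (S m - S n)"
      using \<kappa>(1)[of "\<phi> m"] C0[of "\<phi> n"]
      by (intro add_mono norm_G) (auto simp: b_def Y_def mult.commute[of C0] intro!: mult_right_mono mult_left_mono)
    finally have 1: "\<beta> * norm (restr (- I) D) \<le>
      l * norm D + \<kappa> * norm D + C0 * \<bar>b m - b n\<bar> + norm (S m - S n)" .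
    have "norm D \<le> norm (restr I D) + norm (restr (- I) D)"
      using norm_triangle_ineq[of "restr I D" "restr (- I) D"] by (simp only: restr_add_compl)
    then have "\<beta> * norm D \<le> \<beta> * norm (restr I D) + \<beta> * norm (restr (- I) D)"
      using \<beta>_pos by (metis distrib_left less_imp_le mult_left_mono)
    with 1 have "q * norm D \<le> \<beta> * norm (restr I D) + C0 * \<bar>b m - b n\<bar> + norm (S m - S n)"
      by (simp add: q_def algebra_simps)
    then show ?thesis
      by (simp add: D_def linear_diff[OF linear_restr])
  qed
  have "Cauchy Y"
  proof (rule metric_CauchyI)
    fix e :: real assume e: "e > 0"
    \<comment> \<open>Chosen so that the three terms of \<open>est\<close>, each controlled by
      \<open>d\<close>, add up to \<open>q * e\<close>.\<close>
    define d where "d = q * e / (\<beta> + C0 + 1)"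
    have d: "d > 0" using e q \<beta>_pos C0_nonneg by (simp add: d_def)
    obtain N1 N2 N3 where
      N: "\<And>m n. m \<ge> N1 \<Longrightarrow> n \<ge> N1 \<Longrightarrow> norm (restr I (Y m) - restr I (Y n)) < d"
        "\<And>m n. m \<ge> N2 \<Longrightarrow> n \<ge> N2 \<Longrightarrow> \<bar>b m - b n\<bar> < d"
        "\<And>m n. m \<ge> N3 \<Longrightarrow> n \<ge> N3 \<Longrightarrow> norm (S m - S n) < d"
      using cI cb cS d unfolding Cauchy_def dist_norm real_norm_def by metis
    show "\<exists>N0. \<forall>m\<ge>N0. \<forall>n\<ge>N0. dist (Y m) (Y n) < e"
    proof (intro exI[of _ "N1 + N2 + N3"] allI impI)
      fix m n assume mn: "m \<ge> N1 + N2 + N3" "n \<ge> N1 + N2 + N3"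
      have "q * norm (Y m - Y n) \<le> \<beta> * norm (restr I (Y m) - restr I (Y n)) + C0 * \<bar>b m - b n\<bar> + norm (S m - S n)"
        by (rule est)
      also have "\<dots> < \<beta> * d + C0 * d + d"
        using N(1)[of m n] N(2)[of m n] N(3)[of m n] mn \<beta>_pos C0_nonneg
        by (intro add_le_less_mono add_mono mult_left_mono) auto
      also have "\<dots> = d * (\<beta> + C0 + 1)" by (simp add: algebra_simps)
      also have "\<dots> = q * e" unfolding d_def using \<beta>_pos C0_nonneg by simp
      finally show "dist (Y m) (Y n) < e" using q by (simp add: dist_norm)
    qed
  qed
  then obtain w where w: "Y \<longlonglongrightarrow> w" using Cauchy_convergent convergentD by blast
  interpret G: bounded_linear G
    using linear_G norm_G
    by (intro bounded_linear_intro[of _ l]) (auto simp: linear_add linear_scale mult.commute)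
  have "mu i * coord w i = coord (G w + a0 *\<^sub>R w) i" for i
  proof (rule LIMSEQ_unique)
    show "(\<lambda>n. mu i * coord (Y n) i) \<longlonglongrightarrow> mu i * coord w i"
      by (intro tendsto_intros tendsto_coord w)
    have "(\<lambda>n. coord (G (Y n) + b n *\<^sub>R Y n + S n) i) \<longlonglongrightarrow> coord (G w + a0 *\<^sub>R w + 0) i"
      by (intro tendsto_coord tendsto_add tendsto_scaleR w bl Sl G.tendsto)
    then show "(\<lambda>n. mu i * coord (Y n) i) \<longlonglongrightarrow> coord (G w + a0 *\<^sub>R w) i"
      using eq by (simp add: Y_def b_def S_def)
  qed
  then show ?thesis using \<phi>(1) w unfolding Y_def[abs_def] by blast
qed

text \<open>Symmetry of the unbounded \<open>mu\<close>; it holds term by term in the series for the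
  inner product, so no domain has to be discussed.\<close>

lemma eigen_inner:
  assumes "eigen x x'" "eigen y y'"
  shows "inner x' y = inner x y'"
proof -
  have "coord x' i * coord y i = coord x i * coord y' i" for i
    using assms by (metis mult.assoc mult.commute)
  then show ?thesis by (simp add: inner_ell2_def)
qed

lemma \<sigma>_square: "\<sigma> * \<sigma> = 1"
  using \<sigma> by (metis abs_mult_self_eq mult_1)

text \<open>Otherwise there are unit vectors \<open>x n\<close> in the kernels of
  \<open>mu - G - \<sigma> k\<close> with \<open>k\<close> tending to 0, and a subsequence converges
  to a unit vector \<open>w\<close> in the kernel of \<open>mu - G\<close>. Symmetry makes each
  \<open>x n\<close> orthogonal to \<open>w\<close>, hence \<open>w\<close> orthogonal to
  itself.\<close>

lemma small_shift_injective:
  "\<exists>\<kappa>0>0. l + \<kappa>0 < \<beta> \<and> (\<forall>\<kappa> x. 0 < \<kappa> \<and> \<kappa> \<le> \<kappa>0 \<and> eigen x (G x + (\<sigma> * \<kappa>) *\<^sub>R x) \<longrightarrow> x = 0)"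
proof (rule ccontr)
  assume no: "\<not> ?thesis"
  \<comment> \<open>Half of the gap, so that all shifts up to \<open>q\<close> stay within the range
    of the compactness lemma.\<close>
  define q where "q = (\<beta> - l) / 2"
  have q: "q > 0" "l + q < \<beta>" using l by (auto simp: q_def field_simps)
  define \<delta> where "\<delta> n = q / (real n + 1)" for n
  have \<delta>: "0 < \<delta> n" "\<delta> n \<le> q" for n using q by (auto simp: \<delta>_def field_simps)
  have "\<exists>\<kappa> x. 0 < \<kappa> \<and> \<kappa> \<le> \<delta> n \<and> eigen x (G x + (\<sigma> * \<kappa>) *\<^sub>R x) \<and> x \<noteq> 0" for n
    using no \<delta>[of n] q by force
  then obtain k z where kz: "\<And>n. 0 < k n" "\<And>n. k n \<le> \<delta> n"
    "\<And>n. eigen (z n) (G (z n) + (\<sigma> * k n) *\<^sub>R z n)" "\<And>n. z n \<noteq> 0" by metis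
  define x where "x n = sgn (z n)" for n
  have norm_x: "norm (x n) = 1" for n using kz(4) by (simp add: x_def norm_sgn)
  have eq: "eigen (x n) (G (x n) + (\<sigma> * k n) *\<^sub>R x n)" for n
  proof
    fix i
    have "mu i * coord (x n) i = inverse (norm (z n)) * (mu i * coord (z n) i)"
      by (simp add: x_def sgn_div_norm)
    also have "\<dots> = coord (G (x n) + (\<sigma> * k n) *\<^sub>R x n) i"
      using kz(3)[of n] by (simp add: x_def sgn_div_norm linear_scale[OF linear_G] algebra_simps)
    finally show "mu i * coord (x n) i = coord (G (x n) + (\<sigma> * k n) *\<^sub>R x n) i" .
  qed
  have "\<delta> \<longlonglongrightarrow> 0"
    unfolding \<delta>_def[abs_def] by real_asymp
  have "k \<longlonglongrightarrow> 0"
    by (rule tendsto_sandwich[OF _ _ tendsto_const \<open>\<delta> \<longlonglongrightarrow> 0\<close>]) (use kz in \<open>auto intro: always_eventually less_imp_le\<close>)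
  then have k0: "(\<lambda>n. \<sigma> * k n) \<longlonglongrightarrow> \<sigma> * 0" by (intro tendsto_intros)
  have "\<exists>\<phi> w. strict_mono \<phi> \<and> (\<lambda>n. x (\<phi> n)) \<longlonglongrightarrow> w \<and> eigen w (G w + (\<sigma> * 0) *\<^sub>R w)"
  proof (rule eigen_compact[where R = "\<lambda>_. 0" and \<kappa> = q, OF _ _ _ k0])
    show "bounded (range x)" unfolding bounded_iff using norm_x by auto
    show "\<bar>\<sigma> * k n\<bar> \<le> q" for n
      using kz(1,2)[of n] \<delta>(2)[of n] \<sigma> by (simp add: abs_mult)
  qed (use q eq in auto)
  then obtain \<phi> w where w: "(\<lambda>n. x (\<phi> n)) \<longlonglongrightarrow> w" "eigen w (G w)" by auto
  have ort: "inner (x n) w = 0" for n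
  proof -
    have "inner (G (x n) + (\<sigma> * k n) *\<^sub>R x n) w = inner (x n) (G w)"
      by (rule eigen_inner[OF eq w(2)])
    then have "\<sigma> * k n * inner (x n) w = 0" by (simp add: inner_add_left G_symmetric)
    then show ?thesis using kz(1)[of n] \<sigma> by auto
  qed
  have "(\<lambda>n. inner (x (\<phi> n)) w) \<longlonglongrightarrow> inner w w" by (intro tendsto_intros w(1))
  then have "inner w w = 0" using ort by (simp add: LIMSEQ_const_iff)
  moreover have "norm w = 1"
    using tendsto_norm[OF w(1)] by (simp add: norm_x LIMSEQ_const_iff)
  ultimately show False by simp
qed

section \<open>The homotopy to the shifted linear problem and its a priori bound\<close>

definition \<kappa> :: real where
  "\<kappa> = (SOME \<kappa>0. \<kappa>0 > 0 \<and> l + \<kappa>0 < \<beta> \<and>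
    (\<forall>\<kappa> x. 0 < \<kappa> \<and> \<kappa> \<le> \<kappa>0 \<and> eigen x (G x + (\<sigma> * \<kappa>) *\<^sub>R x) \<longrightarrow> x = 0))"

text \<open>The whole interval of shifts matters: injectivity is used for \<open>\<kappa>\<close>
  itself at the linear end of the homotopy and for \<open>(1 - s0) * \<kappa>\<close> in the a
  priori bound.\<close>

lemma \<kappa>: "\<kappa> > 0" "l + \<kappa> < \<beta>"
  and shift_injective: "0 < k \<Longrightarrow> k \<le> \<kappa> \<Longrightarrow> eigen x (G x + (\<sigma> * k) *\<^sub>R x) \<Longrightarrow> x = 0"
  using someI_ex[OF small_shift_injective] unfolding \<kappa>_def[symmetric] by auto

text \<open>\<open>s = 1\<close> is the given problem, \<open>s = 0\<close> the linear one. The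
  factor \<open>\<sigma>\<close> in the shift makes both parts contribute with the same sign when
  tested with a kernel element of \<open>mu - G\<close>.\<close>

definition Nh :: "real \<Rightarrow> 'i ell2 \<Rightarrow> 'i ell2" where
  "Nh s x = s *\<^sub>R N x + (1 - s) *\<^sub>R (G x + (\<sigma> * \<kappa>) *\<^sub>R x)"

lemma Nh_eq: "Nh s x = G x + ((1 - s) * \<sigma> * \<kappa>) *\<^sub>R x + s *\<^sub>R (N x - G x)"
  by (simp add: Nh_def algebra_simps)

lemma Nh_lipschitz:
  assumes "0 \<le> s" "s \<le> 1"
  shows "norm (Nh s x - Nh s y) \<le> (l + \<kappa>) * norm (x - y)"
proof -
  have "Nh s x - Nh s y = s *\<^sub>R (N x - N y) + (1 - s) *\<^sub>R (G (x - y) + (\<sigma> * \<kappa>) *\<^sub>R (x - y))"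
    by (simp add: Nh_def linear_diff[OF linear_G] algebra_simps)
  also have "norm \<dots> \<le> s * norm (N x - N y) + (1 - s) * (norm (G (x - y)) + \<kappa> * norm (x - y))"
    using assms \<sigma> \<kappa>(1)
    by (intro norm_triangle_le add_mono)
      (auto simp: abs_mult intro!: mult_left_mono norm_triangle_le)
  also have "\<dots> \<le> s * ((l + \<kappa>) * norm (x - y)) + (1 - s) * ((l + \<kappa>) * norm (x - y))"
  proof (intro add_mono mult_left_mono)
    show "norm (N x - N y) \<le> (l + \<kappa>) * norm (x - y)"
      by (rule order_trans[OF N_lipschitz]) (use \<kappa> in \<open>auto intro!: mult_right_mono\<close>)
    show "norm (G (x - y)) + \<kappa> * norm (x - y) \<le> (l + \<kappa>) * norm (x - y)"
      using norm_G[of "x - y"] by (simp add: algebra_simps)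
  qed (use assms in auto)
  also have "\<dots> = (l + \<kappa>) * norm (x - y)" by (simp add: algebra_simps)
  finally show ?thesis .
qed

text \<open>Normalising unbounded solutions turns the nonlinear remainder into
  \<open>O(1 / norm x)\<close>, so a limit direction \<open>v\<close> solves a linear equation with
  shift \<open>(1 - s0) * \<kappa>\<close>. Injectivity of positive shifts leaves only
  \<open>s0 = 1\<close>, the resonant case, which the sign condition then rules out.\<close>

lemma a_priori_bound:
  "\<exists>\<rho>>0. \<forall>s x. 0 \<le> s \<and> s \<le> 1 \<and> eigen x (Nh s x) \<longrightarrow> norm x < \<rho>"
proof (rule ccontr)
  assume no: "\<not> ?thesis"
  have "\<exists>s x. 0 \<le> s \<and> s \<le> 1 \<and> eigen x (Nh s x) \<and> real n + 1 \<le> norm x" for n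
    using no[simplified, rule_format, of "real n + 1"] by (auto simp: not_less)
  then obtain t z where tz: "\<And>n. 0 \<le> t n" "\<And>n. t n \<le> 1" "\<And>n. eigen (z n) (Nh (t n) (z n))"
    "\<And>n. real n + 1 \<le> norm (z n)" by metis
  have "bounded (range t)" unfolding bounded_iff using tz(1,2) by (intro exI[of _ 1]) auto
  then obtain s0 r where r: "strict_mono r" "(t \<circ> r) \<longlonglongrightarrow> s0"
    using bounded_imp_convergent_subsequence by blast
  define s x where "s n = t (r n)" and "x n = z (r n)" for n
  have s: "0 \<le> s n" "s n \<le> 1" and eq: "eigen (x n) (Nh (s n) (x n))" for n
    using tz by (auto simp: s_def x_def)
  have large: "real n + 1 \<le> norm (x n)" for n
    using tz(4)[of "r n"] seq_suble[OF r(1), of n] by (simp add: x_def)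
  have nz: "norm (x n) > 0" for n using large[of n] by linarith
  have slim: "s \<longlonglongrightarrow> s0" using r(2) by (simp add: s_def[abs_def] o_def)
  have s0: "0 \<le> s0" "s0 \<le> 1"
    using LIMSEQ_le_const[OF slim] LIMSEQ_le_const2[OF slim] s by auto
  define w where "w n = sgn (x n)" for n
  define R where "R n = (s n / norm (x n)) *\<^sub>R (N (x n) - G (x n))" for n
  have norm_w: "norm (w n) = 1" for n using nz[of n] by (simp add: w_def norm_sgn)
  have inv0: "(\<lambda>n. M / (real n + 1)) \<longlonglongrightarrow> 0"
    by real_asymp
  have "R \<longlonglongrightarrow> 0"
  proof (rule tendsto_norm_zero_cancel, rule tendsto_sandwich[OF _ _ tendsto_const inv0])
    show "\<forall>\<^sub>F n in sequentially. norm (R n) \<le> M / (real n + 1)"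
    proof (rule always_eventually, rule allI)
      fix n
      have "norm (R n) = s n * norm (N (x n) - G (x n)) / norm (x n)" using s(1)[of n] by (simp add: R_def)
      also have "\<dots> \<le> 1 * M / (real n + 1)"
        using s[of n] large[of n] N_near_G order_trans[OF norm_ge_zero N_near_G]
        by (intro frac_le mult_mono) auto
      finally show "norm (R n) \<le> M / (real n + 1)" by simp
    qed
  qed simp
  have weq: "eigen (w n) (G (w n) + ((1 - s n) * \<sigma> * \<kappa>) *\<^sub>R w n + R n)" for n
  proof
    fix i
    have "mu i * coord (w n) i = inverse (norm (x n)) * (mu i * coord (x n) i)"
      by (simp add: w_def sgn_div_norm)
    also have "mu i * coord (x n) i = coord (Nh (s n) (x n)) i" using eq by simp
    also have "inverse (norm (x n)) * \<dots> = coord (G (w n) + ((1 - s n) * \<sigma> * \<kappa>) *\<^sub>R w n + R n) i"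
      by (simp add: Nh_eq w_def R_def sgn_div_norm linear_scale[OF linear_G] divide_inverse algebra_simps)
    finally show "mu i * coord (w n) i = coord (G (w n) + ((1 - s n) * \<sigma> * \<kappa>) *\<^sub>R w n + R n) i" .
  qed
  have "\<exists>\<phi> v. strict_mono \<phi> \<and> (\<lambda>n. w (\<phi> n)) \<longlonglongrightarrow> v \<and> eigen v (G v + ((1 - s0) * \<sigma> * \<kappa>) *\<^sub>R v)"
  proof (rule eigen_compact[OF _ _ \<kappa>(2) _ \<open>R \<longlonglongrightarrow> 0\<close> weq])
    show "bounded (range w)" unfolding bounded_iff using norm_w by auto
    show "\<bar>(1 - s n) * \<sigma> * \<kappa>\<bar> \<le> \<kappa>" for n
      using s[of n] \<sigma> \<kappa>(1) by (simp add: abs_mult mult_left_le_one_le)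
    show "(\<lambda>n. (1 - s n) * \<sigma> * \<kappa>) \<longlonglongrightarrow> (1 - s0) * \<sigma> * \<kappa>" by (intro tendsto_intros slim)
  qed
  then obtain \<phi> v where v: "strict_mono \<phi>" "(\<lambda>n. w (\<phi> n)) \<longlonglongrightarrow> v"
    "eigen v (G v + ((1 - s0) * \<sigma> * \<kappa>) *\<^sub>R v)" by blast
  have norm_v: "norm v = 1"
    using tendsto_norm[OF v(2)] by (simp add: norm_w LIMSEQ_const_iff)
  have "s0 = 1"
  proof (rule ccontr)
    assume "s0 \<noteq> 1"
    then have "v = 0"
      using s0 \<kappa>(1) v(3)
      by (intro shift_injective[of "(1 - s0) * \<kappa>"]) (auto simp: mult_left_le_one_le mult.assoc mult.left_commute)
    then show False using norm_v by simp
  qed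
  then have ev: "eigen v (G v)" using v(3) by simp
  have "filterlim (\<lambda>n. norm (x (\<phi> n))) at_top sequentially"
  proof (rule filterlim_at_top_mono)
    show "filterlim (\<lambda>n. real n) at_top sequentially" by (rule filterlim_real_sequentially)
    show "\<forall>\<^sub>F n in sequentially. real n \<le> norm (x (\<phi> n))"
    proof (rule always_eventually, rule allI)
      fix n
      show "real n \<le> norm (x (\<phi> n))" using large[of "\<phi> n"] seq_suble[OF v(1), of n] by linarith
    qed
  qed
  then have pos1: "\<forall>\<^sub>F n in sequentially. \<sigma> * inner (N (x (\<phi> n)) - G (x (\<phi> n))) v > 0"
    using v(2) norm_v unfolding w_def by (rule sign_at_infinity)
  have "(\<lambda>n. inner (w (\<phi> n)) v) \<longlonglongrightarrow> inner v v" by (intro tendsto_intros v(2))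
  then have pos2: "\<forall>\<^sub>F n in sequentially. inner (w (\<phi> n)) v > 0"
    by (rule order_tendstoD) (use norm_v in \<open>simp add: dot_square_norm\<close>)
  obtain n where n: "\<sigma> * inner (N (x (\<phi> n)) - G (x (\<phi> n))) v > 0" "inner (w (\<phi> n)) v > 0"
    using eventually_conj[OF pos1 pos2] eventually_happens by force
  let ?n = "\<phi> n"
  have ip: "inner (x ?n) v > 0"
    using n(2) nz[of ?n] by (simp add: w_def sgn_div_norm zero_less_mult_iff)
  \<comment> \<open>Testing with the kernel element \<open>v\<close> removes \<open>mu\<close> and
    \<open>G\<close> altogether: only the shift and the bounded remainder \<open>N - G\<close>
    survive.\<close>
  have "inner (Nh (s ?n) (x ?n)) v = inner (x ?n) (G v)"
    by (rule eigen_inner[OF eq ev])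
  then have "(1 - s ?n) * \<sigma> * \<kappa> * inner (x ?n) v + s ?n * inner (N (x ?n) - G (x ?n)) v = 0"
    unfolding Nh_eq by (simp add: inner_add_left G_symmetric del: inner_diff_left)
  \<comment> \<open>Multiplying by \<open>\<sigma>\<close> and using
    \<open>\<sigma> * \<sigma> = 1\<close> turns both surviving terms into nonnegative
    numbers.\<close>
  moreover have "\<sigma> * ((1 - s ?n) * \<sigma> * \<kappa> * i + s ?n * j) =
      (\<sigma> * \<sigma>) * ((1 - s ?n) * (\<kappa> * i)) + s ?n * (\<sigma> * j)" for i j
    by (simp add: algebra_simps)
  ultimately have sum0: "(1 - s ?n) * (\<kappa> * inner (x ?n) v) + s ?n * (\<sigma> * inner (N (x ?n) - G (x ?n)) v) = 0"
    unfolding \<sigma>_square by (metis mult_1 mult_zero_right)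
  have "0 \<le> (1 - s ?n) * (\<kappa> * inner (x ?n) v)" "0 \<le> s ?n * (\<sigma> * inner (N (x ?n) - G (x ?n)) v)"
    using s[of ?n] ip n(1) \<kappa>(1) by (simp_all del: inner_diff_left)
  with sum0 have "(1 - s ?n) * (\<kappa> * inner (x ?n) v) = 0" "s ?n * (\<sigma> * inner (N (x ?n) - G (x ?n)) v) = 0"
    by linarith+
  \<comment> \<open>Both tested quantities are strictly positive, so their coefficients
    \<open>1 - s\<close> and \<open>s\<close> would have to vanish together.\<close>
  then have "1 - s ?n = 0" "s ?n = 0" using n(1) ip \<kappa>(1) by (auto simp del: inner_diff_left)
  then show False by simp
qed

text \<open>Lyapunov-Schmidt reduction: for \<open>y\<close> in \<open>coord_space I\<close> this is
  the vector with component \<open>y\<close> on \<open>I\<close> that solves the equation for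
  parameter \<open>s\<close> in all modes off \<open>I\<close>. It is defined for every
  \<open>y\<close>, which keeps the continuity statements on the whole space.\<close>

definition Sol :: "real \<Rightarrow> 'i ell2 \<Rightarrow> 'i ell2" where
  "Sol s y = (THE x. y + K (Nh s x) = x)"

lemma K_Nh_lipschitz:
  assumes "0 \<le> s" "s \<le> 1"
  shows "norm (K (Nh s x) - K (Nh s x')) \<le> (l + \<kappa>) / \<beta> * norm (x - x')"
proof -
  have "norm (K (Nh s x) - K (Nh s x')) \<le> norm (Nh s x - Nh s x') / \<beta>"
    using norm_K[of "Nh s x - Nh s x'"] by (simp add: linear_diff[OF linear_K])
  also have "\<dots> \<le> ((l + \<kappa>) * norm (x - x')) / \<beta>"
    using \<beta>_pos by (intro divide_right_mono Nh_lipschitz assms) auto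
  finally show ?thesis by simp
qed

lemma contraction_constant: "0 \<le> (l + \<kappa>) / \<beta>" "(l + \<kappa>) / \<beta> < 1"
  using l \<kappa> by auto

text \<open>Banach's fixed point theorem; the constant \<open>(l + \<kappa>) / \<beta>\<close> is
  the same for all parameters of the homotopy.\<close>

lemma Sol_ex1:
  assumes "0 \<le> s" "s \<le> 1"
  shows "\<exists>!x. y + K (Nh s x) = x"
  by (rule banach_fix_type[OF contraction_constant])
    (use K_Nh_lipschitz[OF assms] in \<open>simp add: dist_norm\<close>)

lemma Sol_eq: "0 \<le> s \<Longrightarrow> s \<le> 1 \<Longrightarrow> y + K (Nh s (Sol s y)) = Sol s y"
  unfolding Sol_def by (rule theI'[OF Sol_ex1])

lemma Sol_unique: "0 \<le> s \<Longrightarrow> s \<le> 1 \<Longrightarrow> y + K (Nh s x) = x \<Longrightarrow> Sol s y = x"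
  unfolding Sol_def by (rule the1_equality[OF Sol_ex1])

lemma restr_Sol:
  assumes "0 \<le> s" "s \<le> 1" "y \<in> coord_space I"
  shows "restr I (Sol s y) = y"
proof -
  have "restr I (Sol s y) = restr I (y + K (Nh s (Sol s y)))"
    using assms by (simp only: Sol_eq)
  also have "\<dots> = restr I y"
    by (simp only: linear_add[OF linear_restr] restr_K add_0_right)
  also have "\<dots> = y" using assms(3) by (simp only: coord_space_def mem_Collect_eq)
  finally show ?thesis .
qed

text \<open>The usual dependence of a fixed point on parameters: the difference is split at
  \<open>K (Nh s ?x')\<close>, one part being absorbed by the contraction. Only the norm of the
  second solution occurs, so fixing that one at the base point gives continuity.\<close>

lemma Sol_dependence:
  assumes "0 \<le> s" "s \<le> 1" "0 \<le> s'" "s' \<le> 1"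
  shows "(\<beta> - l - \<kappa>) * norm (Sol s y - Sol s' y') \<le>
    \<beta> * norm (y - y') + \<bar>s - s'\<bar> * (M + \<kappa> * norm (Sol s' y'))"
proof -
  let ?x = "Sol s y" and ?x' = "Sol s' y'"
  have "Nh s ?x' - Nh s' ?x' = (s - s') *\<^sub>R ((N ?x' - G ?x') - (\<sigma> * \<kappa>) *\<^sub>R ?x')"
    by (simp add: Nh_def algebra_simps)
  also have "norm \<dots> \<le> \<bar>s - s'\<bar> * (M + \<kappa> * norm ?x')"
    using \<sigma> \<kappa>(1) N_near_G[of ?x']
    by (auto simp: abs_mult intro!: mult_left_mono order_trans[OF norm_triangle_ineq4])
  finally have 1: "norm (Nh s ?x' - Nh s' ?x') \<le> \<bar>s - s'\<bar> * (M + \<kappa> * norm ?x')" .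
  have "?x - ?x' = (y - y') + (K (Nh s ?x) - K (Nh s ?x')) + K (Nh s ?x' - Nh s' ?x')"
  proof -
    have "?x - ?x' = (y + K (Nh s ?x)) - (y' + K (Nh s' ?x'))"
      by (intro arg_cong2[where f = minus] Sol_eq[symmetric] assms)
    also have "\<dots> = (y - y') + (K (Nh s ?x) - K (Nh s ?x')) + K (Nh s ?x' - Nh s' ?x')"
      by (simp add: linear_diff[OF linear_K])
    finally show ?thesis .
  qed
  then have "norm (?x - ?x') \<le> norm (y - y') + norm (K (Nh s ?x) - K (Nh s ?x')) + norm (K (Nh s ?x' - Nh s' ?x'))"
    by (metis norm_triangle_ineq norm_triangle_le add_mono order_refl)
  moreover have "norm (K (Nh s ?x' - Nh s' ?x')) \<le> \<bar>s - s'\<bar> * (M + \<kappa> * norm ?x') / \<beta>"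
    by (rule order_trans[OF norm_K divide_right_mono[OF 1]]) (use \<beta>_pos in simp)
  moreover note K_Nh_lipschitz[OF assms(1,2), of ?x ?x']
  ultimately have 2: "norm (?x - ?x') \<le> norm (y - y') + (l + \<kappa>) / \<beta> * norm (?x - ?x') + \<bar>s - s'\<bar> * (M + \<kappa> * norm ?x') / \<beta>"
    by linarith
  have "(\<beta> - l - \<kappa>) * d \<le> \<beta> * e + c" if "d \<le> e + (l + \<kappa>) / \<beta> * d + c / \<beta>" for d e c
    using that \<beta>_pos by (simp add: field_simps)
  from this[OF 2] show ?thesis .
qed

text \<open>The parameter is allowed to vary with \<open>y\<close> because the homotopy will be
  driven by the norm of the finite-dimensional component.\<close>

lemma continuous_Sol:
  assumes s: "continuous_on UNIV s" "\<And>y. 0 \<le> s y" "\<And>y. s y \<le> 1"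
  shows "continuous_on UNIV (\<lambda>y. Sol (s y) y)"
proof (rule continuous_at_imp_continuous_on, rule ballI)
  fix y
  let ?q = "\<beta> - l - \<kappa>"
  have q: "?q > 0" using \<kappa>(2) by simp
  have "continuous_on UNIV (\<lambda>y'. (\<beta> * norm (y' - y) + \<bar>s y' - s y\<bar> * (M + \<kappa> * norm (Sol (s y) y))) / ?q)"
    using q by (intro continuous_intros s) auto
  then have "isCont (\<lambda>y'. (\<beta> * norm (y' - y) + \<bar>s y' - s y\<bar> * (M + \<kappa> * norm (Sol (s y) y))) / ?q) y"
    by (simp add: continuous_on_eq_continuous_at)
  from isContD[OF this] have lim: "((\<lambda>y'. (\<beta> * norm (y' - y) + \<bar>s y' - s y\<bar> * (M + \<kappa> * norm (Sol (s y) y))) / ?q) \<longlongrightarrow> 0) (at y)"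
    by simp
  have "((\<lambda>y'. Sol (s y') y' - Sol (s y) y) \<longlongrightarrow> 0) (at y)"
  proof (rule tendsto_norm_zero_cancel, rule tendsto_sandwich[OF _ _ tendsto_const lim])
    show "\<forall>\<^sub>F y' in at y. norm (Sol (s y') y' - Sol (s y) y) \<le>
        (\<beta> * norm (y' - y) + \<bar>s y' - s y\<bar> * (M + \<kappa> * norm (Sol (s y) y))) / ?q"
      using Sol_dependence[OF s(2,3) s(2,3)] q
      by (intro always_eventually allI) (simp add: pos_le_divide_eq mult.commute)
  qed simp
  then show "isCont (\<lambda>y. Sol (s y) y) y"
    by (simp add: isCont_def LIM_zero_iff)
qed

text \<open>
  The homotopy parameter is switched off far away from the origin, as a function of the
  finite-dimensional component: there the reduced map is linear and injective, so it has a
  zero somewhere, and the a priori bound forces this zero into the region where \<open>Nh\<close> is \<open>N\<close>.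
\<close>

theorem solvable: "\<exists>x. eigen x (N x)"
proof -
  obtain \<rho> where \<rho>: "\<rho> > 0" "\<And>s x. 0 \<le> s \<Longrightarrow> s \<le> 1 \<Longrightarrow> eigen x (Nh s x) \<Longrightarrow> norm x < \<rho>"
    using a_priori_bound by blast
  \<comment> \<open>Equal to 1 for \<open>norm y \<le> \<rho>\<close> and to 0 for
    \<open>norm y \<ge> \<rho> + 1\<close>.\<close>
  define s :: "'i ell2 \<Rightarrow> real" where "s y = max 0 (min 1 (\<rho> + 1 - norm y))" for y
  have s: "continuous_on UNIV s" "0 \<le> s y" "s y \<le> 1" for y
    unfolding s_def by (auto intro!: continuous_intros)
  \<comment> \<open>Truncating \<open>mu\<close> to the small modes gives a bounded multiplier, so
    that \<open>diag\<close> applies.\<close>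
  define mI where "mI i = (if i \<in> I then mu i else 0)" for i
  have mI: "\<bar>mI i\<bar> \<le> \<beta>" for i using \<beta>_pos by (simp add: mI_def)
  define F where "F y = diag mI y - restr I (Nh (s y) (Sol (s y) y))" for y
  define B where "B y = diag mI y - restr I (Nh 0 (Sol 0 y))" for y
  \<comment> \<open>At parameter 0 the fixed point equation is linear, and uniqueness passes
    linearity on to its solution.\<close>
  have lin_Sol0: "linear (Sol 0)"
  proof (rule linearI)
    have N0: "Nh 0 x = G x + (\<sigma> * \<kappa>) *\<^sub>R x" for x by (simp add: Nh_def)
    have lin: "linear (\<lambda>x. K (Nh 0 x))"
      unfolding N0 using linear_compose[OF linear_compose_add[OF linear_G linear_compose_scale_right[OF linear_id]] linear_K]
      by (simp add: o_def)
    show "Sol 0 (x + y) = Sol 0 x + Sol 0 y" for x y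
    proof (rule Sol_unique)
      have "x + y + K (Nh 0 (Sol 0 x + Sol 0 y)) = (x + K (Nh 0 (Sol 0 x))) + (y + K (Nh 0 (Sol 0 y)))"
        by (simp only: linear_add[OF lin] ac_simps)
      then show "x + y + K (Nh 0 (Sol 0 x + Sol 0 y)) = Sol 0 x + Sol 0 y" by (simp add: Sol_eq)
    qed auto
    show "Sol 0 (r *\<^sub>R x) = r *\<^sub>R Sol 0 x" for r x
    proof (rule Sol_unique)
      have "r *\<^sub>R x + K (Nh 0 (r *\<^sub>R Sol 0 x)) = r *\<^sub>R (x + K (Nh 0 (Sol 0 x)))"
        by (simp only: linear_scale[OF lin] scaleR_add_right)
      then show "r *\<^sub>R x + K (Nh 0 (r *\<^sub>R Sol 0 x)) = r *\<^sub>R Sol 0 x" by (simp add: Sol_eq)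
    qed auto
  qed
  \<comment> \<open>The reduced equation provides the modes in \<open>I\<close>, the fixed point
    equation those outside; together they are the full equation.\<close>
  have zero: "eigen (Sol t y) (Nh t (Sol t y))"
    if y: "y \<in> coord_space I" and t: "0 \<le> t" "t \<le> 1"
      and 0: "diag mI y - restr I (Nh t (Sol t y)) = 0" for y t
  proof
    fix i
    show "mu i * coord (Sol t y) i = coord (Nh t (Sol t y)) i"
    proof (cases "i \<in> I")
      case True
      have "coord (diag mI y) i = coord (restr I (Nh t (Sol t y))) i" using 0 by simp
      then have "mu i * coord y i = coord (Nh t (Sol t y)) i"
        using True by (simp add: coord_diag[OF mI] mI_def)
      moreover have "coord (Sol t y) i = coord y i"
        using arg_cong[OF restr_Sol[OF t y], of "\<lambda>x. coord x i"] True by simp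
      ultimately show ?thesis by simp
    next
      case False
      have "coord (Sol t y) i = coord (y + K (Nh t (Sol t y))) i" by (simp add: Sol_eq t)
      also have "\<dots> = coord (Nh t (Sol t y)) i / mu i"
        using False y by (simp add: coord_K coord_space_iff)
      finally show ?thesis using False \<beta>_pos by auto
    qed
  qed
  have "\<exists>y \<in> coord_space I. F y = 0"
  proof (rule zero_of_linear_at_infinity[OF finite_small])
    have cont_N: "continuous_on UNIV N"
    proof (rule lipschitz_on_continuous_on)
      show "l-lipschitz_on UNIV N"
        using N_lipschitz l(1) by (auto simp: lipschitz_on_def dist_norm)
    qed
    have bl: "bounded_linear G"
      using linear_G norm_G
      by (intro bounded_linear_intro[of _ l]) (auto simp: linear_add linear_scale mult.commute)
    have bd: "bounded_linear (diag mI)"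
      using linear_diag[where m = mI, OF mI] norm_diag_le[where m = mI, OF mI]
      by (intro bounded_linear_intro[of _ \<beta>]) (auto simp: linear_add linear_scale mult.commute)
    show "continuous_on (coord_space I) F"
      unfolding F_def Nh_def
      by (rule continuous_on_subset[of UNIV])
        (intro continuous_intros s(1) continuous_Sol[OF s] bounded_linear.continuous_on[OF bounded_linear_restr]
          bounded_linear.continuous_on[OF bl] bounded_linear.continuous_on[OF bd]
          continuous_on_compose2[OF cont_N] subset_UNIV)+
    show "F y \<in> coord_space I" "B y \<in> coord_space I" if "y \<in> coord_space I" for y
      by (simp_all add: F_def B_def coord_space_iff coord_diag[OF mI] mI_def)
    have "linear (\<lambda>y. restr I (Nh 0 (Sol 0 y)))"
    proof -
      have "linear (Nh 0)"
        unfolding Nh_def using linear_compose_add[OF linear_G linear_compose_scale_right[OF linear_id], of "\<sigma> * \<kappa>"]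
        by (simp add: o_def)
      from linear_compose[OF linear_compose[OF lin_Sol0 this] linear_restr] show ?thesis by (simp add: o_def)
    qed
    then show "linear B" unfolding B_def by (intro linear_compose_sub linear_diag[OF mI])
    show "y = 0" if y: "y \<in> coord_space I" "B y = 0" for y
    proof -
      have "eigen (Sol 0 y) (Nh 0 (Sol 0 y))" using zero[OF y(1), of 0] y(2) by (simp add: B_def)
      then have "Sol 0 y = 0"
        by (intro shift_injective[of \<kappa>]) (auto simp: \<kappa> Nh_def)
      then have "restr I (Sol 0 y) = 0" by (simp add: linear_0[OF linear_restr])
      then show ?thesis by (simp add: restr_Sol y)
    qed
    show "F y = B y" if "norm y \<ge> \<rho> + 1" for y
    proof -
      have "s y = 0" using that by (simp add: s_def)
      then show ?thesis by (simp add: F_def B_def)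
    qed
  qed
  then obtain y where y: "y \<in> coord_space I" "F y = 0" by blast
  let ?x = "Sol (s y) y"
  have sol: "eigen ?x (Nh (s y) ?x)" using zero[OF y(1) s(2,3)] y(2) by (simp add: F_def)
  \<comment> \<open>\<open>y\<close> is a projection of the solution, so the a priori bound for the
    solution puts \<open>y\<close> where the parameter equals 1.\<close>
  have "norm y \<le> norm ?x" using norm_restr_le[of I ?x] by (simp add: restr_Sol s y)
  also have "norm ?x < \<rho>" by (rule \<rho>(2)[OF s(2,3) sol])
  finally have "s y = 1" by (simp add: s_def)
  then show ?thesis using sol by (auto simp: Nh_def)
qed

end

subsection \<open>Square integrable functions and orthonormal bases\<close>

definition sqint :: "'a measure \<Rightarrow> ('a \<Rightarrow> real) set" where
  "sqint M = {u \<in> borel_measurable M. integrable M (\<lambda>z. (u z)\<^sup>2)}"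

lemma sqint_measurable: "u \<in> sqint M \<Longrightarrow> u \<in> borel_measurable M"
  and sqint_integrable: "u \<in> sqint M \<Longrightarrow> integrable M (\<lambda>z. (u z)\<^sup>2)"
  by (auto simp: sqint_def)

lemma sqint_mult: "u \<in> sqint M \<Longrightarrow> v \<in> sqint M \<Longrightarrow> integrable M (\<lambda>z. u z * v z)"
  by (rule Bochner_Integration.integrable_bound[of M "\<lambda>z. (u z)\<^sup>2 + (v z)\<^sup>2"])
    (auto simp: sqint_def abs_mult_le_squares)

lemma sqint_add: "u \<in> sqint M \<Longrightarrow> v \<in> sqint M \<Longrightarrow> (\<lambda>z. u z + v z) \<in> sqint M"
  using sqint_mult[of u M v] by (auto simp: sqint_def power2_sum mult.assoc)

lemma sqint_cmult: "u \<in> sqint M \<Longrightarrow> (\<lambda>z. c * u z) \<in> sqint M"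
  by (auto simp: sqint_def power_mult_distrib)

lemma sqint_diff: "u \<in> sqint M \<Longrightarrow> v \<in> sqint M \<Longrightarrow> (\<lambda>z. u z - v z) \<in> sqint M"
  using sqint_add[of u M "\<lambda>z. (- 1) * v z"] sqint_cmult[of v M "- 1"] by simp

lemma sqint_sum: "(\<And>i. i \<in> F \<Longrightarrow> u i \<in> sqint M) \<Longrightarrow> (\<lambda>z. \<Sum>i\<in>F. u i z) \<in> sqint M"
proof (induction F rule: infinite_finite_induct)
  case (insert i F)
  then show ?case using sqint_add[of "u i" M "\<lambda>z. \<Sum>i\<in>F. u i z"] by simp
qed (auto simp: sqint_def)

lemma sqint_bound:
  assumes "v \<in> sqint M" "u \<in> borel_measurable M" "\<And>z. z \<in> space M \<Longrightarrow> \<bar>u z\<bar> \<le> \<bar>v z\<bar>"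
  shows "u \<in> sqint M"
proof -
  have "integrable M (\<lambda>z. (u z)\<^sup>2)"
    by (rule Bochner_Integration.integrable_bound[OF sqint_integrable[OF assms(1)]])
      (use assms(2,3) in \<open>auto simp: abs_le_square_iff[symmetric]\<close>)
  then show ?thesis using assms(2) by (simp add: sqint_def)
qed

text \<open>The classical completeness proof for functions rather than classes: a rapidly Cauchy
  subsequence converges almost everywhere, and Fatou's lemma identifies the pointwise limit as the
  limit in mean square.\<close>

lemma sqint_complete:
  assumes S: "\<And>n :: nat. S n \<in> sqint M"
    and C: "\<And>\<epsilon>. \<epsilon> > 0 \<Longrightarrow> \<exists>N. \<forall>m\<ge>N. \<forall>n\<ge>N. (LINT z|M. (S m z - S n z)\<^sup>2) \<le> \<epsilon>"
  shows "\<exists>u\<in>sqint M. (\<lambda>n. LINT z|M. (u z - S n z)\<^sup>2) \<longlonglongrightarrow> 0"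
proof -
  have meas [measurable]: "S n \<in> borel_measurable M" for n by (rule sqint_measurable[OF S])
  \<comment> \<open>The rate \<open>1/8\<close> beats the weight \<open>4 ^ k\<close> used below:
    the weighted increments sum to a finite integral, and a bound on
    \<open>4 ^ k * (D k z)\<^sup>2\<close> makes \<open>D k z\<close> decay like
    \<open>2 ^ (- k)\<close>.\<close>
  obtain N where N: "\<And>k m n. m \<ge> N k \<Longrightarrow> n \<ge> N k \<Longrightarrow> (LINT z|M. (S m z - S n z)\<^sup>2) \<le> (1/8) ^ k"
  proof -
    have "\<exists>N. \<forall>m\<ge>N. \<forall>n\<ge>N. (LINT z|M. (S m z - S n z)\<^sup>2) \<le> (1/8) ^ k" for k by (rule C) simp
    then show thesis using that by metis
  qed
  \<comment> \<open>Summing the thresholds makes \<open>r\<close> monotone while keeping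
    \<open>r k\<close> above both \<open>k\<close> and \<open>N k\<close>.\<close>
  define r where "r k = k + (\<Sum>i\<le>k. N i)" for k
  have r: "r k \<ge> k" "r k \<ge> N k" "r (Suc k) \<ge> r k" for k
    using member_le_sum[of k "{..k}" N] by (auto simp: r_def)
  have rk: "r (Suc k) \<ge> N k" for k using r(2)[of k] r(3)[of k] by linarith
  define D where "D k z = S (r (Suc k)) z - S (r k) z" for k z
  have D_meas [measurable]: "D k \<in> borel_measurable M" for k unfolding D_def[abs_def] by measurable
  have D_sq: "integrable M (\<lambda>z. (D k z)\<^sup>2)" for k
    unfolding D_def by (rule sqint_integrable[OF sqint_diff[OF S S]])
  have nn: "(\<integral>\<^sup>+z. ennreal (4 ^ k * (D k z)\<^sup>2) \<partial>M) \<le> ennreal ((1/2) ^ k)" for k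
  proof -
    have "(\<integral>\<^sup>+z. ennreal (4 ^ k * (D k z)\<^sup>2) \<partial>M) = ennreal (LINT z|M. 4 ^ k * (D k z)\<^sup>2)"
      by (rule nn_integral_eq_integral) (auto intro: D_sq)
    also have "\<dots> \<le> ennreal (4 ^ k * (1/8) ^ k)"
      using N[OF rk r(2)] by (intro ennreal_leI) (simp add: D_def)
    also have "4 ^ k * (1/8) ^ k = ((1/2) ^ k :: real)" by (simp flip: power_mult_distrib)
    finally show ?thesis .
  qed
  have "(\<integral>\<^sup>+z. suminf (\<lambda>k. ennreal (4 ^ k * (D k z)\<^sup>2)) \<partial>M) = suminf (\<lambda>k. \<integral>\<^sup>+z. ennreal (4 ^ k * (D k z)\<^sup>2) \<partial>M)"
    by (rule nn_integral_suminf) measurable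
  also have "\<dots> \<le> suminf (\<lambda>k. ennreal ((1/2) ^ k))" by (intro suminf_le nn) auto
  also have "\<dots> = ennreal (suminf (\<lambda>k. (1/2) ^ k))"
    by (intro suminf_ennreal2 summable_geometric) auto
  finally have "(\<integral>\<^sup>+z. suminf (\<lambda>k. ennreal (4 ^ k * (D k z)\<^sup>2)) \<partial>M) \<noteq> \<infinity>"
    unfolding infinity_ennreal_def by (rule neq_top_trans[OF ennreal_neq_top])
  then have "AE z in M. suminf (\<lambda>k. ennreal (4 ^ k * (D k z)\<^sup>2)) \<noteq> \<infinity>"
    by (intro nn_integral_noteq_infinite) auto
  then have AE_conv: "AE z in M. convergent (\<lambda>k. S (r k) z)"
  proof eventually_elim
    case (elim z)
    then have "summable (\<lambda>k. 4 ^ k * (D k z)\<^sup>2)"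
      by (intro summable_suminf_not_top) auto
    then have "bounded (range (\<lambda>k. 4 ^ k * (D k z)\<^sup>2))"
      by (rule convergent_imp_bounded[OF summable_LIMSEQ_zero])
    then obtain B where "\<forall>x\<in>range (\<lambda>k. 4 ^ k * (D k z)\<^sup>2). norm x \<le> B"
      unfolding bounded_iff by (rule exE)
    then have B: "4 ^ k * (D k z)\<^sup>2 \<le> B" for k by auto
    have "norm (D k z) \<le> sqrt B * (1/2) ^ k" for k
    proof -
      have "(2 ^ k * \<bar>D k z\<bar>)\<^sup>2 \<le> B"
        using B[of k] by (simp add: power_mult_distrib power_mult[symmetric] mult.commute[of k] power_mult)
      then have "2 ^ k * \<bar>D k z\<bar> \<le> sqrt B" by (rule real_le_rsqrt)
      then show ?thesis by (simp add: field_simps power_divide)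
    qed
    moreover have "summable (\<lambda>k. sqrt B * (1/2) ^ k)"
      by (rule summable_mult, rule summable_geometric) simp
    ultimately have "summable (\<lambda>k. D k z)"
      using summable_comparison_test'[of "\<lambda>k. sqrt B * (1/2) ^ k" 0 "\<lambda>k. D k z"] by blast
    then have "convergent (\<lambda>n. \<Sum>k<n. D k z)" by (simp add: summable_iff_convergent)
    then have "convergent (\<lambda>n. S (r 0) z + (\<Sum>k<n. D k z))" by (intro convergent_add convergent_const)
    moreover have "S (r 0) z + (\<Sum>k<n. D k z) = S (r n) z" for n
      using sum_lessThan_telescope[of "\<lambda>k. S (r k) z" n] by (simp add: D_def)
    ultimately show ?case by simp
  qed
  define u where "u z = lim (\<lambda>k. S (r k) z)" for z
  have [measurable]: "u \<in> borel_measurable M" unfolding u_def[abs_def] by measurable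
  have AE_lim: "AE z in M. (\<lambda>k. S (r k) z) \<longlonglongrightarrow> u z"
    using AE_conv by eventually_elim (simp add: u_def convergent_LIMSEQ_iff)
  have fatou: "(\<integral>\<^sup>+z. ennreal ((u z - S n z)\<^sup>2) \<partial>M) \<le> ennreal \<epsilon>"
    if \<epsilon>: "\<And>m. m \<ge> N0 \<Longrightarrow> (LINT z|M. (S m z - S n z)\<^sup>2) \<le> \<epsilon>" for n N0 \<epsilon>
  proof -
    have "(\<integral>\<^sup>+z. ennreal ((u z - S n z)\<^sup>2) \<partial>M) = (\<integral>\<^sup>+z. liminf (\<lambda>k. ennreal ((S (r k) z - S n z)\<^sup>2)) \<partial>M)"
    proof (rule nn_integral_cong_AE, use AE_lim in eventually_elim)
      case (elim z)
      then have "(\<lambda>k. ennreal ((S (r k) z - S n z)\<^sup>2)) \<longlonglongrightarrow> ennreal ((u z - S n z)\<^sup>2)"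
        by (intro tendsto_intros tendsto_ennrealI)
      then show ?case by (rule lim_imp_Liminf[OF sequentially_bot, symmetric])
    qed
    also have "\<dots> \<le> liminf (\<lambda>k. \<integral>\<^sup>+z. ennreal ((S (r k) z - S n z)\<^sup>2) \<partial>M)"
      by (rule nn_integral_liminf) measurable
    also have "\<dots> \<le> limsup (\<lambda>k. \<integral>\<^sup>+z. ennreal ((S (r k) z - S n z)\<^sup>2) \<partial>M)"
      by (rule Liminf_le_Limsup) simp
    also have "\<dots> \<le> ennreal \<epsilon>"
    proof (rule Limsup_bounded, use eventually_ge_at_top[of N0] in eventually_elim)
      case (elim k)
      have "(\<integral>\<^sup>+z. ennreal ((S (r k) z - S n z)\<^sup>2) \<partial>M) = ennreal (LINT z|M. (S (r k) z - S n z)\<^sup>2)"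
        by (rule nn_integral_eq_integral) (auto intro: sqint_integrable[OF sqint_diff[OF S S]])
      also have "\<dots> \<le> ennreal \<epsilon>"
        using r(1)[of k] elim by (intro ennreal_leI \<epsilon>) linarith
      finally show ?case .
    qed
    finally show ?thesis .
  qed
  have usq: "integrable M (\<lambda>z. (u z - S n z)\<^sup>2) \<and> (LINT z|M. (u z - S n z)\<^sup>2) \<le> \<epsilon>"
    if "\<epsilon> > 0" "\<And>m. m \<ge> N0 \<Longrightarrow> (LINT z|M. (S m z - S n z)\<^sup>2) \<le> \<epsilon>" for n N0 \<epsilon>
  proof -
    have f: "(\<integral>\<^sup>+z. ennreal ((u z - S n z)\<^sup>2) \<partial>M) \<le> ennreal \<epsilon>"
      by (rule fatou[of N0]) fact
    then have i: "integrable M (\<lambda>z. (u z - S n z)\<^sup>2)"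
      by (intro integrableI_bounded) (auto intro: le_less_trans)
    have "ennreal (LINT z|M. (u z - S n z)\<^sup>2) \<le> ennreal \<epsilon>"
      using f nn_integral_eq_integral[OF i] by simp
    then show ?thesis using i that(1) by (simp add: ennreal_le_iff)
  qed
  show ?thesis
  proof
    have "(\<lambda>z. u z - S (N 0) z) \<in> sqint M"
      using usq[of 1 "N 0" "N 0"] N[of 0 _ "N 0"] by (simp add: sqint_def)
    from sqint_add[OF this S[of "N 0"]] show "u \<in> sqint M" by simp
    show "(\<lambda>n. LINT z|M. (u z - S n z)\<^sup>2) \<longlonglongrightarrow> 0"
    proof (rule LIMSEQ_I)
      fix e :: real assume "e > 0"
      then obtain N0 where N0: "\<forall>m\<ge>N0. \<forall>n\<ge>N0. (LINT z|M. (S m z - S n z)\<^sup>2) \<le> e / 2" using C[of "e / 2"] by auto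
      have "(LINT z|M. (u z - S n z)\<^sup>2) \<le> e / 2" if "n \<ge> N0" for n
        using usq[of "e / 2" N0 n] \<open>e > 0\<close> N0 that by simp
      then have "norm ((LINT z|M. (u z - S n z)\<^sup>2) - 0) < e" if "n \<ge> N0" for n
        using that \<open>e > 0\<close> by (fastforce intro: le_less_trans)
      then show "\<exists>N. \<forall>n\<ge>N. norm ((LINT z|M. (u z - S n z)\<^sup>2) - 0) < e" by blast
    qed
  qed
qed

text \<open>Totality is assumed as triviality of the orthogonal complement, the form in which a
  Stone-Weierstrass argument delivers it. Parseval's identity is derived from it through
  Riesz-Fischer.\<close>

locale L2_basis =
  fixes M :: "'a measure" and e :: "'i :: countable \<Rightarrow> 'a \<Rightarrow> real"
  assumes e_sqint: "e i \<in> sqint M"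
    and orthonormal: "(LINT z|M. e i z * e j z) = (if i = j then 1 else 0)"
    and total: "u \<in> sqint M \<Longrightarrow> (\<And>i. (LINT z|M. u z * e i z) = 0) \<Longrightarrow> AE z in M. u z = 0"
begin

definition fc :: "('a \<Rightarrow> real) \<Rightarrow> 'i \<Rightarrow> real" where
  "fc u i = (LINT z|M. u z * e i z)"

lemma fc_integrable: "u \<in> sqint M \<Longrightarrow> integrable M (\<lambda>z. u z * e i z)"
  by (rule sqint_mult[OF _ e_sqint])

lemma fc_add: "u \<in> sqint M \<Longrightarrow> v \<in> sqint M \<Longrightarrow> fc (\<lambda>z. u z + v z) i = fc u i + fc v i"
  unfolding fc_def distrib_right by (rule Bochner_Integration.integral_add) (rule fc_integrable, assumption)+

lemma fc_cmult: "fc (\<lambda>z. c * u z) i = c * fc u i"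
  by (simp add: fc_def mult.assoc)

lemma fc_diff: "u \<in> sqint M \<Longrightarrow> v \<in> sqint M \<Longrightarrow> fc (\<lambda>z. u z - v z) i = fc u i - fc v i"
  unfolding fc_def left_diff_distrib by (rule Bochner_Integration.integral_diff) (rule fc_integrable, assumption)+

lemma comb_sqint: "(\<lambda>z. \<Sum>i\<in>F. a i * e i z) \<in> sqint M"
  by (intro sqint_sum sqint_cmult e_sqint)

lemma integral_mult_comb:
  "u \<in> sqint M \<Longrightarrow> (LINT z|M. u z * (\<Sum>i\<in>F. a i * e i z)) = (\<Sum>i\<in>F. a i * fc u i)"
proof -
  assume u: "u \<in> sqint M"
  have "(LINT z|M. u z * (\<Sum>i\<in>F. a i * e i z)) = (LINT z|M. (\<Sum>i\<in>F. a i * (u z * e i z)))"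
    by (simp add: sum_distrib_left mult_ac)
  also have "\<dots> = (\<Sum>i\<in>F. a i * fc u i)"
    unfolding fc_def by (subst Bochner_Integration.integral_sum) (simp_all add: fc_integrable[OF u])
  finally show ?thesis .
qed

lemma fc_comb: "finite F \<Longrightarrow> fc (\<lambda>z. \<Sum>i\<in>F. a i * e i z) j = (if j \<in> F then a j else 0)"
proof -
  assume F: "finite F"
  have "fc (\<lambda>z. \<Sum>i\<in>F. a i * e i z) j = (\<Sum>i\<in>F. a i * fc (e j) i)"
    using integral_mult_comb[OF e_sqint[of j], of a F] by (simp add: fc_def mult.commute)
  also have "\<dots> = (if j \<in> F then a j else 0)"
    using F by (simp add: fc_def orthonormal if_distrib cong: if_cong)
  finally show ?thesis .
qed

lemma integral_diff_comb_square:
  assumes u: "u \<in> sqint M" and F: "finite F"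
  shows "(LINT z|M. (u z - (\<Sum>i\<in>F. a i * e i z))\<^sup>2) =
    (LINT z|M. (u z)\<^sup>2) - 2 * (\<Sum>i\<in>F. a i * fc u i) + (\<Sum>i\<in>F. (a i)\<^sup>2)"
proof -
  let ?s = "\<lambda>z. \<Sum>i\<in>F. a i * e i z"
  have "(LINT z|M. (u z - ?s z)\<^sup>2) = (LINT z|M. (u z)\<^sup>2 - 2 * (u z * ?s z) + ?s z * ?s z)"
  proof -
    have "(x - y)\<^sup>2 = x\<^sup>2 - 2 * (x * y) + y * y" for x y :: real
      by (simp add: power2_eq_square algebra_simps)
    then show ?thesis by (simp only:)
  qed
  also have "\<dots> = (LINT z|M. (u z)\<^sup>2) - 2 * (LINT z|M. u z * ?s z) + (LINT z|M. ?s z * ?s z)"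
    by (simp add: sqint_mult[OF u comb_sqint] sqint_mult[OF comb_sqint comb_sqint] sqint_integrable[OF u])
  also have "(LINT z|M. ?s z * ?s z) = (\<Sum>i\<in>F. (a i)\<^sup>2)"
    using F by (simp add: integral_mult_comb[OF comb_sqint] fc_comb power2_eq_square)
  finally show ?thesis by (simp add: integral_mult_comb[OF u])
qed

lemma integral_diff_projection:
  assumes "u \<in> sqint M" "finite F"
  shows "(LINT z|M. (u z - (\<Sum>i\<in>F. fc u i * e i z))\<^sup>2) = (LINT z|M. (u z)\<^sup>2) - (\<Sum>i\<in>F. (fc u i)\<^sup>2)"
  using integral_diff_comb_square[OF assms, of "fc u"] by (simp add: power2_eq_square)

lemma bessel: "u \<in> sqint M \<Longrightarrow> finite F \<Longrightarrow> (\<Sum>i\<in>F. (fc u i)\<^sup>2) \<le> (LINT z|M. (u z)\<^sup>2)"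
proof -
  assume "u \<in> sqint M" "finite F"
  from integral_diff_projection[OF this, symmetric]
  have "0 \<le> (LINT z|M. (u z)\<^sup>2) - (\<Sum>i\<in>F. (fc u i)\<^sup>2)" by simp
  then show ?thesis by simp
qed

definition co :: "('a \<Rightarrow> real) \<Rightarrow> 'i ell2" where "co u = Abs_ell2 (fc u)"

lemma coord_co: "u \<in> sqint M \<Longrightarrow> coord (co u) i = fc u i"
  unfolding co_def by (subst Abs_ell2_inverse) (auto intro: square_summable_bounded bessel)

text \<open>A sequential exhaustion of the countable index type, so that unordered sums can be fed
  into the completeness statement for sequences.\<close>

definition first :: "nat \<Rightarrow> 'i set" where "first n = {i. to_nat i < n}"

lemma finite_first: "finite (first n)"
  unfolding first_def using finite_vimageI[of "{..<n}" "to_nat :: 'i \<Rightarrow> nat"] by (simp add: vimage_def)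

lemma sum_first_tendsto: "(\<lambda>n. \<Sum>i\<in>first n. (coord a i)\<^sup>2) \<longlonglongrightarrow> (norm a)\<^sup>2"
proof -
  have "((\<lambda>i. (coord a i)\<^sup>2) has_sum (norm a)\<^sup>2) UNIV"
    unfolding norm_ell2_square by (rule has_sum_infsum[OF coord_square_summable])
  then have "(sum (\<lambda>i. (coord a i)\<^sup>2) \<longlongrightarrow> (norm a)\<^sup>2) (finite_subsets_at_top UNIV)"
    by (simp add: has_sum_def)
  moreover have "filterlim first (finite_subsets_at_top UNIV) sequentially"
    unfolding filterlim_finite_subsets_at_top
  proof (intro allI impI)
    fix X :: "'i set" assume "finite X \<and> X \<subseteq> UNIV"
    then have "finite (to_nat ` X)" by simp
    then obtain k where k: "to_nat ` X \<subseteq> {..<k}" using finite_nat_iff_bounded by blast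
    show "\<forall>\<^sub>F n in sequentially. finite (first n) \<and> X \<subseteq> first n \<and> first n \<subseteq> UNIV"
      using eventually_ge_at_top[of k]
    proof eventually_elim
      case (elim n)
      then show ?case using k finite_first by (auto simp: first_def)
    qed
  qed
  ultimately show ?thesis by (rule filterlim_compose)
qed

text \<open>The squared distance of two partial sums is the difference of the partial sums of
  squares, so they are Cauchy; the norm identity comes from the same computation in the
  limit.\<close>

lemma riesz_fischer:
  "\<exists>u\<in>sqint M. (\<forall>i. fc u i = coord a i) \<and> (LINT z|M. (u z)\<^sup>2) = (norm a)\<^sup>2"
proof -
  define S where "S n z = (\<Sum>i\<in>first n. coord a i * e i z)" for n z
  define A where "A n = (\<Sum>i\<in>first n. (coord a i)\<^sup>2)" for n
  have S: "S n \<in> sqint M" for n unfolding S_def[abs_def] by (rule comb_sqint)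
  have A: "A \<longlonglongrightarrow> (norm a)\<^sup>2" unfolding A_def[abs_def] by (rule sum_first_tendsto)
  have diff: "(LINT z|M. (S m z - S n z)\<^sup>2) = A m - A n" if "n \<le> m" for m n
  proof -
    \<comment> \<open>On the first \<open>n\<close> indices the coefficients agree, so
      \<open>S n\<close> is the projection of \<open>S m\<close>.\<close>
    have "fc (S m) i = coord a i" if "i \<in> first n" for i
      using that \<open>n \<le> m\<close> unfolding S_def fc_comb[OF finite_first] by (auto simp: first_def)
    then have "(LINT z|M. (S m z - S n z)\<^sup>2) = (LINT z|M. (S m z - (\<Sum>i\<in>first n. fc (S m) i * e i z))\<^sup>2)"
      unfolding S_def[of n] by (simp cong: sum.cong)
    also have "\<dots> = (LINT z|M. (S m z)\<^sup>2) - (\<Sum>i\<in>first n. (fc (S m) i)\<^sup>2)"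
      by (rule integral_diff_projection[OF S finite_first])
    also have "(\<Sum>i\<in>first n. (fc (S m) i)\<^sup>2) = A n"
      unfolding A_def using \<open>\<And>i. i \<in> first n \<Longrightarrow> fc (S m) i = coord a i\<close> by simp
    also have "(LINT z|M. (S m z)\<^sup>2) = A m"
      using integral_diff_comb_square[of "\<lambda>_. 0" "first m" "coord a"] finite_first
      by (simp add: S_def A_def fc_def sqint_def)
    finally show ?thesis .
  qed
  have abs_diff: "(LINT z|M. (S m z - S n z)\<^sup>2) \<le> \<bar>A m - A n\<bar>" for m n
    using diff[of m n] diff[of n m] by (cases "m \<le> n") (auto simp: power2_commute[of "S m _"])
  obtain u where u: "u \<in> sqint M" "(\<lambda>n. LINT z|M. (u z - S n z)\<^sup>2) \<longlonglongrightarrow> 0"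
  proof -
    have "Cauchy A" using A by (rule LIMSEQ_imp_Cauchy)
    then have "\<exists>N. \<forall>m\<ge>N. \<forall>n\<ge>N. (LINT z|M. (S m z - S n z)\<^sup>2) \<le> \<epsilon>" if "\<epsilon> > 0" for \<epsilon>
      using that abs_diff unfolding Cauchy_def dist_real_def by (meson less_imp_le order_trans)
    from sqint_complete[OF S this] that show thesis by blast
  qed
  have fcu: "fc u i = coord a i" for i
  proof -
    have "(\<lambda>n. (fc u i - fc (S n) i)\<^sup>2) \<longlonglongrightarrow> 0"
    proof (rule tendsto_sandwich[OF _ _ tendsto_const u(2)])
      show "\<forall>\<^sub>F n in sequentially. (fc u i - fc (S n) i)\<^sup>2 \<le> (LINT z|M. (u z - S n z)\<^sup>2)"
        using bessel[OF sqint_diff[OF u(1) S], of "{i}"] by (simp add: fc_diff u S)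
    qed simp
    moreover have "(\<lambda>n. (fc u i - fc (S n) i)\<^sup>2) \<longlonglongrightarrow> (fc u i - coord a i)\<^sup>2"
    proof (rule tendsto_eventually, use eventually_gt_at_top[of "to_nat i"] in eventually_elim)
      case (elim n)
      then show ?case unfolding S_def fc_comb[OF finite_first] by (auto simp: first_def)
    qed
    ultimately have "(fc u i - coord a i)\<^sup>2 = 0" using LIMSEQ_unique by blast
    then show ?thesis by simp
  qed
  have "(LINT z|M. (u z - S n z)\<^sup>2) = (LINT z|M. (u z)\<^sup>2) - A n" for n
    using integral_diff_projection[OF u(1) finite_first, of n] by (simp add: S_def A_def fcu)
  then have "(\<lambda>n. (LINT z|M. (u z)\<^sup>2) - A n) \<longlonglongrightarrow> 0" using u(2) by simp
  moreover have "(\<lambda>n. (LINT z|M. (u z)\<^sup>2) - A n) \<longlonglongrightarrow> (LINT z|M. (u z)\<^sup>2) - (norm a)\<^sup>2"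
    by (intro tendsto_intros A)
  ultimately have "(LINT z|M. (u z)\<^sup>2) - (norm a)\<^sup>2 = 0" using LIMSEQ_unique by blast
  then show ?thesis using u(1) fcu by auto
qed

lemma fc_inj:
  assumes "u \<in> sqint M" "v \<in> sqint M" "\<And>i. fc u i = fc v i"
  shows "AE z in M. u z = v z"
  using total[OF sqint_diff[OF assms(1,2)]] fc_diff[OF assms(1,2)] assms(3)
  by (simp add: fc_def)

text \<open>The Riesz-Fischer function built from the coefficients of \<open>u\<close> satisfies the
  identity, and totality says that it equals \<open>u\<close> almost everywhere.\<close>

lemma parseval: "u \<in> sqint M \<Longrightarrow> (LINT z|M. (u z)\<^sup>2) = (norm (co u))\<^sup>2"
proof -
  assume u: "u \<in> sqint M"
  obtain v where v: "v \<in> sqint M" "\<And>i. fc v i = coord (co u) i" "(LINT z|M. (v z)\<^sup>2) = (norm (co u))\<^sup>2"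
    using riesz_fischer by blast
  have "AE z in M. u z = v z" by (rule fc_inj[OF u v(1)]) (simp add: v coord_co u)
  then have "(LINT z|M. (u z)\<^sup>2) = (LINT z|M. (v z)\<^sup>2)"
    using u v(1) by (intro integral_cong_AE) (auto simp: sqint_def)
  then show ?thesis using v(3) by simp
qed

lemma co_add: "u \<in> sqint M \<Longrightarrow> v \<in> sqint M \<Longrightarrow> co (\<lambda>z. u z + v z) = co u + co v"
  by (rule ell2_eqI) (simp add: coord_co sqint_add fc_add)

lemma co_diff: "u \<in> sqint M \<Longrightarrow> v \<in> sqint M \<Longrightarrow> co (\<lambda>z. u z - v z) = co u - co v"
  by (rule ell2_eqI) (simp add: coord_co sqint_diff fc_diff)

lemma co_cmult: "u \<in> sqint M \<Longrightarrow> co (\<lambda>z. c * u z) = c *\<^sub>R co u"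
  by (rule ell2_eqI) (simp add: coord_co sqint_cmult fc_cmult)

lemma co_cong:
  assumes "u \<in> borel_measurable M" "v \<in> borel_measurable M" "AE z in M. u z = v z"
  shows "co u = co v"
proof -
  have "fc u i = fc v i" for i
    unfolding fc_def using assms sqint_measurable[OF e_sqint[of i]]
    by (intro integral_cong_AE) auto
  then have "fc u = fc v" by blast
  then show ?thesis by (simp add: co_def)
qed

lemma inner_co: "u \<in> sqint M \<Longrightarrow> v \<in> sqint M \<Longrightarrow> inner (co u) (co v) = (LINT z|M. u z * v z)"
proof -
  assume u: "u \<in> sqint M" and v: "v \<in> sqint M"
  have "(norm (co u + co v))\<^sup>2 = (LINT z|M. (u z + v z)\<^sup>2)"
    using parseval[OF sqint_add[OF u v]] by (simp add: co_add u v)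
  also have "\<dots> = (LINT z|M. (u z)\<^sup>2 + (v z)\<^sup>2 + 2 * (u z * v z))"
    by (simp add: power2_sum mult.assoc)
  also have "\<dots> = (norm (co u))\<^sup>2 + (norm (co v))\<^sup>2 + 2 * (LINT z|M. u z * v z)"
    using sqint_mult[OF u v] sqint_integrable[OF u] sqint_integrable[OF v] by (simp add: parseval u v)
  finally show ?thesis
    by (simp add: power2_norm_eq_inner inner_add inner_commute)
qed

text \<open>A chosen representative of the class with coefficients \<open>a\<close>; inverse to
  \<open>co\<close> up to null sets. Pointwise nonlinearities act on it.\<close>

definition J :: "'i ell2 \<Rightarrow> 'a \<Rightarrow> real" where
  "J a = (SOME u. u \<in> sqint M \<and> (\<forall>i. fc u i = coord a i))"

lemma J_sqint: "J a \<in> sqint M" and fc_J: "fc (J a) i = coord a i"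
proof -
  have "\<exists>u. u \<in> sqint M \<and> (\<forall>i. fc u i = coord a i)" using riesz_fischer by blast
  from someI_ex[OF this] show "J a \<in> sqint M" "fc (J a) i = coord a i" unfolding J_def by auto
qed

lemma co_J: "co (J a) = a"
  by (rule ell2_eqI) (simp add: coord_co J_sqint fc_J)

lemma J_co: "u \<in> sqint M \<Longrightarrow> AE z in M. J (co u) z = u z"
  by (rule fc_inj) (simp_all add: J_sqint fc_J coord_co)

lemma norm_co_le:
  assumes "u \<in> sqint M" "v \<in> sqint M" "0 \<le> C" "\<And>z. z \<in> space M \<Longrightarrow> \<bar>u z\<bar> \<le> C * \<bar>v z\<bar>"
  shows "norm (co u) \<le> C * norm (co v)"
proof -
  have "(u z)\<^sup>2 \<le> C\<^sup>2 * (v z)\<^sup>2" if "z \<in> space M" for z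
    using power_mono[OF assms(4)[OF that], of 2] by (simp add: power_mult_distrib)
  then have "(LINT z|M. (u z)\<^sup>2) \<le> (LINT z|M. C\<^sup>2 * (v z)\<^sup>2)"
    using assms by (intro integral_mono) (auto intro: sqint_integrable)
  then have "(norm (co u))\<^sup>2 \<le> (C * norm (co v))\<^sup>2"
    using assms by (simp add: parseval power_mult_distrib)
  then show ?thesis by (rule power2_le_imp_le) (use assms(3) in simp)
qed

end

subsection \<open>Superposition operators\<close>

text \<open>Conjugation with \<open>co\<close> and \<open>J\<close> turns superposition into the map
  \<open>N\<close> and multiplication by \<open>g\<close> into the symmetric map \<open>G\<close> on
  \<open>ell2\<close>. The substance is the Landesman-Lazer condition, obtained by integrating the
  pointwise sign condition along a sequence that blows up in a converging direction.\<close>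

lemma (in L2_basis) semilinear_solvable:
  fixes mu :: "'i \<Rightarrow> real" and F :: "'a \<Rightarrow> real \<Rightarrow> real" and g :: "'a \<Rightarrow> real"
  assumes fin: "finite_measure M"
    and small: "finite {i. \<bar>mu i\<bar> < \<beta>}" and l: "0 \<le> l" "l < \<beta>"
    and F_meas: "\<And>u. u \<in> borel_measurable M \<Longrightarrow> (\<lambda>z. F z (u z)) \<in> borel_measurable M"
    and F_lip: "\<And>z u v. z \<in> space M \<Longrightarrow> \<bar>F z u - F z v\<bar> \<le> l * \<bar>u - v\<bar>"
    and g: "g \<in> borel_measurable M" "\<And>z. z \<in> space M \<Longrightarrow> \<bar>g z\<bar> \<le> l"
    and F_g: "\<And>z u. z \<in> space M \<Longrightarrow> \<bar>F z u - g z * u\<bar> \<le> M1"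
    and c: "c > 0" and \<sigma>: "\<bar>\<sigma>\<bar> = 1" and M2: "M2 \<ge> 0"
    and F_sign: "\<And>z u. z \<in> space M \<Longrightarrow> \<bar>u\<bar> > M2 \<Longrightarrow> \<sigma> * ((F z u - g z * u) * u) \<ge> c * \<bar>u\<bar>"
  shows "\<exists>u\<in>sqint M. (\<lambda>z. F z (u z)) \<in> sqint M \<and>
    (\<forall>i. mu i * (LINT z|M. u z * e i z) = (LINT z|M. F z (u z) * e i z))"
proof -
  interpret finite_measure M by (rule fin)
  define m where "m = measure M (space M)"
  have const: "(\<lambda>_. k) \<in> sqint M" for k by (simp add: sqint_def)
  have gu: "(\<lambda>z. g z * u z) \<in> sqint M" if "u \<in> sqint M" for u
    by (rule sqint_bound[OF sqint_cmult[OF that, of l]])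
      (use g sqint_measurable[OF that] l in \<open>auto simp: abs_mult intro!: mult_right_mono\<close>)
  define h where "h u z = F z (u z) - g z * u z" for u z
  have h: "h u \<in> sqint M" if "u \<in> sqint M" for u
  proof (rule sqint_bound[OF const[of M1]])
    show "h u \<in> borel_measurable M"
      unfolding h_def[abs_def] using F_meas[OF sqint_measurable[OF that]] g(1) sqint_measurable[OF that]
      by measurable
    show "\<bar>h u z\<bar> \<le> \<bar>M1\<bar>" if "z \<in> space M" for z
      using F_g[OF that, of "u z"] by (simp add: h_def)
  qed
  have Fu: "(\<lambda>z. F z (u z)) \<in> sqint M" if "u \<in> sqint M" for u
    using sqint_add[OF h[OF that] gu[OF that]] by (simp add: h_def)
  define N where "N a = co (\<lambda>z. F z (J a z))" for a
  define G where "G a = co (\<lambda>z. g z * J a z)" for a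
  have N_G: "N a - G a = co (h (J a))" for a
    by (simp add: N_def G_def h_def[abs_def] co_diff[symmetric] Fu gu J_sqint)
  have G_co: "G (co u) = co (\<lambda>z. g z * u z)" if "u \<in> sqint M" for u
    unfolding G_def
  proof (rule co_cong)
    show "AE z in M. g z * J (co u) z = g z * u z"
      using J_co[OF that] by eventually_elim simp
  qed (rule sqint_measurable, rule gu, rule J_sqint that)+
  interpret R: resonant_problem mu \<beta> l "M1 * sqrt m" \<sigma> N G
  proof (rule resonant_problem.intro)
    show "norm (N x - N y) \<le> l * norm (x - y)" for x y
    proof -
      have "norm (co (\<lambda>z. F z (J x z) - F z (J y z))) \<le> l * norm (co (\<lambda>z. J x z - J y z))"
        by (rule norm_co_le[OF sqint_diff[OF Fu[OF J_sqint] Fu[OF J_sqint]] sqint_diff[OF J_sqint J_sqint] l(1) F_lip])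
      then show ?thesis by (simp add: co_diff Fu J_sqint N_def co_J)
    qed
    show "linear G"
    proof (rule linearI)
      fix x y :: "'i ell2"
      have "G (co (\<lambda>z. J x z + J y z)) = co (\<lambda>z. g z * J x z + g z * J y z)"
        by (simp add: G_co sqint_add J_sqint distrib_left)
      then show "G (x + y) = G x + G y"
        by (simp add: co_add J_sqint gu co_J G_def[of x] G_def[of y])
    next
      fix x :: "'i ell2" and r :: real
      have "G (co (\<lambda>z. r * J x z)) = co (\<lambda>z. r * (g z * J x z))"
        by (simp add: G_co sqint_cmult J_sqint mult_ac)
      then show "G (r *\<^sub>R x) = r *\<^sub>R G x"
        by (simp add: co_cmult J_sqint gu co_J G_def[of x])
    qed
    show "norm (G x) \<le> l * norm x" for x
    proof -
      have "norm (co (\<lambda>z. g z * J x z)) \<le> l * norm (co (J x))"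
        by (rule norm_co_le) (auto intro!: gu J_sqint l mult_right_mono g simp: abs_mult)
      then show ?thesis by (simp add: G_def co_J)
    qed
    show "inner (G x) y = inner x (G y)" for x y
      using inner_co[OF gu[OF J_sqint[of x]] J_sqint[of y]] inner_co[OF J_sqint[of x] gu[OF J_sqint[of y]]]
      by (simp add: G_def co_J mult_ac)
    show "norm (N x - G x) \<le> M1 * sqrt m" for x
    \<comment> \<open>On an empty space the bound by \<open>M1\<close> is vacuous and
      \<open>M1\<close> could be negative; the claim then holds because
      \<open>m = 0\<close>.\<close>
    proof (cases "space M = {}")
      case True
      then have "(norm (co (h (J x))))\<^sup>2 = 0"
        by (subst parseval[OF h[OF J_sqint], symmetric])
          (rule Bochner_Integration.integral_eq_zero_AE, rule AE_I2, use True in simp)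
      then show ?thesis using True by (simp add: N_G m_def)
    next
      case False
      then have M1: "0 \<le> M1" using F_g by (metis abs_ge_zero all_not_in_conv order_trans)
      have "(norm (co (h (J x))))\<^sup>2 \<le> (LINT z|M. M1\<^sup>2)"
        unfolding parseval[OF h[OF J_sqint], symmetric]
        by (rule integral_mono[OF sqint_integrable[OF h[OF J_sqint]]])
          (use F_g M1 in \<open>auto simp: h_def abs_le_square_iff[symmetric]\<close>)
      then have "(norm (co (h (J x))))\<^sup>2 \<le> (M1 * sqrt m)\<^sup>2"
        by (simp add: power_mult_distrib m_def mult.commute)
      then have "norm (co (h (J x))) \<le> M1 * sqrt m"
        by (rule power2_le_imp_le) (simp add: M1 m_def)
      then show ?thesis by (simp add: N_G)
    qed
    fix X :: "nat \<Rightarrow> 'i ell2" and w :: "'i ell2"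
    assume large: "filterlim (\<lambda>n. norm (X n)) at_top sequentially"
      and lim: "(\<lambda>n. sgn (X n)) \<longlonglongrightarrow> w" and norm_w: "norm w = 1"
    define om where "om = J w"
    \<comment> \<open>Price for points with \<open>\<bar>u\<bar> \<le> M2\<close>, where the sign is
      not controlled: there \<open>c * \<bar>u\<bar> \<le> c * M2\<close>, and the product with
      \<open>h\<close> is at least \<open>- \<bar>M1\<bar> * M2\<close>.\<close>
    define C0 where "C0 = (c + \<bar>M1\<bar>) * M2"
    define I1 where "I1 = (LINT z|M. \<bar>om z\<bar>)"
    define d where "d n z = om z - J (X n) z / norm (X n)" for n z
    have om: "om \<in> sqint M" by (simp add: om_def J_sqint)
    have abs_sq: "(\<lambda>z. \<bar>u z\<bar>) \<in> sqint M" if "u \<in> sqint M" for u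
      by (rule sqint_bound[OF that]) (use sqint_measurable[OF that] in auto)
    have int1: "integrable M u" if "u \<in> sqint M" for u
      using sqint_mult[OF that const[of 1]] by simp
    have d: "d n \<in> sqint M" for n
      unfolding d_def[abs_def] using sqint_diff[OF om sqint_cmult[OF J_sqint[of "X n"], of "1 / norm (X n)"]] by simp
    have co_d: "co (d n) = w - sgn (X n)" for n
    proof -
      have "co (d n) = co om - co (\<lambda>z. (1 / norm (X n)) * J (X n) z)"
        using co_diff[OF om sqint_cmult[OF J_sqint[of "X n"], of "1 / norm (X n)"]] by (simp add: d_def[abs_def])
      then show ?thesis
        by (simp only: co_cmult[OF J_sqint] co_J om_def) (simp add: sgn_div_norm divide_inverse)
    qed
    \<comment> \<open>Cauchy-Schwarz against the constant 1 on a finite measure space: convergence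
      of directions in mean square gives convergence in mean.\<close>
    have L1: "(LINT z|M. \<bar>d n z\<bar>) \<le> norm (w - sgn (X n)) * norm (co (\<lambda>_. 1))" for n
    proof -
      have "(LINT z|M. \<bar>d n z\<bar>) = inner (co (\<lambda>z. \<bar>d n z\<bar>)) (co (\<lambda>_. 1))"
        by (simp add: inner_co abs_sq d const)
      also have "\<dots> \<le> norm (co (\<lambda>z. \<bar>d n z\<bar>)) * norm (co (\<lambda>_. 1))" by (rule norm_cauchy_schwarz)
      also have "norm (co (\<lambda>z. \<bar>d n z\<bar>)) \<le> 1 * norm (co (d n))"
        by (rule norm_co_le) (auto intro: abs_sq d)
      finally show ?thesis by (simp add: co_d mult_right_mono)
    qed
    have "I1 \<noteq> 0"
    proof
      assume "I1 = 0"
      then have "AE z in M. \<bar>om z\<bar> = 0"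
        unfolding I1_def by (subst (asm) integral_nonneg_eq_0_iff_AE) (auto intro: int1 abs_sq om)
      then have "co om = co (\<lambda>_. 0)"
        using sqint_measurable[OF om] by (intro co_cong) auto
      moreover have "co (\<lambda>_. 0) = 0" by (rule ell2_eqI) (simp add: coord_co const fc_def)
      ultimately show False using norm_w by (simp add: om_def co_J)
    qed
    then have I1: "I1 > 0" unfolding I1_def by (simp add: order_less_le)
    have est: "\<sigma> * inner (N (X n) - G (X n)) w \<ge>
        c * I1 - (c + \<bar>M1\<bar>) * (norm (w - sgn (X n)) * norm (co (\<lambda>_. 1))) - C0 * m / norm (X n)"
      if r: "norm (X n) > 0" for n
    proof -
      let ?u = "J (X n)" and ?r = "norm (X n)"
      \<comment> \<open>The sign condition is divided by the norm of \<open>X n\<close>, and the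
        normalised function is then replaced by its limit \<open>om\<close> at the cost
        \<open>(c + \<bar>M1\<bar>) * \<bar>d n z\<bar>\<close>. Integrating leaves
        \<open>c * I1 > 0\<close> plus terms that tend to 0.\<close>
      have pw: "c * \<bar>om z\<bar> - (c + \<bar>M1\<bar>) * \<bar>d n z\<bar> - C0 / ?r \<le> \<sigma> * (h ?u z * om z)" if z: "z \<in> space M" for z
      proof -
        have hb: "\<bar>h ?u z\<bar> \<le> \<bar>M1\<bar>" using F_g[OF z, of "?u z"] by (simp add: h_def)
        have "c * \<bar>?u z\<bar> - C0 \<le> \<sigma> * (h ?u z * ?u z)"
        proof (cases "\<bar>?u z\<bar> > M2")
          case True
          moreover have "0 \<le> C0" using c M2 by (simp add: C0_def)
          ultimately show ?thesis using F_sign[OF z True] by (simp add: h_def)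
        next
          case False
          have "\<bar>\<sigma> * (h ?u z * ?u z)\<bar> \<le> \<bar>M1\<bar> * M2"
            using hb False \<sigma> by (simp add: abs_mult mult_mono)
          moreover have "c * \<bar>?u z\<bar> \<le> c * M2" using False c by (intro mult_left_mono) auto
          ultimately show ?thesis by (simp add: C0_def algebra_simps abs_le_iff)
        qed
        then have "(c * \<bar>?u z\<bar> - C0) / ?r \<le> \<sigma> * (h ?u z * ?u z) / ?r"
          using r by (intro divide_right_mono) auto
        then have 1: "c * \<bar>?u z / ?r\<bar> - C0 / ?r \<le> \<sigma> * (h ?u z * (?u z / ?r))"
          using r by (simp add: diff_divide_distrib)
        have "\<bar>\<sigma> * (h ?u z * d n z)\<bar> \<le> \<bar>M1\<bar> * \<bar>d n z\<bar>"
          using hb \<sigma> by (simp add: abs_mult mult_right_mono)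
        moreover have "\<sigma> * (h ?u z * om z) = \<sigma> * (h ?u z * (?u z / ?r)) + \<sigma> * (h ?u z * d n z)"
          by (simp add: d_def algebra_simps)
        moreover have "c * \<bar>om z\<bar> \<le> c * \<bar>?u z / ?r\<bar> + c * \<bar>d n z\<bar>"
        proof -
          have "\<bar>om z\<bar> \<le> \<bar>?u z / ?r\<bar> + \<bar>d n z\<bar>" unfolding d_def by linarith
          then have "c * \<bar>om z\<bar> \<le> c * (\<bar>?u z / ?r\<bar> + \<bar>d n z\<bar>)" using c by (intro mult_left_mono) auto
          then show ?thesis by (simp only: distrib_left)
        qed
        ultimately show ?thesis using 1 by (simp only: distrib_right) linarith
      qed
      have ihom: "integrable M (\<lambda>z. h ?u z * om z)" by (rule sqint_mult[OF h[OF J_sqint] om])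
      have iom: "integrable M (\<lambda>z. \<bar>om z\<bar>)" and id: "integrable M (\<lambda>z. \<bar>d n z\<bar>)"
        by (intro int1 abs_sq om d)+
      have "c * I1 - (c + \<bar>M1\<bar>) * (LINT z|M. \<bar>d n z\<bar>) - C0 / ?r * m =
          (LINT z|M. c * \<bar>om z\<bar> - (c + \<bar>M1\<bar>) * \<bar>d n z\<bar> - C0 / ?r)"
        using iom id by (simp add: I1_def m_def)
      also have "\<dots> \<le> (LINT z|M. \<sigma> * (h ?u z * om z))"
        by (rule integral_mono) (use iom id ihom pw in auto)
      also have "\<dots> = \<sigma> * inner (N (X n) - G (X n)) w"
        using inner_co[OF h[OF J_sqint[of "X n"]] om] by (simp add: N_G om_def co_J)
      finally have "c * I1 - (c + \<bar>M1\<bar>) * (LINT z|M. \<bar>d n z\<bar>) - C0 / ?r * m \<le> \<sigma> * inner (N (X n) - G (X n)) w" .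
      moreover have "(c + \<bar>M1\<bar>) * (LINT z|M. \<bar>d n z\<bar>) \<le> (c + \<bar>M1\<bar>) * (norm (w - sgn (X n)) * norm (co (\<lambda>_. 1)))"
        using c by (intro mult_left_mono L1) auto
      ultimately show ?thesis by simp
    qed
    have "(\<lambda>n. norm (w - sgn (X n))) \<longlonglongrightarrow> norm (w - w)" by (intro tendsto_intros lim)
    moreover have "(\<lambda>n. C0 * m / norm (X n)) \<longlonglongrightarrow> 0"
      by (rule tendsto_divide_0[OF tendsto_const filterlim_at_top_imp_at_infinity[OF large]])
    ultimately have "(\<lambda>n. c * I1 - (c + \<bar>M1\<bar>) * (norm (w - sgn (X n)) * norm (co (\<lambda>_. 1))) - C0 * m / norm (X n))
        \<longlonglongrightarrow> c * I1 - (c + \<bar>M1\<bar>) * (norm (w - w) * norm (co (\<lambda>_. 1))) - 0"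
      by (intro tendsto_intros lim)
    then have "\<forall>\<^sub>F n in sequentially. 0 < c * I1 - (c + \<bar>M1\<bar>) * (norm (w - sgn (X n)) * norm (co (\<lambda>_. 1))) - C0 * m / norm (X n)"
      by (rule order_tendstoD) (use c I1 in simp)
    moreover have "\<forall>\<^sub>F n in sequentially. norm (X n) > 0"
      using large[unfolded filterlim_at_top_dense, rule_format, of 0] .
    ultimately show "\<forall>\<^sub>F n in sequentially. 0 < \<sigma> * inner (N (X n) - G (X n)) w"
      by eventually_elim (use est in \<open>force intro: less_le_trans\<close>)
  qed (use small l \<sigma> in auto)
  obtain x where x: "\<And>i. mu i * coord x i = coord (N x) i" using R.solvable by blast
  show ?thesis
  proof (intro bexI[of _ "J x"] conjI allI)
    show "mu i * (LINT z|M. J x z * e i z) = (LINT z|M. F z (J x z) * e i z)" for i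
      using x[of i] fc_J[of x i] coord_co[OF Fu[OF J_sqint[of x]], of i] by (simp add: N_def fc_def)
  qed (simp_all add: J_sqint Fu)
qed

subsection \<open>Trigonometric modes on the cylinder\<close>

text \<open>Hartley's kernel. Since \<open>cas a * cas b = cos (a - b) + sin (a + b)\<close>, the
  functions \<open>cas (k w t)\<close> with \<open>k\<close> any integer are orthogonal over a
  period; the pair \<open>k\<close>, \<open>- k\<close> accounts for the cosine and the sine of one
  frequency.\<close>

definition cas :: "real \<Rightarrow> real" where "cas \<theta> = cos \<theta> + sin \<theta>"

lemma continuous_on_cas [continuous_intros]:
  fixes f :: "'a :: t2_space \<Rightarrow> real"
  shows "continuous_on S f \<Longrightarrow> continuous_on S (\<lambda>x. cas (f x))"
  unfolding cas_def by (auto intro!: continuous_intros)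

lemma abs_cas_le: "\<bar>cas \<theta>\<bar> \<le> 2"
  unfolding cas_def using abs_sin_le_one[of \<theta>] abs_cos_le_one[of \<theta>] by linarith

lemma cas_mult_cas: "cas a * cas b = cos (a - b) + sin (a + b)"
  by (simp add: cas_def cos_diff sin_add algebra_simps)

lemma cos_mult_cas: "cos a * cas b = (cas (b + a) + cas (b - a)) / 2"
  by (simp add: cas_def cos_diff sin_add cos_add sin_diff algebra_simps)

lemma sin_mult_cas: "sin a * cas b = (cas (- (b - a)) - cas (- (b + a))) / 2"
  by (simp add: cas_def cos_diff sin_add cos_add sin_diff algebra_simps)

lemma
  fixes r \<omega> :: real
  assumes r: "r > 0" and \<omega>: "\<omega> \<noteq> 0"
  shows integral_cos_scaled: "integral {0..r} (\<lambda>t. cos (\<omega> * t)) = sin (\<omega> * r) / \<omega>"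
    and integral_sin_scaled: "integral {0..r} (\<lambda>t. sin (\<omega> * t)) = (1 - cos (\<omega> * r)) / \<omega>"
proof -
  have "((\<lambda>t. cos (\<omega> * t)) has_integral (sin (\<omega> * r) / \<omega> - sin (\<omega> * 0) / \<omega>)) {0..r}"
    by (rule fundamental_theorem_of_calculus[where f = "\<lambda>t. sin (\<omega> * t) / \<omega>"])
      (use r \<omega> in \<open>auto intro!: derivative_eq_intros simp: has_real_derivative_iff_has_vector_derivative[symmetric]\<close>)
  then show "integral {0..r} (\<lambda>t. cos (\<omega> * t)) = sin (\<omega> * r) / \<omega>" by (simp add: integral_unique)
  have "((\<lambda>t. sin (\<omega> * t)) has_integral (- cos (\<omega> * r) / \<omega> - (- cos (\<omega> * 0) / \<omega>))) {0..r}"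
    by (rule fundamental_theorem_of_calculus[where f = "\<lambda>t. - cos (\<omega> * t) / \<omega>"])
      (use r \<omega> in \<open>auto intro!: derivative_eq_intros simp: has_real_derivative_iff_has_vector_derivative[symmetric]\<close>)
  then show "integral {0..r} (\<lambda>t. sin (\<omega> * t)) = (1 - cos (\<omega> * r)) / \<omega>"
    by (simp add: integral_unique diff_divide_distrib)
qed

lemma integral_cos_int: "integral {0..pi} (\<lambda>x. cos (of_int m * x)) = (if m = 0 then pi else 0)"
  using integral_cos_scaled[of pi "of_int m"] sin_npi_int[of m] by (simp add: mult.commute)

lemma integral_sin_mult_sin:
  fixes a b :: nat
  assumes "a > 0" "b > 0"
  shows "integral {0..pi} (\<lambda>x. sin (real a * x) * sin (real b * x)) = (if a = b then pi / 2 else 0)"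
proof -
  have "sin (real a * x) * sin (real b * x) =
      (cos (of_int (int a - int b) * x) - cos (of_int (int a + int b) * x)) / 2" for x
    by (simp add: sin_times_sin left_diff_distrib distrib_right)
  then have "integral {0..pi} (\<lambda>x. sin (real a * x) * sin (real b * x)) =
      integral {0..pi} (\<lambda>x. (cos (of_int (int a - int b) * x) - cos (of_int (int a + int b) * x)) / 2)"
    by (simp only:)
  also have "\<dots> = (integral {0..pi} (\<lambda>x. cos (of_int (int a - int b) * x)) -
      integral {0..pi} (\<lambda>x. cos (of_int (int a + int b) * x))) / 2"
    by (subst Henstock_Kurzweil_Integration.integral_diff[symmetric])
      (auto intro!: integrable_continuous_real continuous_intros)
  finally show ?thesis using assms by (simp only: integral_cos_int) auto
qed

text \<open>Positivity of the period makes \<open>p\<close> and \<open>q\<close> nonzero and of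
  equal sign, hence the frequency \<open>w\<close> positive.\<close>

locale cylinder =
  fixes p q :: int
  assumes period_pos: "period p q > 0"
begin

abbreviation "T \<equiv> period p q"
abbreviation "w \<equiv> real_of_int p / real_of_int q"
abbreviation "M \<equiv> Omega p q"

definition dom :: "(real \<times> real) set" where "dom = {0..pi} \<times> {0..<T}"

lemma pq_nonzero: "p \<noteq> 0" "q \<noteq> 0"
  using period_pos by (auto simp: period_def)

lemma wT: "w * T = 2 * pi"
  using pq_nonzero by (simp add: period_def)

lemma w_pos: "w > 0"
  using wT period_pos pi_gt_zero by (metis mult_pos_pos zero_less_mult_pos2 zero_less_numeral)

lemma M_eq: "M = lebesgue_on dom" by (simp add: Omega_measure_def dom_def)

lemma dom_sets [measurable]: "dom \<in> sets lebesgue"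
proof -
  have "dom \<in> sets borel" unfolding dom_def by (intro borel_Times) auto
  then show ?thesis by simp
qed

lemma space_M: "space M = dom" by (simp add: M_eq)

lemma dom_lmeasurable: "dom \<in> lmeasurable"
proof (rule bounded_set_imp_lmeasurable)
  have "dom \<subseteq> cbox (0, 0) (pi, T)" by (auto simp: dom_def cbox_Pair_eq)
  then show "bounded dom" using bounded_cbox bounded_subset by blast
qed (rule dom_sets)

lemma finite_M: "finite_measure M"
  unfolding M_eq by (rule finite_measure_lebesgue_on[OF dom_lmeasurable])

lemma continuous_measurable:
  fixes h :: "real \<times> real \<Rightarrow> 'b :: topological_space"
  assumes "continuous_on UNIV h" shows "h \<in> borel_measurable M"
proof -
  have "h \<in> borel_measurable borel" using assms by (rule borel_measurable_continuous_onI)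
  then have "h \<in> borel_measurable lebesgue" by (simp add: measurable_completion)
  then show ?thesis unfolding M_eq by (rule measurable_restrict_space1)
qed

lemma bounded_integrable:
  fixes h :: "real \<times> real \<Rightarrow> 'b :: {banach, second_countable_topology}"
  assumes "h \<in> borel_measurable M" "\<And>z. z \<in> dom \<Longrightarrow> norm (h z) \<le> B"
  shows "integrable M h"
proof -
  interpret finite_measure M by (rule finite_M)
  show ?thesis
    by (rule integrable_const_bound[of _ B]) (use assms in \<open>auto simp: space_M\<close>)
qed

lemma continuous_integrable:
  fixes h :: "real \<times> real \<Rightarrow> 'b :: {banach, second_countable_topology}"
  assumes "continuous_on UNIV h" shows "integrable M h"
proof -
  have "compact (h ` cbox (0, 0) (pi, T))"
    using assms by (intro compact_continuous_image) (auto intro: continuous_on_subset)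
  then obtain B where B: "\<And>z. z \<in> cbox (0, 0) (pi, T) \<Longrightarrow> norm (h z) \<le> B"
    using compact_imp_bounded bounded_iff by (metis imageI)
  have "dom \<subseteq> cbox (0, 0) (pi, T)" by (auto simp: dom_def cbox_Pair_eq)
  then show ?thesis
    using B by (intro bounded_integrable[OF continuous_measurable[OF assms], of B]) blast
qed

lemma negligible_line: "negligible {z :: real \<times> real. fst z = c}" "negligible {z :: real \<times> real. snd z = c}"
  using negligible_standard_hyperplane[of "(1, 0) :: real \<times> real" c]
    negligible_standard_hyperplane[of "(0, 1) :: real \<times> real" c]
  by (auto simp: Basis_prod_def inner_prod_def)

lemma AE_not_negligible: "negligible S \<Longrightarrow> AE z in M. z \<notin> S"
  unfolding M_eq by (subst AE_restrict_space_iff)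
    (auto simp: negligible_iff_null_sets dest: AE_not_in)

lemma integral_product:
  fixes \<phi> \<psi> :: "real \<Rightarrow> real"
  assumes "continuous_on UNIV \<phi>" "continuous_on UNIV \<psi>"
  shows "(LINT z|M. \<phi> (fst z) * \<psi> (snd z)) = integral {0..pi} \<phi> * integral {0..T} \<psi>"
proof -
  let ?h = "\<lambda>z. \<phi> (fst z) * \<psi> (snd z)"
  have cont: "continuous_on UNIV ?h"
    by (intro continuous_intros continuous_on_compose2[OF assms(1)] continuous_on_compose2[OF assms(2)]) auto
  have "(LINT z|M. ?h z) = integral dom ?h"
    unfolding M_eq by (rule lebesgue_integral_eq_integral) (use continuous_integrable[OF cont] dom_sets in \<open>auto simp: M_eq\<close>)
  \<comment> \<open>The half-open fundamental domain and the closed rectangle differ by part of the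
    line \<open>t = T\<close>.\<close>
  also have "\<dots> = integral (cbox (0, 0) (pi, T)) ?h"
  proof (rule integral_spike_set)
    have "negligible (cbox (0, 0) (pi, T) - dom)"
      by (rule negligible_subset[OF negligible_line(2)[of T]]) (auto simp: dom_def cbox_Pair_eq)
    then show "negligible {x \<in> cbox (0, 0) (pi, T) - dom. ?h x \<noteq> 0}"
      by (rule negligible_subset) auto
    have "{x \<in> dom - cbox (0, 0) (pi, T). ?h x \<noteq> 0} = {}" by (auto simp: dom_def cbox_Pair_eq)
    then show "negligible {x \<in> dom - cbox (0, 0) (pi, T). ?h x \<noteq> 0}" by (simp only: negligible_empty)
  qed
  also have "\<dots> = integral (cbox 0 pi) (\<lambda>x. integral (cbox 0 T) (\<lambda>y. ?h (x, y)))"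
    by (rule integral_prod_continuous) (rule continuous_on_subset[OF cont], simp)
  also have "\<dots> = integral {0..pi} \<phi> * integral {0..T} \<psi>"
    by simp
  finally show ?thesis .
qed

lemma integral_cos_period: "integral {0..T} (\<lambda>t. cos (of_int m * w * t)) = (if m = 0 then T else 0)"
proof (cases "m = 0")
  case False
  have "of_int m * w * T = of_int m * (2 * pi)" by (metis mult.assoc wT)
  then have "sin (of_int m * w * T) = 0"
    using sin_integer_2pi[of "of_int m"] by (simp add: mult_ac)
  then show ?thesis
    using False integral_cos_scaled[OF period_pos, of "of_int m * w"] pq_nonzero by simp
qed (use period_pos in simp)

lemma integral_sin_period: "integral {0..T} (\<lambda>t. sin (of_int m * w * t)) = 0"
proof (cases "m = 0")
  case False
  have "of_int m * w * T = of_int m * (2 * pi)" by (metis mult.assoc wT)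
  then have "cos (of_int m * w * T) = 1"
    using cos_integer_2pi[of "of_int m"] by (simp add: mult_ac)
  then show ?thesis
    using False integral_sin_scaled[OF period_pos, of "of_int m * w"] pq_nonzero by simp
qed simp

lemma integral_cas_mult_cas:
  "integral {0..T} (\<lambda>t. cas (of_int k * w * t) * cas (of_int m * w * t)) = (if k = m then T else 0)"
proof -
  have "cas (of_int k * w * t) * cas (of_int m * w * t) =
      cos (of_int (k - m) * w * t) + sin (of_int (k + m) * w * t)" for t
    unfolding cas_mult_cas by (simp only: of_int_diff of_int_add left_diff_distrib distrib_right)
  then have "integral {0..T} (\<lambda>t. cas (of_int k * w * t) * cas (of_int m * w * t)) =
      integral {0..T} (\<lambda>t. cos (of_int (k - m) * w * t) + sin (of_int (k + m) * w * t))"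
    by (simp only:)
  also have "\<dots> = integral {0..T} (\<lambda>t. cos (of_int (k - m) * w * t)) + integral {0..T} (\<lambda>t. sin (of_int (k + m) * w * t))"
    by (rule Henstock_Kurzweil_Integration.integral_add)
      (auto intro!: integrable_continuous_real continuous_intros simp: pq_nonzero)
  finally show ?thesis by (simp only: integral_cos_period integral_sin_period) simp
qed

definition E :: "nat \<Rightarrow> int \<Rightarrow> real \<times> real \<Rightarrow> real" where
  "E j k z = sin (real j * fst z) * cas (of_int k * w * snd z)"

lemma continuous_E: "continuous_on S (E j k)"
  unfolding E_def[abs_def] by (intro continuous_intros)

lemma abs_E_le: "\<bar>E j k z\<bar> \<le> 2"
  using mult_mono[OF abs_sin_le_one[of "real j * fst z"] abs_cas_le[of "of_int k * w * snd z"]]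
  by (simp add: E_def abs_mult)

lemma E_measurable: "E j k \<in> borel_measurable M"
  by (rule continuous_measurable[OF continuous_E])

lemma E_sqint: "E j k \<in> sqint M"
  using E_measurable continuous_integrable[of "\<lambda>z. (E j k z)\<^sup>2"]
  by (auto simp: sqint_def intro!: continuous_intros continuous_E)

lemma E_orthogonal:
  assumes "j > 0" "j' > 0"
  shows "(LINT z|M. E j k z * E j' k' z) = (if j = j' \<and> k = k' then pi * T / 2 else 0)"
proof -
  have "(LINT z|M. E j k z * E j' k' z) =
    (LINT z|M. (sin (real j * fst z) * sin (real j' * fst z)) * (cas (of_int k * w * snd z) * cas (of_int k' * w * snd z)))"
    by (simp add: E_def mult_ac)
  also have "\<dots> = integral {0..pi} (\<lambda>x. sin (real j * x) * sin (real j' * x)) *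
      integral {0..T} (\<lambda>t. cas (of_int k * w * t) * cas (of_int k' * w * t))"
    by (rule integral_product) (intro continuous_intros)+
  finally show ?thesis using assms by (simp only: integral_sin_mult_sin integral_cas_mult_cas) simp
qed

end

subsection \<open>Completeness of the modes\<close>

lemma Arg2pi_cis: "0 \<le> \<theta> \<Longrightarrow> \<theta> < 2 * pi \<Longrightarrow> Arg2pi (cis \<theta>) = \<theta>"
  by (rule Arg2pi_unique[of 1]) (auto simp: cis_conv_exp)

lemma integrable_mult_bounded:
  fixes v h :: "'a \<Rightarrow> real"
  assumes v: "integrable M v" and h: "h \<in> borel_measurable M" "\<And>z. z \<in> space M \<Longrightarrow> \<bar>h z\<bar> \<le> B"
  shows "integrable M (\<lambda>z. v z * h z)"
proof (rule Bochner_Integration.integrable_bound[of M "\<lambda>z. \<bar>B\<bar> * v z"])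
  show "AE z in M. norm (v z * h z) \<le> norm (\<bar>B\<bar> * v z)"
  proof (rule AE_I2)
    fix z assume "z \<in> space M"
    from h(2)[OF this] have "\<bar>h z\<bar> \<le> \<bar>B\<bar>" by linarith
    then have "\<bar>v z\<bar> * \<bar>h z\<bar> \<le> \<bar>v z\<bar> * \<bar>B\<bar>" by (rule mult_left_mono) simp
    then show "norm (v z * h z) \<le> norm (\<bar>B\<bar> * v z)" by (simp add: abs_mult mult.commute)
  qed
qed (use v h(1) in auto)

text \<open>Uniform approximation of \<open>F\<close> on \<open>K\<close> by polynomials changes the
  integral by at most \<open>\<epsilon>\<close> times the integral of
  \<open>\<bar>v\<bar>\<close>.\<close>

lemma Stone_Weierstrass_vanishing:
  fixes v :: "'a \<Rightarrow> real" and \<Phi> :: "'a \<Rightarrow> 'b :: euclidean_space"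
  assumes v: "integrable M v" and \<Phi>: "\<Phi> \<in> borel_measurable M" "\<And>z. z \<in> space M \<Longrightarrow> \<Phi> z \<in> K"
    and K: "compact K" and F: "continuous_on K F"
    and poly: "\<And>P. real_polynomial_function P \<Longrightarrow> (LINT z|M. v z * P (\<Phi> z)) = 0"
    and FM: "(\<lambda>z. F (\<Phi> z)) \<in> borel_measurable M"
  shows "(LINT z|M. v z * F (\<Phi> z)) = 0"
proof -
  have int: "integrable M (\<lambda>z. v z * f (\<Phi> z))"
    if f: "continuous_on K f" "(\<lambda>z. f (\<Phi> z)) \<in> borel_measurable M" for f
  proof -
    obtain B where B: "\<And>x. x \<in> K \<Longrightarrow> \<bar>f x\<bar> \<le> B"
      using compact_imp_bounded[OF compact_continuous_image[OF f(1) K]] unfolding bounded_iff by auto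
    show ?thesis by (rule integrable_mult_bounded[OF v f(2)]) (use B \<Phi>(2) in blast)
  qed
  have small: "\<bar>LINT z|M. v z * F (\<Phi> z)\<bar> \<le> \<epsilon> * (LINT z|M. \<bar>v z\<bar>)" if \<epsilon>: "\<epsilon> > 0" for \<epsilon>
  proof -
    obtain P where P: "real_polynomial_function P" "\<And>x. x \<in> K \<Longrightarrow> \<bar>F x - P x\<bar> < \<epsilon>"
      using Stone_Weierstrass_real_polynomial_function[OF K F \<epsilon>] by blast
    have contP: "continuous_on UNIV P"
      using P(1) continuous_on_polymonial_function real_polynomial_function_eq by blast
    have PM: "(\<lambda>z. P (\<Phi> z)) \<in> borel_measurable M"
      using measurable_compose[OF \<Phi>(1) borel_measurable_continuous_onI[OF contP]] .
    have intP: "integrable M (\<lambda>z. v z * P (\<Phi> z))"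
      by (rule int[OF continuous_on_subset[OF contP] PM]) simp
    have "(LINT z|M. v z * F (\<Phi> z)) = (LINT z|M. v z * F (\<Phi> z) - v z * P (\<Phi> z))"
      by (subst Bochner_Integration.integral_diff[OF int[OF F FM] intP]) (simp add: poly[OF P(1)])
    also have "\<bar>\<dots>\<bar> \<le> (LINT z|M. \<bar>v z * F (\<Phi> z) - v z * P (\<Phi> z)\<bar>)"
      by (rule integral_abs_bound)
    also have "\<dots> \<le> (LINT z|M. \<epsilon> * \<bar>v z\<bar>)"
    proof (rule integral_mono)
      show "\<bar>v z * F (\<Phi> z) - v z * P (\<Phi> z)\<bar> \<le> \<epsilon> * \<bar>v z\<bar>" if "z \<in> space M" for z
      proof -
        have "\<bar>v z * F (\<Phi> z) - v z * P (\<Phi> z)\<bar> = \<bar>F (\<Phi> z) - P (\<Phi> z)\<bar> * \<bar>v z\<bar>"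
          by (simp add: abs_mult[symmetric] algebra_simps)
        also have "\<dots> \<le> \<epsilon> * \<bar>v z\<bar>"
          using P(2)[OF \<Phi>(2)[OF that]] by (intro mult_right_mono) auto
        finally show ?thesis .
      qed
    qed (use int[OF F FM] intP v in auto)
    finally show ?thesis by simp
  qed
  let ?C = "LINT z|M. \<bar>v z\<bar>"
  have C: "0 \<le> ?C" by simp
  have "\<bar>LINT z|M. v z * F (\<Phi> z)\<bar> \<le> 0 + d" if "d > 0" for d
  proof -
    have "\<bar>LINT z|M. v z * F (\<Phi> z)\<bar> \<le> d / (?C + 1) * ?C"
      by (intro small divide_pos_pos that add_nonneg_pos C zero_less_one)
    also have "d / (c + 1) * c \<le> d" if "0 \<le> c" for c :: real
      using that \<open>d > 0\<close> by (simp add: field_simps)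
    note this[OF C]
    finally show ?thesis by simp
  qed
  then have "\<bar>LINT z|M. v z * F (\<Phi> z)\<bar> \<le> 0" by (rule field_le_epsilon)
  then show ?thesis by simp
qed

context cylinder
begin

text \<open>An embedding of the fundamental domain whose coordinate functions \<open>cos x\<close>,
  \<open>cos (w t)\<close>, \<open>sin (w t)\<close> multiply modes into combinations of modes.
  Polynomials in it therefore stay within reach of the orthogonality relations.\<close>

definition chart :: "real \<times> real \<Rightarrow> real \<times> complex" where
  "chart z = (cos (fst z), cis (w * snd z))"

lemma continuous_chart: "continuous_on S chart"
  unfolding chart_def[abs_def] by (intro continuous_intros)

lemma chart_in: "chart z \<in> {-1..1} \<times> sphere 0 1"
  by (simp add: chart_def)

text \<open>Bounded measurable weights; they collect the factors already treated in the induction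
  over polynomials.\<close>

definition bdm :: "(real \<times> real \<Rightarrow> real) \<Rightarrow> bool" where
  "bdm f \<longleftrightarrow> f \<in> borel_measurable M \<and> (\<exists>B. \<forall>z\<in>dom. \<bar>f z\<bar> \<le> B)"

lemma bdmI: "f \<in> borel_measurable M \<Longrightarrow> (\<And>z. z \<in> dom \<Longrightarrow> \<bar>f z\<bar> \<le> B) \<Longrightarrow> bdm f"
  unfolding bdm_def by blast

lemma bdm_mult: "bdm f \<Longrightarrow> bdm g \<Longrightarrow> bdm (\<lambda>z. f z * g z)"
proof -
  assume f: "bdm f" and g: "bdm g"
  obtain B where B: "\<And>z. z \<in> dom \<Longrightarrow> \<bar>f z\<bar> \<le> B" using f by (auto simp: bdm_def)
  obtain C where C: "\<And>z. z \<in> dom \<Longrightarrow> \<bar>g z\<bar> \<le> C" using g by (auto simp: bdm_def)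
  have "\<bar>f z * g z\<bar> \<le> B * C" if "z \<in> dom" for z
    unfolding abs_mult using B[OF that] C[OF that] by (intro mult_mono) auto
  moreover have "(\<lambda>z. f z * g z) \<in> borel_measurable M"
    using f g by (auto simp: bdm_def)
  ultimately show ?thesis by (intro bdmI)
qed

lemma bdm_E: "bdm (E j k)"
  by (rule bdmI[OF E_measurable abs_E_le])

lemma bdm_poly:
  assumes "real_polynomial_function P" shows "bdm (\<lambda>z. P (chart z))"
proof -
  have contP: "continuous_on UNIV P"
    using assms continuous_on_polymonial_function real_polynomial_function_eq by blast
  have comp: "compact (P ` ({-1..1} \<times> sphere 0 1))"
    by (rule compact_continuous_image[OF continuous_on_subset[OF contP subset_UNIV]]) (auto intro: compact_Times)
  obtain B where "\<forall>y\<in>P ` ({-1..1} \<times> sphere 0 1). norm y \<le> B"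
    using compact_imp_bounded[OF comp] unfolding bounded_iff by (rule exE)
  then have "\<bar>P (chart z)\<bar> \<le> B" for z using chart_in[of z] by auto
  moreover have "continuous_on UNIV (\<lambda>z. P (chart z))"
    by (rule continuous_on_compose2[OF contP continuous_chart]) simp
  ultimately show ?thesis by (intro bdmI continuous_measurable)
qed

lemma bdm_integrable: "integrable M u \<Longrightarrow> bdm f \<Longrightarrow> integrable M (\<lambda>z. u z * f z)"
proof -
  assume u: "integrable M u" and f: "bdm f"
  obtain B where B: "\<forall>z\<in>dom. \<bar>f z\<bar> \<le> B" using f unfolding bdm_def by (elim conjE exE)
  have "f \<in> borel_measurable M" using f unfolding bdm_def by (rule conjunct1)
  then show ?thesis
    by (rule integrable_mult_bounded[OF u]) (rule bspec[OF B], simp only: space_M)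
qed

text \<open>Product-to-sum formulas shift \<open>j\<close> and \<open>k\<close> by one, so
  orthogonality to all modes survives a linear factor. The arbitrary weight \<open>f\<close> is what
  makes the induction go through products: \<open>Q\<close> is absorbed into the weight before
  \<open>P\<close> is treated.\<close>

lemma polynomial_preserves_orthogonality:
  fixes u :: "real \<times> real \<Rightarrow> real"
  assumes u: "integrable M u"
    and P: "real_polynomial_function P"
    and f: "bdm f"
    and ort: "\<And>j k. (LINT z|M. u z * E j k z * f z) = 0"
  shows "(LINT z|M. u z * E j k z * (P (chart z) * f z)) = 0"
  using P f ort
proof (induction P arbitrary: f j k)
  case (linear P)
  have int: "integrable M (\<lambda>z. u z * E j k z * f z)" for j k
    unfolding mult.assoc by (intro bdm_integrable u bdm_mult bdm_E linear.prems(1))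
  interpret P: bounded_linear P by (rule linear.hyps)
  \<comment> \<open>Values on a real basis of the product of the real line and the complex
    plane.\<close>
  define a b c where "a = P (1, 0)" and "b = P (0, 1)" and "c = P (0, \<i>)"
  have P_eq: "P (chart z) = cos (fst z) * a + cos (w * snd z) * b + sin (w * snd z) * c" for z
  proof -
    have "chart z = cos (fst z) *\<^sub>R (1, 0) + (cos (w * snd z) *\<^sub>R (0, 1) + sin (w * snd z) *\<^sub>R (0, \<i>))"
      by (simp add: chart_def complex_eq_iff)
    then show ?thesis by (simp only: P.add P.scaleR a_def b_def c_def real_scaleR_def add.assoc)
  qed
  have halves: "s * r * t = x / 2 + y / 2" if "t * r = (x' + y') / 2" "x = s * x'" "y = s * y'" for s r t x y x' y' :: real
  proof -
    have "s * r * t = s * (t * r)" by simp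
    then show ?thesis unfolding that by (simp add: algebra_simps)
  qed
  have halves': "s * r * t = x / 2 - y / 2" if "t * r = (x' - y') / 2" "x = s * x'" "y = s * y'" for s r t x y x' y' :: real
    using halves[of t r x' "- y'" x s "- y"] that by simp
  \<comment> \<open>\<open>j\<close> is a natural number: at \<open>j = 0\<close> the truncated
    \<open>j - 1\<close> would be wrong, but there the mode vanishes identically.\<close>
  have cos_x: "E j k z * cos (fst z) = (if j = 0 then 0 else E (j + 1) k z / 2 + E (j - 1) k z / 2)" for z
  proof (cases j)
    case (Suc i)
    have "real (j + 1) * fst z = real j * fst z + fst z" "real (j - 1) * fst z = real j * fst z - fst z"
      unfolding Suc by (simp_all add: algebra_simps)
    then have "cos (fst z) * sin (real j * fst z) = (sin (real (j + 1) * fst z) + sin (real (j - 1) * fst z)) / 2"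
      by (simp only: sin_times_cos mult.commute[of "cos (fst z)"])
    from halves[OF this, of _ "cas (of_int k * w * snd z)"] show ?thesis
      unfolding E_def using Suc by (simp only: mult.commute[of "cas _"]) simp
  qed (simp add: E_def)
  have cos_t: "E j k z * cos (w * snd z) = E j (k + 1) z / 2 + E j (k - 1) z / 2" for z
  proof -
    have "cos (w * snd z) * cas (of_int k * w * snd z) = (cas (of_int (k + 1) * w * snd z) + cas (of_int (k - 1) * w * snd z)) / 2"
      unfolding cos_mult_cas by (simp only: of_int_diff of_int_add left_diff_distrib distrib_right of_int_1 mult_1)
    then show ?thesis unfolding E_def by (rule halves) (rule refl)+
  qed
  \<comment> \<open>Multiplication by the sine reflects the frequency as well as shifting it, whence
    the indices \<open>- (k - 1)\<close> and \<open>- (k + 1)\<close>.\<close>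
  have sin_t: "E j k z * sin (w * snd z) = E j (- (k - 1)) z / 2 - E j (- (k + 1)) z / 2" for z
  proof -
    have "sin (w * snd z) * cas (of_int k * w * snd z) = (cas (of_int (- (k - 1)) * w * snd z) - cas (of_int (- (k + 1)) * w * snd z)) / 2"
      unfolding sin_mult_cas by (simp only: of_int_diff of_int_add of_int_minus left_diff_distrib distrib_right of_int_1 mult_1 mult_minus_left)
    then show ?thesis unfolding E_def by (rule halves') (rule refl)+
  qed
  have comb: "(LINT z|M. x1 * (u z * E j1 k1 z * f z) + x2 * (u z * E j2 k2 z * f z)) = 0
      \<and> integrable M (\<lambda>z. x1 * (u z * E j1 k1 z * f z) + x2 * (u z * E j2 k2 z * f z))" for x1 x2 j1 k1 j2 k2
    using int by (simp add: linear.prems(2))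
  have 1: "(LINT z|M. u z * (E j k z * cos (fst z)) * f z) = 0 \<and> integrable M (\<lambda>z. u z * (E j k z * cos (fst z)) * f z)"
  proof (cases "j = 0")
    case False
    then have "u z * (E j k z * cos (fst z)) * f z = 1/2 * (u z * E (j+1) k z * f z) + 1/2 * (u z * E (j-1) k z * f z)" for z
      unfolding cos_x by (simp add: algebra_simps)
    then show ?thesis by (simp only:) (rule comb)
  qed (simp add: E_def)
  have 2: "(LINT z|M. u z * (E j k z * cos (w * snd z)) * f z) = 0 \<and> integrable M (\<lambda>z. u z * (E j k z * cos (w * snd z)) * f z)"
  proof -
    have "u z * (E j k z * cos (w * snd z)) * f z = 1/2 * (u z * E j (k+1) z * f z) + 1/2 * (u z * E j (k-1) z * f z)" for z
      unfolding cos_t by (simp add: algebra_simps)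
    then show ?thesis by (simp only:) (rule comb)
  qed
  have 3: "(LINT z|M. u z * (E j k z * sin (w * snd z)) * f z) = 0 \<and> integrable M (\<lambda>z. u z * (E j k z * sin (w * snd z)) * f z)"
  proof -
    have "u z * (E j k z * sin (w * snd z)) * f z = 1/2 * (u z * E j (- (k - 1)) z * f z) + (-1/2) * (u z * E j (- (k + 1)) z * f z)" for z
      unfolding sin_t by (simp add: algebra_simps)
    then show ?thesis by (simp only:) (rule comb)
  qed
  have alg: "x * e * ((c1 * a + c2 * b + c3 * c) * y) = a * (x * (e * c1) * y) + (b * (x * (e * c2) * y) + c * (x * (e * c3) * y))"
    for x e c1 c2 c3 y :: real
    by (simp add: algebra_simps)
  have "(LINT z|M. u z * E j k z * (P (chart z) * f z)) = (LINT z|M. a * (u z * (E j k z * cos (fst z)) * f z) +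
      (b * (u z * (E j k z * cos (w * snd z)) * f z) + c * (u z * (E j k z * sin (w * snd z)) * f z)))"
    unfolding P_eq by (simp only: alg)
  also have "\<dots> = a * (LINT z|M. u z * (E j k z * cos (fst z)) * f z) +
      (b * (LINT z|M. u z * (E j k z * cos (w * snd z)) * f z) + c * (LINT z|M. u z * (E j k z * sin (w * snd z)) * f z))"
    using 1 2 3 by (simp only: Bochner_Integration.integral_add Bochner_Integration.integrable_add
      integrable_mult_right integral_mult_right_zero)
  also have "\<dots> = 0" using 1 2 3 by simp
  finally show ?case .
next
  case (const c)
  have "u z * E j k z * (c * f z) = c * (u z * E j k z * f z)" for z by simp
  then show ?case by (simp only: integral_mult_right_zero const.prems(2) mult_zero_right)
next
  case (add P Q)
  have int: "integrable M (\<lambda>z. u z * E j k z * (R (chart z) * f z))" if "real_polynomial_function R" for R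
    unfolding mult.assoc by (intro bdm_integrable u bdm_mult bdm_E bdm_poly that add.prems(1))
  have "(LINT z|M. u z * E j k z * ((P (chart z) + Q (chart z)) * f z)) =
      (LINT z|M. u z * E j k z * (P (chart z) * f z) + u z * E j k z * (Q (chart z) * f z))"
    by (simp only: distrib_left distrib_right)
  also have "\<dots> = 0"
    using add.IH(1)[OF add.prems] add.IH(2)[OF add.prems]
    by (subst Bochner_Integration.integral_add) (simp_all add: int add.hyps)
  finally show ?case .
next
  case (mult P Q)
  have "(LINT z|M. u z * E j k z * (P (chart z) * (Q (chart z) * f z))) = 0"
    by (rule mult.IH(1)[OF bdm_mult[OF bdm_poly[OF mult.hyps(2)] mult.prems(1)] mult.IH(2)[OF mult.prems]])
  then show ?case by (simp only: mult.assoc)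
qed

lemma chart_inverse:
  assumes "z \<in> dom"
  shows "(arccos (fst (chart z)), Arg2pi (snd (chart z)) / w) = z"
proof -
  have "0 \<le> w * snd z" "w * snd z < w * T"
    using assms w_pos by (auto simp: dom_def simp del: times_divide_eq_left)
  then have "Arg2pi (cis (w * snd z)) = w * snd z"
    by (intro Arg2pi_cis) (simp_all only: wT)
  then show ?thesis
    using assms pq_nonzero by (simp add: chart_def dom_def arccos_cos mem_Times_iff prod_eq_iff)
qed

lemma chart_snd_eq_1:
  assumes "z \<in> dom" "snd (chart z) = 1"
  shows "snd z = 0"
proof -
  have "snd z = Arg2pi (snd (chart z)) / w" using chart_inverse[OF assms(1)] by (metis snd_conv)
  then show ?thesis using assms(2) Arg2pi_cis[of 0] by simp
qed

text \<open>
  Continuous functions of \<open>z\<close> descend along the chart only after multiplication with a cutoff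
  near \<open>t = 0\<close>, where the inverse of the chart jumps.
\<close>

definition pullback :: "nat \<Rightarrow> (real \<times> real \<Rightarrow> real) \<Rightarrow> real \<times> complex \<Rightarrow> real" where
  "pullback n g y = min 1 (real n * norm (snd y - 1)) * max (- 1) (min 1 (g (arccos (fst y), Arg2pi (snd y) / w)))"

text \<open>Where the second coordinate is not 1, the argument function is continuous on the circle.
  At 1 the cutoff factor tends to 0 while the clamped factor stays within
  \<open>[-1, 1]\<close>.\<close>

lemma continuous_pullback:
  assumes g: "continuous_on UNIV g"
  shows "continuous_on ({-1..1} \<times> sphere 0 1) (pullback n g)"
  unfolding continuous_on_eq_continuous_within
proof
  fix y0 :: "real \<times> complex" assume y0: "y0 \<in> {-1..1} \<times> sphere 0 1"
  let ?K = "{-1..1} \<times> sphere 0 1 :: (real \<times> complex) set"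
  show "continuous (at y0 within ?K) (pullback n g)"
  proof (cases "snd y0 = 1")
    case True
    have "((\<lambda>y. real n * norm (snd y - 1)) \<longlongrightarrow> real n * norm (snd y0 - 1)) (at y0 within ?K)"
      by (intro tendsto_intros)
    then have lim: "((\<lambda>y. real n * norm (snd y - 1)) \<longlongrightarrow> 0) (at y0 within ?K)" by (simp add: True)
    have bd: "\<bar>pullback n g y\<bar> \<le> real n * norm (snd y - 1)" for y
    proof -
      define a b where "a = real n * norm (snd y - 1)" and "b = g (arccos (fst y), Arg2pi (snd y) / w)"
      have "0 \<le> a" by (simp add: a_def)
      then have "\<bar>min 1 a\<bar> \<le> a" "\<bar>max (- 1) (min 1 b)\<bar> \<le> 1" by auto
      then have "\<bar>min 1 a\<bar> * \<bar>max (- 1) (min 1 b)\<bar> \<le> a * 1" by (intro mult_mono) auto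
      then show ?thesis by (simp only: pullback_def abs_mult a_def[symmetric] b_def[symmetric] mult_1_right)
    qed
    have "(pullback n g \<longlongrightarrow> 0) (at y0 within ?K)"
      by (rule Lim_null_comparison[OF _ lim]) (simp add: bd)
    moreover have "pullback n g y0 = 0" using True by (simp add: pullback_def)
    ultimately show ?thesis by (simp add: continuous_within)
  next
    case False
    have nn: "snd y0 \<notin> \<real>\<^sub>\<ge>\<^sub>0"
    proof
      assume "snd y0 \<in> \<real>\<^sub>\<ge>\<^sub>0"
      then obtain r where "snd y0 = of_real r" "r \<ge> 0" by (auto simp: nonneg_Reals_def)
      moreover have "norm (snd y0) = 1" using y0 by (auto simp: mem_Times_iff)
      ultimately show False using False by simp
    qed
    have c_fst: "continuous (at y0 within ?K) (\<lambda>y. arccos (fst y))"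
    proof -
      have "continuous_on ?K (\<lambda>y. arccos (fst y))"
        by (rule continuous_on_compose2[OF continuous_on_arccos']) (auto intro: continuous_intros)
      then show ?thesis unfolding continuous_on_eq_continuous_within using y0 by (rule bspec)
    qed
    have c_snd: "continuous (at y0 within ?K) (\<lambda>y. Arg2pi (snd y))"
      by (rule continuous_within_compose3[where g = Arg2pi and f = snd, OF continuous_at_Arg2pi[OF nn]]) (intro continuous_intros)
    have "continuous (at y0 within ?K) (\<lambda>y. (arccos (fst y), Arg2pi (snd y) / w))"
      using pq_nonzero by (intro continuous_Pair c_fst continuous_divide c_snd continuous_const) auto
    moreover have "isCont g x" for x
      using g unfolding continuous_on_eq_continuous_at[OF open_UNIV] by (rule bspec) simp
    ultimately have "continuous (at y0 within ?K) (\<lambda>y. g (arccos (fst y), Arg2pi (snd y) / w))"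
      by (rule continuous_within_compose3[where g = g and f = "\<lambda>y. (arccos (fst y), Arg2pi (snd y) / w)", rotated])
    then show ?thesis
      unfolding pullback_def[abs_def] by (intro continuous_intros)
  qed
qed

lemma pullback_chart:
  assumes "z \<in> dom"
  shows "pullback n g (chart z) = min 1 (real n * norm (cis (w * snd z) - 1)) * max (- 1) (min 1 (g z))"
  using chart_inverse[OF assms] by (simp add: pullback_def chart_def)

lemma abs_pullback_le: "\<bar>pullback n g y\<bar> \<le> 1"
proof -
  have "\<bar>min 1 a\<bar> \<le> 1" if "0 \<le> a" for a :: real using that by auto
  moreover have "\<bar>max (- 1) (min 1 b)\<bar> \<le> 1" for b :: real by auto
  ultimately have "\<bar>min 1 (real n * norm (snd y - 1))\<bar> * \<bar>max (- 1) (min 1 (g (arccos (fst y), Arg2pi (snd y) / w)))\<bar> \<le> 1 * 1"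
    by (intro mult_mono) simp_all
  then show ?thesis by (simp only: pullback_def abs_mult mult_1)
qed

lemma pullback_measurable:
  assumes "continuous_on UNIV g"
  shows "(\<lambda>z. pullback n g (chart z)) \<in> borel_measurable M"
proof -
  have "continuous_on UNIV (\<lambda>z. min 1 (real n * norm (cis (w * snd z) - 1)) * max (- 1) (min 1 (g z)))"
    by (intro continuous_intros assms)
  from continuous_measurable[OF this] show ?thesis
    by (subst measurable_cong[where g = "\<lambda>z. min 1 (real n * norm (cis (w * snd z) - 1)) * max (- 1) (min 1 (g z))"])
      (simp_all only: space_M pullback_chart)
qed

lemma pullback_tendsto:
  assumes z: "z \<in> dom" "snd z \<noteq> 0" and g: "(\<lambda>n. g n z) \<longlonglongrightarrow> s" "\<bar>s\<bar> \<le> 1"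
  shows "(\<lambda>n. pullback n (g n) (chart z)) \<longlonglongrightarrow> s"
proof -
  have "cis (w * snd z) \<noteq> 1" using chart_snd_eq_1[OF z(1)] z(2) by (auto simp: chart_def)
  then have r: "norm (cis (w * snd z) - 1) > 0" (is "?r > 0") by simp
  obtain k where k: "1 / ?r < real k" using reals_Archimedean2 by blast
  have "(\<lambda>n. min 1 (real n * ?r)) \<longlonglongrightarrow> 1"
  proof (rule tendsto_eventually, use eventually_ge_at_top[of k] in eventually_elim)
    case (elim n)
    then have "1 / ?r \<le> real n" using k by linarith
    then have "1 \<le> real n * ?r" using r by (simp only: pos_divide_le_eq)
    then show ?case by (simp only: min_absorb1)
  qed
  moreover have "(\<lambda>n. max (- 1) (min 1 (g n z))) \<longlonglongrightarrow> max (- 1) (min 1 s)"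
    by (intro tendsto_intros g(1))
  ultimately have "(\<lambda>n. min 1 (real n * ?r) * max (- 1) (min 1 (g n z))) \<longlonglongrightarrow> 1 * max (- 1) (min 1 s)"
    by (rule tendsto_mult)
  moreover have "max (- 1) (min 1 s) = s" using g(2) by (simp add: abs_le_iff)
  ultimately show ?thesis by (simp only: pullback_chart[OF z(1)] mult_1)
qed

text \<open>With \<open>v z = u z * sin x\<close>, orthogonality to the modes says that
  \<open>v\<close> integrates to 0 against all polynomials in the chart, hence against all pullbacks
  of continuous functions. Approximating \<open>sgn v\<close> by such pullbacks gives that the
  integral of \<open>\<bar>v\<bar>\<close> is 0.\<close>

lemma E_total:
  assumes u: "u \<in> sqint M" and ort: "\<And>j k. j > 0 \<Longrightarrow> (LINT z|M. u z * E j k z) = 0"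
  shows "AE z in M. u z = 0"
proof -
  interpret finite_measure M by (rule finite_M)
  have "(\<lambda>_. 1) \<in> sqint M" by (simp add: sqint_def)
  from sqint_mult[OF u this] have u_int: "integrable M u" by simp
  \<comment> \<open>The sine modes are \<open>sin x\<close> times polynomials in
    \<open>cos x\<close>, so a factor \<open>sin x\<close> is moved from the modes to
    \<open>u\<close>; it vanishes only on the boundary lines.\<close>
  define v where "v z = u z * E 1 0 z" for z
  have v_eq: "v z = u z * sin (fst z)" for z by (simp add: v_def E_def cas_def)
  have v_int: "integrable M v" unfolding v_def[abs_def] by (rule bdm_integrable[OF u_int bdm_E])
  have v_meas [measurable]: "v \<in> borel_measurable M" by (rule borel_measurable_integrable[OF v_int])
  have ort': "(LINT z|M. u z * E j k z * 1) = 0" for j k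
    by (cases "j = 0") (simp_all add: ort E_def[of 0])
  have one: "bdm (\<lambda>_. 1)" by (rule bdmI[of _ 1]) auto
  have poly: "(LINT z|M. v z * P (chart z)) = 0" if "real_polynomial_function P" for P
    using polynomial_preserves_orthogonality[OF u_int that one ort', of 1 0] by (simp add: v_def)
  have chart_meas: "chart \<in> borel_measurable M" by (rule continuous_measurable[OF continuous_chart])
  have van: "(LINT z|M. v z * pullback n g (chart z)) = 0" if "continuous_on UNIV g" for n g
    by (rule Stone_Weierstrass_vanishing[OF v_int chart_meas chart_in _ continuous_pullback[OF that] poly pullback_measurable[OF that]])
      (auto intro: compact_Times)
  have "(\<lambda>z. sgn (v z)) \<in> borel_measurable (lebesgue_on dom)"
    unfolding M_eq[symmetric] by measurable
  then have "(\<lambda>z. sgn (v z)) measurable_on dom"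
    by (simp only: measurable_on_iff_borel_measurable[OF dom_sets])
  \<comment> \<open>Measurability of \<open>sgn v\<close> as an almost everywhere limit of
    continuous functions; the clamp and the cutoff in \<open>pullback\<close> do not disturb this
    limit off \<open>t = 0\<close>.\<close>
  then obtain N g where N: "negligible N" and g: "\<And>n. continuous_on UNIV (g n)"
    and lim: "\<And>z. z \<notin> N \<Longrightarrow> (\<lambda>n. g n z) \<longlonglongrightarrow> (if z \<in> dom then sgn (v z) else 0)"
    unfolding measurable_on_def by blast
  have "(\<lambda>n. LINT z|M. v z * pullback n (g n) (chart z)) \<longlonglongrightarrow> (LINT z|M. \<bar>v z\<bar>)"
  proof (rule integral_dominated_convergence[where w = "\<lambda>z. \<bar>v z\<bar>"])
    show "(\<lambda>z. v z * pullback n (g n) (chart z)) \<in> borel_measurable M" for n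
      using pullback_measurable[OF g] by measurable
    show "AE z in M. (\<lambda>n. v z * pullback n (g n) (chart z)) \<longlonglongrightarrow> \<bar>v z\<bar>"
      using AE_not_negligible[OF N] AE_not_negligible[OF negligible_line(2)[of 0]] AE_space
    proof eventually_elim
      case (elim z)
      then have z: "z \<in> dom" "snd z \<noteq> 0" by (auto simp: space_M)
      have "(\<lambda>n. g n z) \<longlonglongrightarrow> sgn (v z)" using lim[of z] elim z by simp
      then have "(\<lambda>n. pullback n (g n) (chart z)) \<longlonglongrightarrow> sgn (v z)"
        by (rule pullback_tendsto[OF z]) (simp add: sgn_if)
      then have "(\<lambda>n. v z * pullback n (g n) (chart z)) \<longlonglongrightarrow> v z * sgn (v z)" by (intro tendsto_intros)
      then show ?case by (simp add: abs_sgn)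
    qed
    show "AE z in M. norm (v z * pullback n (g n) (chart z)) \<le> \<bar>v z\<bar>" for n
      using abs_pullback_le[of n "g n"] by (intro AE_I2) (simp add: abs_mult mult_left_le)
  qed (use v_int in auto)
  then have "(LINT z|M. \<bar>v z\<bar>) = 0" by (simp add: van g LIMSEQ_const_iff)
  then have "AE z in M. \<bar>v z\<bar> = 0"
    using integral_nonneg_eq_0_iff_AE[of M "\<lambda>z. \<bar>v z\<bar>"] v_int by auto
  then show ?thesis
    using AE_not_negligible[OF negligible_line(1)[of 0]] AE_not_negligible[OF negligible_line(1)[of pi]] AE_space
  proof eventually_elim
    case (elim z)
    then have "0 < fst z" "fst z < pi" by (auto simp: space_M dom_def)
    then have "sin (fst z) \<noteq> 0" using sin_gt_zero[of "fst z"] by simp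
    then show ?case using elim by (simp add: v_eq)
  qed
qed

definition nc :: real where "nc = sqrt (2 / (pi * T))"

lemma nc: "nc > 0" "nc * nc = 2 / (pi * T)"
proof -
  have "pi * T > 0" using period_pos by simp
  then have "2 / (pi * T) > 0" by simp
  then show "nc > 0" "nc * nc = 2 / (pi * T)" unfolding nc_def by (simp_all only: real_sqrt_gt_zero real_sqrt_mult_self abs_of_pos)
qed

text \<open>The index type is all of \<open>nat \<times> int\<close>, whereas the modes start at
  \<open>j = 1\<close>; hence the shift by \<open>Suc\<close>.\<close>

sublocale B: L2_basis M "\<lambda>i z. nc * E (Suc (fst i)) (snd i) z"
proof
  show "(\<lambda>z. nc * E (Suc (fst i)) (snd i) z) \<in> sqint M" for i
    by (rule sqint_cmult[OF E_sqint])
  show "(LINT z|M. (nc * E (Suc (fst i)) (snd i) z) * (nc * E (Suc (fst j)) (snd j) z)) = (if i = j then 1 else 0)" for i j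
  proof -
    have "(LINT z|M. (nc * E (Suc (fst i)) (snd i) z) * (nc * E (Suc (fst j)) (snd j) z)) =
        (LINT z|M. (nc * nc) * (E (Suc (fst i)) (snd i) z * E (Suc (fst j)) (snd j) z))"
      by (simp only: mult_ac)
    also have "\<dots> = (nc * nc) * (if i = j then pi * T / 2 else 0)"
      unfolding integral_mult_right_zero using E_orthogonal[of "Suc (fst i)" "Suc (fst j)" "snd i" "snd j"]
      by (simp add: prod_eq_iff)
    also have "\<dots> = (if i = j then 1 else 0)" unfolding nc(2) using period_pos by simp
    finally show ?thesis .
  qed
  fix u assume u: "u \<in> sqint M" and ort: "\<And>i. (LINT z|M. u z * (nc * E (Suc (fst i)) (snd i) z)) = 0"
  show "AE z in M. u z = 0"
  proof (rule E_total[OF u])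
    fix j :: nat and k assume "j > 0"
    then obtain n where j: "j = Suc n" by (cases j) auto
    have "(LINT z|M. nc * (u z * E (Suc n) k z)) = 0" using ort[of "(n, k)"] by (simp add: mult_ac)
    then show "(LINT z|M. u z * E j k z) = 0" using nc(1) by (simp add: j)
  qed
qed

end

subsection \<open>Fourier expansions\<close>

context cylinder
begin

lemma has_sum_E_squares:
  assumes u: "u \<in> sqint M"
  shows "((\<lambda>(n, k). (LINT z|M. u z * E (Suc n) k z)\<^sup>2) has_sum (pi * T / 2 * (LINT z|M. (u z)\<^sup>2))) UNIV"
proof -
  have "((\<lambda>i. (coord (B.co u) i)\<^sup>2) has_sum (LINT z|M. (u z)\<^sup>2)) UNIV"
    unfolding B.parseval[OF u] norm_ell2_square by (rule has_sum_infsum[OF coord_square_summable])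
  then have "((\<lambda>i. pi * T / 2 * (coord (B.co u) i)\<^sup>2) has_sum (pi * T / 2 * (LINT z|M. (u z)\<^sup>2))) UNIV"
    by (rule has_sum_cmult_right)
  moreover have "pi * T / 2 * (coord (B.co u) i)\<^sup>2 = (case i of (n, k) \<Rightarrow> (LINT z|M. u z * E (Suc n) k z)\<^sup>2)" for i
  proof -
    have "coord (B.co u) i = nc * (LINT z|M. u z * E (Suc (fst i)) (snd i) z)"
    proof -
      have "u z * (nc * x) = nc * (u z * x)" for x z by simp
      then show ?thesis unfolding B.coord_co[OF u] B.fc_def by (simp only: integral_mult_right_zero)
    qed
    then have "(coord (B.co u) i)\<^sup>2 = (nc * nc) * (LINT z|M. u z * E (Suc (fst i)) (snd i) z)\<^sup>2"
      by (simp add: power2_eq_square)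
    then show ?thesis unfolding nc(2) using period_pos by (simp add: case_prod_beta)
  qed
  ultimately show ?thesis by simp
qed

text \<open>The complex Fourier coefficient \<open>2 / (pi * T)\<close> times the integral of
  \<open>u\<close> against the conjugate mode, written through the real coefficients at
  \<open>k\<close> and \<open>- k\<close>.\<close>

definition chat :: "(real \<times> real \<Rightarrow> real) \<Rightarrow> nat \<Rightarrow> int \<Rightarrow> complex" where
  "chat u j k = (let a = (LINT z|M. u z * E j k z); a' = (LINT z|M. u z * E j (- k) z)
    in Complex ((a + a') / (pi * T)) ((a' - a) / (pi * T)))"

lemma chat_cnj: "chat u j k = cnj (chat u j (- k))"
  by (simp add: chat_def Let_def complex_eq_iff add.commute minus_divide_left)

lemma cmod_chat_square:
  "(cmod (chat u j k))\<^sup>2 = 2 / (pi * T)\<^sup>2 * ((LINT z|M. u z * E j k z)\<^sup>2 + (LINT z|M. u z * E j (- k) z)\<^sup>2)"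
proof -
  have "((x + y) / r)\<^sup>2 + ((y - x) / r)\<^sup>2 = 2 / r\<^sup>2 * (x\<^sup>2 + y\<^sup>2)" for x y r :: real
  proof -
    have "((x + y) / r)\<^sup>2 + ((y - x) / r)\<^sup>2 = ((x + y)\<^sup>2 + (y - x)\<^sup>2) / r\<^sup>2"
      unfolding power_divide by (rule add_divide_distrib[symmetric])
    also have "(x + y)\<^sup>2 + (y - x)\<^sup>2 = 2 * (x\<^sup>2 + y\<^sup>2)"
      by (simp add: power2_eq_square algebra_simps)
    finally show ?thesis by simp
  qed
  then show ?thesis unfolding chat_def Let_def cmod_power2 complex.sel .
qed

text \<open>Each squared real coefficient enters twice, at \<open>k\<close> and after the reflection
  of \<open>k\<close>; the two sums coincide.\<close>

lemma has_sum_chat: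
  assumes u: "u \<in> sqint M"
  shows "((\<lambda>(j, k). (cmod (chat u j k))\<^sup>2) has_sum (2 / (pi * T) * (LINT z|M. (u z)\<^sup>2))) modes"
proof -
  let ?a = "\<lambda>n k. (LINT z|M. u z * E (Suc n) k z)\<^sup>2"
  let ?s = "pi * T / 2 * (LINT z|M. (u z)\<^sup>2)"
  have 1: "((\<lambda>(n, k). ?a n k) has_sum ?s) UNIV" by (rule has_sum_E_squares[OF u])
  have bij: "bij_betw (\<lambda>(n, k). (n, - k)) (UNIV :: (nat \<times> int) set) UNIV"
    by (rule bij_betwI[where g = "\<lambda>(n, k). (n, - k)"]) auto
  have "((\<lambda>i. (case (case i of (n, k) \<Rightarrow> (n, - k)) of (n, k) \<Rightarrow> ?a n k)) has_sum ?s) UNIV"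
    using has_sum_reindex_bij_betw[OF bij, of "\<lambda>(n, k). ?a n k" ?s] 1 by simp
  then have 2: "((\<lambda>(n, k). ?a n (- k)) has_sum ?s) UNIV" by (simp add: case_prod_unfold)
  have "((\<lambda>i. 2 / (pi * T)\<^sup>2 * ((case i of (n, k) \<Rightarrow> ?a n k) + (case i of (n, k) \<Rightarrow> ?a n (- k)))) has_sum
      (2 / (pi * T)\<^sup>2 * (?s + ?s))) UNIV"
    by (intro has_sum_cmult_right has_sum_add 1 2)
  moreover have "2 / (pi * T)\<^sup>2 * (?s + ?s) = 2 / (pi * T) * (LINT z|M. (u z)\<^sup>2)"
    using period_pos by (simp add: power2_eq_square)
  moreover have "2 / (pi * T)\<^sup>2 * ((case i of (n, k) \<Rightarrow> ?a n k) + (case i of (n, k) \<Rightarrow> ?a n (- k))) =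
      (case (case i of (n, k) \<Rightarrow> (Suc n, k)) of (j, k) \<Rightarrow> (cmod (chat u j k))\<^sup>2)" for i
    by (simp only: case_prod_beta cmod_chat_square fst_conv snd_conv)
  ultimately have 3: "((\<lambda>i. (case (case i of (n, k) \<Rightarrow> (Suc n, k)) of (j, k) \<Rightarrow> (cmod (chat u j k))\<^sup>2)) has_sum
      (2 / (pi * T) * (LINT z|M. (u z)\<^sup>2))) UNIV"
    by (simp only:)
  have bij': "bij_betw (\<lambda>(n, k). (Suc n, k)) (UNIV :: (nat \<times> int) set) modes"
    by (rule bij_betwI[where g = "\<lambda>(j, k). (j - 1, k)"]) (auto simp: modes_def)
  show ?thesis
    using has_sum_reindex_bij_betw[OF bij', of "\<lambda>(j, k). (cmod (chat u j k))\<^sup>2"] 3 by simp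
qed

lemma mode_eq:
  "mode p q j k z = of_real (sin (real j * fst z)) * cis (of_int k * w * snd z)"
  by (simp add: mode_def case_prod_beta cis_conv_exp)

lemma continuous_mode: "continuous_on S (mode p q j k)"
  unfolding mode_eq[abs_def] by (intro continuous_intros)

lemma integral_Complex:
  fixes f g :: "'a \<Rightarrow> real"
  assumes "integrable N f" "integrable N g"
  shows "integrable N (\<lambda>z. Complex (f z) (g z))"
    and "(LINT z|N. Complex (f z) (g z)) = Complex (LINT z|N. f z) (LINT z|N. g z)"
proof -
  have eq: "Complex (f z) (g z) = of_real (f z) + \<i> * of_real (g z)" for z by (simp add: complex_eq_iff)
  show "integrable N (\<lambda>z. Complex (f z) (g z))"
    unfolding eq using assms by simp
  have "(LINT z|N. of_real (f z) + \<i> * of_real (g z) :: complex) = of_real (LINT z|N. f z) + \<i> * of_real (LINT z|N. g z)"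
    using assms by simp
  then show "(LINT z|N. Complex (f z) (g z)) = Complex (LINT z|N. f z) (LINT z|N. g z)"
    unfolding eq by (simp add: complex_eq_iff)
qed

lemma mode_orthogonal:
  assumes "j > 0" "j' > 0"
  shows "(LINT z|M. mode p q j k z * cnj (mode p q j' k' z)) = (if j = j' \<and> k = k' then of_real (pi * T / 2) else 0)"
proof -
  let ?s = "\<lambda>x. sin (real j * x) * sin (real j' * x)"
  let ?c = "\<lambda>z :: real \<times> real. ?s (fst z) * cos (of_int (k - k') * w * snd z)"
  let ?d = "\<lambda>z :: real \<times> real. ?s (fst z) * sin (of_int (k - k') * w * snd z)"
  have arg: "of_int k * w * t + - (of_int k' * w * t) = of_int (k - k') * w * t" for t
    by (simp only: of_int_diff left_diff_distrib add_uminus_conv_diff)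
  have "mode p q j k z * cnj (mode p q j' k' z) = of_real (?s (fst z)) * (cis (of_int k * w * snd z) * cis (- (of_int k' * w * snd z)))" for z
    unfolding mode_eq by (simp only: complex_cnj_mult complex_cnj_complex_of_real cis_cnj of_real_mult mult_ac)
  then have eq: "mode p q j k z * cnj (mode p q j' k' z) = Complex (?c z) (?d z)" for z
    unfolding cis_mult arg by (simp add: complex_eq_iff)
  have "integrable M ?c" "integrable M ?d"
    by (rule continuous_integrable, intro continuous_intros)+
  from integral_Complex(2)[OF this]
  have "(LINT z|M. mode p q j k z * cnj (mode p q j' k' z)) = Complex (LINT z|M. ?c z) (LINT z|M. ?d z)"
    unfolding eq .
  also have "(LINT z|M. ?c z) = integral {0..pi} ?s * integral {0..T} (\<lambda>t. cos (of_int (k - k') * w * t))"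
    by (rule integral_product) (intro continuous_intros)+
  also have "(LINT z|M. ?d z) = integral {0..pi} ?s * integral {0..T} (\<lambda>t. sin (of_int (k - k') * w * t))"
    by (rule integral_product) (intro continuous_intros)+
  finally show ?thesis
    using assms by (simp only: integral_cos_period integral_sin_period integral_sin_mult_sin) (simp add: complex_eq_iff)
qed

lemma integral_mult_cnj_mode:
  assumes u: "u \<in> sqint M"
  shows "integrable M (\<lambda>z. of_real (u z) * cnj (mode p q j k z))"
    and "(LINT z|M. of_real (u z) * cnj (mode p q j k z)) = of_real (pi * T / 2) * chat u j k"
proof -
  have i: "integrable M (\<lambda>z. u z * E j k z)" for k by (rule sqint_mult[OF u E_sqint])
  have minus: "of_int (- k) * w * t = - (of_int k * w * t)" for t by simp
  have "cnj (mode p q j k z) = Complex ((E j k z + E j (- k) z) / 2) ((E j (- k) z - E j k z) / 2)" for z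
    unfolding mode_eq E_def minus cas_def by (simp add: complex_eq_iff field_simps)
  then have eq: "of_real (u z) * cnj (mode p q j k z) =
      Complex ((u z * E j k z + u z * E j (- k) z) / 2) ((u z * E j (- k) z - u z * E j k z) / 2)" for z
    by (simp add: complex_eq_iff algebra_simps)
  have ii: "integrable M (\<lambda>z. (u z * E j k z + u z * E j (- k) z) / 2)" "integrable M (\<lambda>z. (u z * E j (- k) z - u z * E j k z) / 2)"
    using i by simp_all
  show "integrable M (\<lambda>z. of_real (u z) * cnj (mode p q j k z))"
    unfolding eq by (rule integral_Complex(1)[OF ii])
  show "(LINT z|M. of_real (u z) * cnj (mode p q j k z)) = of_real (pi * T / 2) * chat u j k"
    unfolding eq integral_Complex(2)[OF ii] using i pq_nonzero period_pos
    by (simp add: chat_def Let_def complex_eq_iff field_simps)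
qed

lemma residual_mode:
  assumes u: "u \<in> sqint M" and F: "finite F" "F \<subseteq> modes" and jk: "(j, k) \<in> modes - F"
  shows "integrable M (\<lambda>z. (of_real (u z) - (\<Sum>(j, k)\<in>F. c j k * mode p q j k z)) * cnj (mode p q j k z))"
    and "(LINT z|M. (of_real (u z) - (\<Sum>(j, k)\<in>F. c j k * mode p q j k z)) * cnj (mode p q j k z)) =
      of_real (pi * T / 2) * chat u j k"
proof -
  let ?m = "mode p q j k"
  have eq: "(of_real (u z) - (\<Sum>(j, k)\<in>F. c j k * mode p q j k z)) * cnj (?m z) =
      of_real (u z) * cnj (?m z) - (\<Sum>i\<in>F. c (fst i) (snd i) * (mode p q (fst i) (snd i) z * cnj (?m z)))" for z
    by (simp add: left_diff_distrib sum_distrib_right case_prod_beta mult.assoc)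
  have im: "integrable M (\<lambda>z. c (fst i) (snd i) * (mode p q (fst i) (snd i) z * cnj (?m z)))" for i
    by (intro integrable_mult_right continuous_integrable continuous_intros continuous_mode)
  show "integrable M (\<lambda>z. (of_real (u z) - (\<Sum>(j, k)\<in>F. c j k * mode p q j k z)) * cnj (?m z))"
    unfolding eq by (intro Bochner_Integration.integrable_diff Bochner_Integration.integrable_sum im integral_mult_cnj_mode(1)[OF u])
  have "(LINT z|M. (of_real (u z) - (\<Sum>(j, k)\<in>F. c j k * mode p q j k z)) * cnj (?m z)) =
      of_real (pi * T / 2) * chat u j k - (\<Sum>i\<in>F. LINT z|M. c (fst i) (snd i) * (mode p q (fst i) (snd i) z * cnj (?m z)))"
    unfolding eq
    by (subst Bochner_Integration.integral_diff)
      (simp_all only: integral_mult_cnj_mode[OF u] Bochner_Integration.integrable_sum im Bochner_Integration.integral_sum)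
  also have "(\<Sum>i\<in>F. LINT z|M. c (fst i) (snd i) * (mode p q (fst i) (snd i) z * cnj (?m z))) = 0"
  proof (rule sum.neutral, rule ballI)
    fix i assume i: "i \<in> F"
    then have "fst i > 0" "j > 0" "\<not> (fst i = j \<and> snd i = k)"
      using F jk by (auto simp: modes_def)
    then show "(LINT z|M. c (fst i) (snd i) * (mode p q (fst i) (snd i) z * cnj (?m z))) = 0"
      by (simp only: integral_mult_right_zero mode_orthogonal if_False mult_zero_right)
  qed
  finally show "(LINT z|M. (of_real (u z) - (\<Sum>(j, k)\<in>F. c j k * mode p q j k z)) * cnj (?m z)) =
      of_real (pi * T / 2) * chat u j k" by simp
qed

text \<open>Pythagoras with arbitrary coefficients, one mode added per step. Taking
  \<open>c = chat u\<close> yields the expansion, general \<open>c\<close> its uniqueness.\<close>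

lemma residual_square:
  assumes u: "u \<in> sqint M" and F: "finite F" "F \<subseteq> modes"
  shows "integrable M (\<lambda>z. (cmod (of_real (u z) - (\<Sum>(j, k)\<in>F. c j k * mode p q j k z)))\<^sup>2) \<and>
    (LINT z|M. (cmod (of_real (u z) - (\<Sum>(j, k)\<in>F. c j k * mode p q j k z)))\<^sup>2) =
    (LINT z|M. (u z)\<^sup>2) + pi * T / 2 * (\<Sum>(j, k)\<in>F. (cmod (c j k - chat u j k))\<^sup>2 - (cmod (chat u j k))\<^sup>2)"
  using F
proof (induction F rule: finite_induct)
  case empty
  then show ?case by (simp add: sqint_integrable[OF u])
next
  case (insert i F)
  obtain j k where i: "i = (j, k)" by (cases i)
  define X where "X z = of_real (u z) - (\<Sum>(j, k)\<in>F. c j k * mode p q j k z)" for z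
  define m where "m = mode p q j k"
  define a where "a = c j k"
  have jk: "(j, k) \<in> modes - F" "F \<subseteq> modes" "j > 0" using insert i by (auto simp: modes_def)
  have IH: "integrable M (\<lambda>z. (cmod (X z))\<^sup>2)"
    "(LINT z|M. (cmod (X z))\<^sup>2) = (LINT z|M. (u z)\<^sup>2) + pi * T / 2 * (\<Sum>(j, k)\<in>F. (cmod (c j k - chat u j k))\<^sup>2 - (cmod (chat u j k))\<^sup>2)"
    using insert.IH[OF jk(2)] unfolding X_def by blast+
  have step: "of_real (u z) - (\<Sum>(j, k)\<in>insert i F. c j k * mode p q j k z) = X z - a * m z" for z
    using insert(1,2) by (simp add: i X_def m_def a_def)
  have sq: "(cmod (x - a * y))\<^sup>2 = (cmod x)\<^sup>2 - 2 * Re (cnj a * (x * cnj y)) + (cmod a)\<^sup>2 * Re (y * cnj y)" for x y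
    unfolding cmod_power2 by (simp add: power2_eq_square algebra_simps)
  have iXm: "integrable M (\<lambda>z. X z * cnj (m z))" "(LINT z|M. X z * cnj (m z)) = of_real (pi * T / 2) * chat u j k"
    unfolding X_def m_def by (rule residual_mode[OF u insert(1) jk(2,1)])+
  have imm: "integrable M (\<lambda>z. m z * cnj (m z))"
    unfolding m_def by (intro continuous_integrable continuous_intros continuous_mode)
  have mm: "(LINT z|M. m z * cnj (m z)) = of_real (pi * T / 2)"
    unfolding m_def using mode_orthogonal[OF jk(3,3), of k k] by simp
  have i1: "integrable M (\<lambda>z. Re (cnj a * (X z * cnj (m z))))"
    using iXm(1) by (intro integrable_Re integrable_mult_right)
  have i2: "integrable M (\<lambda>z. Re (m z * cnj (m z)))"
    using imm by (rule integrable_Re)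
  have e1: "(LINT z|M. Re (cnj a * (X z * cnj (m z)))) = Re (cnj a * (of_real (pi * T / 2) * chat u j k))"
    using iXm by (subst integral_Re) (simp_all del: of_real_mult of_real_divide)
  have e2: "(LINT z|M. Re (m z * cnj (m z))) = pi * T / 2"
    by (subst integral_Re[OF imm]) (simp only: mm Re_complex_of_real)
  have "integrable M (\<lambda>z. (cmod (X z - a * m z))\<^sup>2)"
    unfolding sq by (intro Bochner_Integration.integrable_add Bochner_Integration.integrable_diff integrable_mult_right IH(1) i1 i2)
  moreover have "(LINT z|M. (cmod (X z - a * m z))\<^sup>2) =
      (LINT z|M. (cmod (X z))\<^sup>2) - 2 * Re (cnj a * (of_real (pi * T / 2) * chat u j k)) + (cmod a)\<^sup>2 * (pi * T / 2)"
    unfolding sq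
    by (simp only: e1 e2 Bochner_Integration.integral_add Bochner_Integration.integral_diff
      Bochner_Integration.integrable_diff integrable_mult_right integral_mult_right_zero IH(1) i1 i2)
  \<comment> \<open>Completing the square in the new coefficient, with \<open>r\<close> the squared
    norm of a mode.\<close>
  moreover have "- 2 * Re (cnj a * (of_real r * b)) + (cmod a)\<^sup>2 * r = r * ((cmod (a - b))\<^sup>2 - (cmod b)\<^sup>2)" for r b
    unfolding cmod_power2 by (simp add: power2_eq_square algebra_simps)
  from this[of "pi * T / 2" "chat u j k"]
  have "- 2 * Re (cnj a * (of_real (pi * T / 2) * chat u j k)) + (cmod a)\<^sup>2 * (pi * T / 2) =
      pi * T / 2 * ((cmod (a - chat u j k))\<^sup>2 - (cmod (chat u j k))\<^sup>2)" .
  moreover have "(\<Sum>(j, k)\<in>insert i F. (cmod (c j k - chat u j k))\<^sup>2 - (cmod (chat u j k))\<^sup>2) =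
      ((cmod (a - chat u j k))\<^sup>2 - (cmod (chat u j k))\<^sup>2) + (\<Sum>(j, k)\<in>F. (cmod (c j k - chat u j k))\<^sup>2 - (cmod (chat u j k))\<^sup>2)"
    using insert(1,2) by (simp add: i a_def)
  ultimately show ?case
    unfolding step using IH(2) by (simp only: distrib_left simp_thms)
qed

lemma expands_chat:
  assumes u: "u \<in> sqint M" "on_cylinder T u"
  shows "expands p q u (chat u)"
  unfolding expands_def
proof (intro conjI allI impI)
  show "u \<in> borel_measurable M" "integrable M (\<lambda>z. (u z)\<^sup>2)"
    using u(1) by (auto simp: sqint_def)
  show "chat u j k = cnj (chat u j (- k))" for j k by (rule chat_cnj)
  show "(\<lambda>(j, k). (cmod (chat u j k))\<^sup>2) summable_on modes"
    using has_sum_chat[OF u(1)] by (rule has_sum_imp_summable)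
  let ?c2 = "\<lambda>(j, k). (cmod (chat u j k))\<^sup>2"
  have "(sum ?c2 \<longlongrightarrow> 2 / (pi * T) * (LINT z|M. (u z)\<^sup>2)) (finite_subsets_at_top modes)"
    using has_sum_chat[OF u(1)] by (simp add: has_sum_def)
  then have "((\<lambda>F. (LINT z|M. (u z)\<^sup>2) - pi * T / 2 * sum ?c2 F) \<longlongrightarrow>
      (LINT z|M. (u z)\<^sup>2) - pi * T / 2 * (2 / (pi * T) * (LINT z|M. (u z)\<^sup>2))) (finite_subsets_at_top modes)"
    by (intro tendsto_intros)
  then have lim: "((\<lambda>F. (LINT z|M. (u z)\<^sup>2) - pi * T / 2 * sum ?c2 F) \<longlongrightarrow> 0) (finite_subsets_at_top modes)"
    using period_pos by simp
  show "((\<lambda>F. LINT z|M. (cmod (of_real (u z) - (\<Sum>(j, k)\<in>F. chat u j k * mode p q j k z)))\<^sup>2) \<longlongrightarrow> 0)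
      (finite_subsets_at_top modes)"
  proof (rule Lim_transform_eventually[OF lim])
    show "\<forall>\<^sub>F F in finite_subsets_at_top modes. (LINT z|M. (u z)\<^sup>2) - pi * T / 2 * sum ?c2 F =
        (LINT z|M. (cmod (of_real (u z) - (\<Sum>(j, k)\<in>F. chat u j k * mode p q j k z)))\<^sup>2)"
    proof (rule eventually_finite_subsets_at_top_weakI)
      fix F assume F: "finite F" "F \<subseteq> modes"
      have "(\<Sum>(j, k)\<in>F. (cmod (chat u j k - chat u j k))\<^sup>2 - (cmod (chat u j k))\<^sup>2) = - sum ?c2 F"
        by (simp add: case_prod_beta sum_negf)
      then show "(LINT z|M. (u z)\<^sup>2) - pi * T / 2 * sum ?c2 F =
        (LINT z|M. (cmod (of_real (u z) - (\<Sum>(j, k)\<in>F. chat u j k * mode p q j k z)))\<^sup>2)"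
        using residual_square[OF u(1) F, of "chat u"] by simp
    qed
  qed
qed (rule u(2))

lemma expands_sqint: "expands p q u c \<Longrightarrow> u \<in> sqint M"
  by (auto simp: expands_def sqint_def)

text \<open>Once \<open>F\<close> contains \<open>(j, k)\<close>, Bessel's inequality bounds the
  residual below by the contribution of this single coefficient, and the residual tends to
  0.\<close>

lemma expands_unique:
  assumes "expands p q u c" "j \<ge> 1"
  shows "c j k = chat u j k"
proof -
  have u: "u \<in> sqint M" by (rule expands_sqint) fact
  have lim: "((\<lambda>F. LINT z|M. (cmod (of_real (u z) - (\<Sum>(j, k)\<in>F. c j k * mode p q j k z)))\<^sup>2) \<longlongrightarrow> 0)
      (finite_subsets_at_top modes)"
    using assms(1) by (simp add: expands_def)
  have "\<forall>\<^sub>F F in finite_subsets_at_top modes. pi * T / 2 * (cmod (c j k - chat u j k))\<^sup>2 \<le>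
      (LINT z|M. (cmod (of_real (u z) - (\<Sum>(j, k)\<in>F. c j k * mode p q j k z)))\<^sup>2)"
    unfolding eventually_finite_subsets_at_top
  proof (intro exI[of _ "{(j, k)}"] conjI allI impI)
    fix F assume F: "finite F \<and> {(j, k)} \<subseteq> F \<and> F \<subseteq> modes"
    let ?d = "\<lambda>i. (cmod (c (fst i) (snd i) - chat u (fst i) (snd i)))\<^sup>2"
    have "0 \<le> (LINT z|M. (cmod (of_real (u z) - (\<Sum>(j, k)\<in>F. chat u j k * mode p q j k z)))\<^sup>2)" by simp
    also have "\<dots> = (LINT z|M. (u z)\<^sup>2) - pi * T / 2 * (\<Sum>i\<in>F. (cmod (chat u (fst i) (snd i)))\<^sup>2)"
      using residual_square[OF u, of F "chat u"] F by (simp add: case_prod_beta sum_negf)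
    finally have 1: "pi * T / 2 * (\<Sum>i\<in>F. (cmod (chat u (fst i) (snd i)))\<^sup>2) \<le> (LINT z|M. (u z)\<^sup>2)" by simp
    have "?d (j, k) \<le> sum ?d F" using F by (intro member_le_sum) auto
    then have "pi * T / 2 * ?d (j, k) \<le> pi * T / 2 * sum ?d F"
      using period_pos by (intro mult_left_mono) auto
    moreover have "(LINT z|M. (cmod (of_real (u z) - (\<Sum>(j, k)\<in>F. c j k * mode p q j k z)))\<^sup>2) =
        (LINT z|M. (u z)\<^sup>2) + pi * T / 2 * (sum ?d F - (\<Sum>i\<in>F. (cmod (chat u (fst i) (snd i)))\<^sup>2))"
      using residual_square[OF u, of F c] F by (simp add: case_prod_unfold sum_subtractf)
    ultimately show "pi * T / 2 * (cmod (c j k - chat u j k))\<^sup>2 \<le>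
      (LINT z|M. (cmod (of_real (u z) - (\<Sum>(j, k)\<in>F. c j k * mode p q j k z)))\<^sup>2)"
      using 1 by (simp only: right_diff_distrib fst_conv snd_conv)
  qed (use assms(2) in \<open>auto simp: modes_def\<close>)
  then have "pi * T / 2 * (cmod (c j k - chat u j k))\<^sup>2 \<le> 0"
    by (rule tendsto_lowerbound[OF lim]) (simp add: finite_subsets_at_top_neq_bot)
  moreover have "pi * T / 2 > 0" using period_pos by simp
  ultimately have "(cmod (c j k - chat u j k))\<^sup>2 \<le> 0"
    using mult_le_cancel_left_pos[of "pi * T / 2" "(cmod (c j k - chat u j k))\<^sup>2" 0] by (simp only: mult_zero_right)
  then show ?thesis by simp
qed

text \<open>Values at \<open>j = 0\<close> are not seen by an expansion, so a choice of coefficients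
  is determined only for \<open>j \<ge> 1\<close>.\<close>

lemma expands_cong:
  assumes "expands p q u c" "\<And>j k. j \<ge> 1 \<Longrightarrow> c' j k = c j k"
  shows "expands p q u c'"
proof -
  have sums: "(\<Sum>(j, k)\<in>F. c j k * mode p q j k z) = (\<Sum>(j, k)\<in>F. c' j k * mode p q j k z)" if "F \<subseteq> modes" for F z
    using that assms(2) by (intro sum.cong) (auto simp: modes_def)
  have "((\<lambda>F. LINT z|M. (cmod (of_real (u z) - (\<Sum>(j, k)\<in>F. c' j k * mode p q j k z)))\<^sup>2) \<longlongrightarrow> 0)
      (finite_subsets_at_top modes)"
  proof (rule Lim_transform_eventually)
    show "((\<lambda>F. LINT z|M. (cmod (of_real (u z) - (\<Sum>(j, k)\<in>F. c j k * mode p q j k z)))\<^sup>2) \<longlongrightarrow> 0)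
      (finite_subsets_at_top modes)" using assms(1) by (simp add: expands_def)
    show "\<forall>\<^sub>F F in finite_subsets_at_top modes.
      (LINT z|M. (cmod (of_real (u z) - (\<Sum>(j, k)\<in>F. c j k * mode p q j k z)))\<^sup>2) =
      (LINT z|M. (cmod (of_real (u z) - (\<Sum>(j, k)\<in>F. c' j k * mode p q j k z)))\<^sup>2)"
      by (rule eventually_finite_subsets_at_top_weakI) (simp only: sums)
  qed
  moreover have "(\<lambda>(j, k). (cmod (c' j k))\<^sup>2) summable_on modes"
  proof (rule summable_on_cong[THEN iffD1])
    show "(\<lambda>(j, k). (cmod (c j k))\<^sup>2) summable_on modes" using assms(1) by (simp add: expands_def)
    show "(case i of (j, k) \<Rightarrow> (cmod (c j k))\<^sup>2) = (case i of (j, k) \<Rightarrow> (cmod (c' j k))\<^sup>2)" if "i \<in> modes" for i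
      using that assms(2) by (auto simp: modes_def)
  qed
  moreover have "c' j k = cnj (c' j (- k))" if "j \<ge> 1" for j k
  proof -
    have "c j k = cnj (c j (- k))" using assms(1) that unfolding expands_def by blast
    then show ?thesis by (simp only: assms(2)[OF that])
  qed
  moreover have "on_cylinder T u" "u \<in> borel_measurable M" "integrable M (\<lambda>z. (u z)\<^sup>2)"
    using assms(1) by (simp_all add: expands_def)
  ultimately show ?thesis unfolding expands_def by blast
qed

text \<open>The eigenvalue is even in \<open>k\<close>, so the relation between real coefficients
  carries over to the complex ones; the latter agree with the chosen \<open>coeffs\<close> for
  \<open>j \<ge> 1\<close> by uniqueness.\<close>

lemma box_eqI:
  assumes u: "u \<in> sqint M" "on_cylinder T u" and v: "v \<in> sqint M" "on_cylinder T v"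
    and eq: "\<And>j k. j \<ge> 1 \<Longrightarrow>
      (LINT z|M. v z * E j k z) = box_eigenvalue p q j k * (LINT z|M. u z * E j k z)"
  shows "box_eq p q u v"
proof -
  have "expands p q u (coeffs p q u)"
    unfolding coeffs_def by (rule someI[of "expands p q u"]) (rule expands_chat[OF u])
  then have cu: "coeffs p q u j k = chat u j k" if "j \<ge> 1" for j k
    by (rule expands_unique) fact
  have "box_eigenvalue p q j (- k) = box_eigenvalue p q j k" for j k by (simp add: box_eigenvalue_def)
  then have "of_real (box_eigenvalue p q j k) * coeffs p q u j k = chat v j k" if "j \<ge> 1" for j k
    using that by (simp add: cu chat_def Let_def eq complex_eq_iff distrib_left right_diff_distrib)
  then have ex: "expands p q v (\<lambda>j k. of_real (box_eigenvalue p q j k) * coeffs p q u j k)"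
    by (intro expands_cong[OF expands_chat[OF v]])
  moreover have "u \<in> HH p q" using expands_chat[OF u] by (auto simp: HH_def)
  moreover have "(\<lambda>(j, k). (cmod (of_real (box_eigenvalue p q j k) * coeffs p q u j k))\<^sup>2) summable_on modes"
    using ex unfolding expands_def by (elim conjE)
  ultimately show ?thesis unfolding box_eq_def box_domain_def by simp
qed

end

subsection \<open>Existence of weak solutions\<close>

lemma sqint_cong: "(\<And>z. z \<in> space M \<Longrightarrow> u z = v z) \<Longrightarrow> u \<in> sqint M \<longleftrightarrow> v \<in> sqint M"
  unfolding sqint_def by (auto cong: measurable_cong Bochner_Integration.integrable_cong)

text \<open>If the slope exceeded \<open>l\<close>, the line would leave the Lipschitz cone by a
  linearly growing amount; \<open>y\<close> is the point where this exceeds the constants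
  \<open>C + \<bar>F 0\<bar>\<close> by 1.\<close>

lemma slope_le_of_bounded_difference:
  fixes F :: "real \<Rightarrow> real"
  assumes "\<And>y. \<bar>F y - F 0\<bar> \<le> l * \<bar>y\<bar>" "\<And>y. \<bar>F y - g * y\<bar> \<le> C"
  shows "\<bar>g\<bar> \<le> l"
proof (rule ccontr)
  assume "\<not> ?thesis"
  then have d: "\<bar>g\<bar> - l > 0" by simp
  define K where "K = C + \<bar>F 0\<bar> + 1"
  define y where "y = K / (\<bar>g\<bar> - l)"
  have "0 \<le> C" using assms(2)[of 0] by linarith
  then have y: "y > 0" using d by (simp add: y_def K_def)
  have "\<bar>g * y\<bar> \<le> l * \<bar>y\<bar> + C + \<bar>F 0\<bar>" using assms(1)[of y] assms(2)[of y] by linarith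
  then have "(\<bar>g\<bar> - l) * y \<le> C + \<bar>F 0\<bar>" using y by (simp add: abs_mult algebra_simps)
  moreover have "(\<bar>g\<bar> - l) * y = K" using d by (simp add: y_def)
  ultimately show False by (simp add: K_def)
qed

context cylinder
begin

text \<open>Rationality of the period enters here: \<open>q\<^sup>2\<close> times an eigenvalue is
  the integer \<open>(q j - p k) * (q j + p k)\<close>. The condition excludes the eigenvalue 0, so
  both factors are nonzero integers, and a bound on the product bounds each of them, hence
  \<open>j\<close> and \<open>k\<close>.\<close>

lemma finite_small_eigenvalues:
  assumes "b \<noteq> 0"
  shows "finite {i. \<bar>box_eigenvalue p q (Suc (fst i)) (snd i) - b\<bar> < \<bar>b\<bar>}"
proof -
  define R where "R = \<lceil>2 * \<bar>b\<bar> * (real_of_int q)\<^sup>2\<rceil>"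
  have bound: "int j \<le> R \<and> \<bar>k\<bar> \<le> R" if lt: "\<bar>box_eigenvalue p q j k - b\<bar> < \<bar>b\<bar>" for j k
  proof -
    define x y where "x = q * int j - p * k" and "y = q * int j + p * k"
    have q2: "(real_of_int q)\<^sup>2 > 0" using pq_nonzero by simp
    have eig: "box_eigenvalue p q j k * (real_of_int q)\<^sup>2 = of_int (x * y)"
      using pq_nonzero by (simp add: box_eigenvalue_def x_def y_def power2_eq_square field_simps)
    have "box_eigenvalue p q j k \<noteq> 0" "\<bar>box_eigenvalue p q j k\<bar> < 2 * \<bar>b\<bar>" using lt by auto
    then have nz: "x \<noteq> 0" "y \<noteq> 0" and "\<bar>box_eigenvalue p q j k\<bar> * (real_of_int q)\<^sup>2 < 2 * \<bar>b\<bar> * (real_of_int q)\<^sup>2"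
      using eig q2 by auto
    then have "\<bar>real_of_int (x * y)\<bar> < 2 * \<bar>b\<bar> * (real_of_int q)\<^sup>2"
      unfolding eig[symmetric] abs_mult by simp
    then have "real_of_int \<bar>x * y\<bar> \<le> of_int R" unfolding R_def by linarith
    then have xy: "\<bar>x\<bar> * \<bar>y\<bar> \<le> R" by (simp only: of_int_le_iff abs_mult)
    have "\<bar>x\<bar> * 1 \<le> \<bar>x\<bar> * \<bar>y\<bar>" "1 * \<bar>y\<bar> \<le> \<bar>x\<bar> * \<bar>y\<bar>"
      using nz by (intro mult_left_mono mult_right_mono; simp)+
    then have "\<bar>x\<bar> \<le> R" "\<bar>y\<bar> \<le> R" using xy by linarith+
    then have "\<bar>q * int j\<bar> \<le> R" "\<bar>p * k\<bar> \<le> R" by (auto simp: x_def y_def)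
    moreover have "1 * int j \<le> \<bar>q\<bar> * int j" "1 * \<bar>k\<bar> \<le> \<bar>p\<bar> * \<bar>k\<bar>"
      using pq_nonzero by (intro mult_right_mono; simp)+
    ultimately show ?thesis by (simp add: abs_mult)
  qed
  have "{i. \<bar>box_eigenvalue p q (Suc (fst i)) (snd i) - b\<bar> < \<bar>b\<bar>} \<subseteq> {..nat R} \<times> {-R..R}"
  proof
    fix i assume "i \<in> {i. \<bar>box_eigenvalue p q (Suc (fst i)) (snd i) - b\<bar> < \<bar>b\<bar>}"
    then have "int (Suc (fst i)) \<le> R \<and> \<bar>snd i\<bar> \<le> R" by (intro bound) simp
    then show "i \<in> {..nat R} \<times> {-R..R}" by (auto simp: mem_Times_iff)
  qed
  then show ?thesis by (rule finite_subset) simp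
qed

text \<open>Functions obtained from the abstract existence result are only meaningful on the
  fundamental domain, whereas \<open>expands\<close> demands periodicity.\<close>

definition periodic_ext :: "(real \<times> real \<Rightarrow> real) \<Rightarrow> real \<times> real \<Rightarrow> real" where
  "periodic_ext u = (\<lambda>(x, t). u (x, t - T * of_int \<lfloor>t / T\<rfloor>))"

lemma periodic_ext_eq: "z \<in> dom \<Longrightarrow> periodic_ext u z = u z"
proof -
  assume z: "z \<in> dom"
  then have "0 \<le> snd z / T" "snd z / T < 1" using period_pos by (auto simp: dom_def)
  then have "\<lfloor>snd z / T\<rfloor> = 0" by (simp only: floor_eq_iff) simp
  then show ?thesis by (simp add: periodic_ext_def case_prod_beta)
qed

lemma on_cylinder_periodic_ext: "on_cylinder T (periodic_ext u)"
proof -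
  have "(t + T) / T = t / T + 1" for t using period_pos by (simp add: add_divide_distrib)
  then have "t + T - T * of_int \<lfloor>(t + T) / T\<rfloor> = t - T * of_int \<lfloor>t / T\<rfloor>" for t
    by (simp add: algebra_simps)
  then show ?thesis unfolding on_cylinder_def periodic_ext_def prod.case by (intro ballI allI) (simp only:)
qed

lemma dom_subset_strip: "dom \<subseteq> strip"
  by (auto simp: dom_def strip_def)

lemma superposition_measurable:
  assumes f: "continuous_on (strip \<times> UNIV) (\<lambda>(z, y). f z y :: real)" and u: "u \<in> borel_measurable M"
  shows "(\<lambda>z. f z (u z :: real)) \<in> borel_measurable M"
proof -
  have "(\<lambda>z. z) \<in> borel_measurable M" by (rule continuous_measurable) (rule continuous_on_id)
  then have "(\<lambda>z. (z, u z)) \<in> borel_measurable M" using u by (rule borel_measurable_Pair)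
  then have "(\<lambda>z. (z, u z)) \<in> measurable M (restrict_space borel (strip \<times> UNIV))"
    using dom_subset_strip by (intro measurable_restrict_space2) (auto simp: space_M)
  from measurable_compose[OF this borel_measurable_continuous_on_restrict[OF f]]
  show ?thesis by simp
qed

end

theorem theorem4p2:
  fixes T b l c M1 M2 \<sigma> :: real and p q :: int
    and f :: "real \<times> real \<Rightarrow> real \<Rightarrow> real" and g :: "real \<times> real \<Rightarrow> real"
  assumes T: "T > 0" "T = 2 * pi * real_of_int q / real_of_int p" "coprime p q"
    and f_periodic: "on_cylinder T f"
    and f_cont: "continuous_on (strip \<times> UNIV) (\<lambda>(z, u). f z u)"
    and b: "b \<noteq> 0" and l: "0 < l" "l < \<bar>b\<bar>"
    and lipschitz: "\<forall>z\<in>strip. \<forall>u v.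
      \<bar>(f z (u + v) - b * (u + v)) - (f z u - b * u)\<bar> \<le> l * \<bar>v\<bar>"
    and g: "g \<in> Linf p q" "mult_op g \<in> Ls p q (- \<bar>b\<bar>) \<bar>b\<bar>"
    and constants: "M1 > 0" "M2 > 0" "c > 0"
    and bounded: "\<forall>z\<in>strip. \<forall>u. \<bar>(f z u - b * u) - g z * u\<bar> \<le> M1"
    and sign: "\<sigma> = 1 \<or> \<sigma> = - 1"
      "\<forall>z\<in>strip. \<forall>u. u \<notin> {- M2..M2} \<longrightarrow>
        \<sigma> * (((f z u - b * u) - g z * u) * u) \<ge> c * \<bar>u\<bar>"
  shows "\<exists>u. weak_solution p q f u"
proof -
  have period: "period p q = T" using T(2) by (simp add: period_def)
  interpret cylinder p q by unfold_locales (use T(1) period in simp)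
  define F where "F z y = f z y - b * y" for z y
  let ?mu = "\<lambda>i. box_eigenvalue p q (Suc (fst i)) (snd i) - b"
  have z_strip: "z \<in> strip" if "z \<in> space M" for z
    using that dom_subset_strip by (auto simp: space_M)
  have F_lip: "\<bar>F z y - F z y'\<bar> \<le> l * \<bar>y - y'\<bar>" if "z \<in> strip" for z y y'
    using lipschitz[rule_format, OF that, of y' "y - y'"] by (simp add: F_def)
  have F_g: "\<bar>F z y - g z * y\<bar> \<le> M1" if "z \<in> strip" for z y
    using bounded that by (simp add: F_def)
  have "\<exists>u\<in>sqint M. (\<lambda>z. F z (u z)) \<in> sqint M \<and>
    (\<forall>i. ?mu i * (LINT z|M. u z * (nc * E (Suc (fst i)) (snd i) z)) =
      (LINT z|M. F z (u z) * (nc * E (Suc (fst i)) (snd i) z)))"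
  proof (rule B.semilinear_solvable[OF finite_M finite_small_eigenvalues[OF b] less_imp_le[OF l(1)] l(2),
        where g = g and c = c and ?M1.0 = M1 and ?M2.0 = M2 and \<sigma> = \<sigma>])
    show "(\<lambda>z. F z (u z)) \<in> borel_measurable M" if "u \<in> borel_measurable M" for u
      unfolding F_def using superposition_measurable[OF f_cont that] that by simp
    show "\<bar>F z y - F z y'\<bar> \<le> l * \<bar>y - y'\<bar>" if "z \<in> space M" for z y y'
      by (rule F_lip[OF z_strip[OF that]])
    show "g \<in> borel_measurable M" using g(1) by (simp add: Linf_def)
    \<comment> \<open>The bound holds at every point, not only almost everywhere, because it comes
      from the pointwise Lipschitz and distance conditions.\<close>
    show "\<bar>g z\<bar> \<le> l" if "z \<in> space M" for z
      using F_lip[OF z_strip[OF that], of _ 0] F_g[OF z_strip[OF that]]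
      by (intro slope_le_of_bounded_difference[of "F z" l "g z" M1]) simp_all
    show "\<bar>F z y - g z * y\<bar> \<le> M1" if "z \<in> space M" for z y
      by (rule F_g[OF z_strip[OF that]])
    show "\<sigma> * ((F z y - g z * y) * y) \<ge> c * \<bar>y\<bar>" if "z \<in> space M" "\<bar>y\<bar> > M2" for z y
    proof -
      have "y \<notin> {- M2..M2}" using that(2) by auto
      from sign(2)[rule_format, OF z_strip[OF that(1)] this] show ?thesis by (simp only: F_def)
    qed
  qed (use constants sign(1) in auto)
  then obtain u where u: "u \<in> sqint M" "(\<lambda>z. F z (u z)) \<in> sqint M"
    "\<And>i. ?mu i * (LINT z|M. u z * (nc * E (Suc (fst i)) (snd i) z)) =
      (LINT z|M. F z (u z) * (nc * E (Suc (fst i)) (snd i) z))" by blast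
  define v where "v = periodic_ext u"
  have v_eq: "v z = u z" if "z \<in> space M" for z
    using that by (simp add: v_def periodic_ext_eq space_M)
  have v: "v \<in> sqint M" using sqint_cong[of M v u] v_eq u(1) by blast
  have v_per: "on_cylinder (period p q) v" unfolding v_def by (rule on_cylinder_periodic_ext)
  have fu: "(\<lambda>z. f z (u z)) \<in> sqint M"
    using sqint_add[OF u(2) sqint_cmult[OF u(1), of b]] by (simp add: F_def)
  have fv: "(\<lambda>z. f z (v z)) \<in> sqint M"
    using sqint_cong[of M "\<lambda>z. f z (v z)" "\<lambda>z. f z (u z)"] v_eq fu by simp
  have fv_per: "on_cylinder (period p q) (\<lambda>z. f z (v z))"
    using f_periodic v_per by (simp add: on_cylinder_def period)
  have "box_eq p q v (\<lambda>z. f z (v z))"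
  proof (rule box_eqI[OF v v_per fv fv_per])
    fix j :: nat and k assume "j \<ge> 1"
    then obtain n where j: "j = Suc n" by (cases j) auto
    have swap: "x * (nc * y) = nc * (x * y)" for x y by simp
    have "nc * (?mu (n, k) * (LINT z|M. u z * E j k z)) = nc * (LINT z|M. F z (u z) * E j k z)"
      using u(3)[of "(n, k)"] by (simp only: swap integral_mult_right_zero fst_conv snd_conv j mult.left_commute[of _ nc])
    then have "?mu (n, k) * (LINT z|M. u z * E j k z) = (LINT z|M. F z (u z) * E j k z)"
      using nc(1) by simp
    \<comment> \<open>Undoing the shift: adding \<open>b u\<close> to both sides turns
      \<open>mu\<close> and \<open>F\<close> back into the eigenvalue of the wave operator and
      \<open>f\<close>.\<close>
    also have "\<dots> = (LINT z|M. f z (u z) * E j k z - b * (u z * E j k z))"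
      by (simp add: F_def left_diff_distrib mult.assoc)
    also have "\<dots> = (LINT z|M. f z (u z) * E j k z) - b * (LINT z|M. u z * E j k z)"
      using sqint_mult[OF fu E_sqint[of j k]] sqint_mult[OF u(1) E_sqint[of j k]] by simp
    finally have "(LINT z|M. f z (u z) * E j k z) = box_eigenvalue p q j k * (LINT z|M. u z * E j k z)"
      by (simp add: j algebra_simps)
    moreover have "(LINT z|M. f z (v z) * E j k z) = (LINT z|M. f z (u z) * E j k z)"
      "(LINT z|M. v z * E j k z) = (LINT z|M. u z * E j k z)"
      by (rule Bochner_Integration.integral_cong; simp add: v_eq)+
    ultimately show "(LINT z|M. f z (v z) * E j k z) = box_eigenvalue p q j k * (LINT z|M. v z * E j k z)"
      by simp
  qed
  then show ?thesis by (auto simp: weak_solution_def)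
qed

end
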